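(* Let $n\ge 1$ and $\alpha\in\mathbb{R}^n$ with $\alpha_i>-\frac12$ for all $i$. Let $0\le t\le s$. Then there exists a constant $C>0$ such that for every $\varepsilon>0$, $$\|T\|_{H_\alpha^t}\le C\,\varepsilon^{2(s-t)}\,\|T\|_{H_\alpha^s}\qquad\text{for all }T\in H_{\alpha,\varepsilon}^s,$$ where $H_{\alpha,\varepsilon}^s$ is the space of all $T\in H_\alpha^s$ with support contained in the closed ball $\{x\in\mathbb{R}^n:\|x\|\le\varepsilon\}$.
   Context: Fix $n\ge1$ and $\alpha=(\alpha_1,\dots,\alpha_n)\in\mathbb{R}^n$ with $\alpha_i>-\frac12$; $|\alpha|=\alpha_1+\dots+\alpha_n$ and $\|x\|$ is the Euclidean norm. $\mathbb{R}^n_+=\{x\in\mathbb{R}^n: x_1>0,\dots,x_n>0\}$, $d\mu_\alpha(x)=\prod_{i=1}^n x_i^{2\alpha_i+1}dx_i$, and $L^p_\alpha(\mathbb{R}^n_+)=L^p(\mathbb{R}^n_+,d\mu_\alpha)$ (complex-valued functions). A function on $\mathbb{R}^n$ is called even if it is even in each variable. $\mathcal{D}_e(\mathbb{R}^n)$ is the space of even compactly supported $\mathcal{C}^\infty$ functions, $\mathcal{S}_e(\mathbb{R}^n)$ is the space of even Schwartz functions with its usual Fréchet topology, and $\mathcal{S}'_e(\mathbb{R}^n)$ is its topological dual (even tempered distributions). A function $\psi\in L^p_\alpha(\mathbb{R}^n_+)$ is identified with the element of $\mathcal{S}'_e(\mathbb{R}^n)$ given by $\langle\psi,f\rangle=\int_{\mathbb{R}^n_+}\psi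 f\,d\mu_\alpha$. An even smooth function $h$ all of whose derivatives grow at most polynomially acts on $\mathcal{S}'_e(\mathbb{R}^n)$ by $\langle hT,\varphi\rangle=\langle T,h\varphi\rangle$. For $\gamma>-\frac12$, $j_\gamma(t)=\Gamma(\gamma+1)\sum_{k\ge0}\frac{(-1)^k}{k!\,\Gamma(k+\gamma+1)}\left(\frac t2\right)^{2k}$ is the normalized Bessel function. The Fourier-Bessel transform is $\mathcal{F}_\alpha f(\lambda)=\int_{\mathbb{R}^n_+}f(x)\prod_{i=1}^n j_{\alpha_i}(\lambda_ix_i)\,d\mu_\alpha(x)$; it is a topological isomorphism of $\mathcal{S}_e(\mathbb{R}^n)$ with inverse $c_\alpha^2\mathcal{F}_\alpha$, where $c_\alpha=\frac{2^{-|\alpha|}}{\prod_{i=1}^n\Gamma(\alpha_i+1)}$. It is extended to $\mathcal{S}'_e(\mathbb{R}^n)$ by $\langle\mathcal{F}_\alpha(T),\varphi\rangle=\langle T,\mathcal{F}_\alpha(\varphi)\rangle$. For $s\in\mathbb{R}$: $H_\alpha^s=\{T\in\mathcal{S}'_e(\mathbb{R}^n): (1+\|\xi\|^2)^s\mathcal{F}_\alpha(T)\in L^2_\alpha(\mathbb{R}^n_+)\}$, with norm $\|T\|_{H_\alpha^s}=c_\alpha\|(1+\|\xi\|^2)^s\mathcal{F}_\alpha(T)\|_{L^2_\alpha}$. For $T\in\mathcal{S}'_e(\mathbb{R}^n)$, the support of $T$ is contained in the closed ball $B$ centred at $0$ if $\langle T,\varphi\rangle=0$ for every $\varphi\in\mathcal{D}_e(\mathbb{R}^n)$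 vanishing on a neighbourhood of $B$. *)

theory Defs
  imports "HOL-Analysis.Analysis"
begin

section \<open>Even test functions\<close>

definition even_fun :: "(real^'n \<Rightarrow> complex) \<Rightarrow> bool" where
  "even_fun f \<longleftrightarrow> (\<forall>i x. f (\<chi> j. if j = i then - x $ j else x $ j) = f x)"

definition partial_derivative ::
    "'n::finite \<Rightarrow> (real^'n \<Rightarrow> complex) \<Rightarrow> real^'n \<Rightarrow> complex" where
  "partial_derivative i f x = frechet_derivative f (at x) (axis i 1)"

text \<open>Mixed partial derivatives are indexed by the list of directions of differentiation.\<close>

primrec iter_partial ::
    "'n::finite list \<Rightarrow> (real^'n \<Rightarrow> complex) \<Rightarrow> real^'n \<Rightarrow> complex" where
  "iter_partial [] f = f"
| "iter_partial (i # is) f = partial_derivative i (iter_partial is f)"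

definition smooth_fun :: "(real^'n::finite \<Rightarrow> complex) \<Rightarrow> bool" where
  "smooth_fun f \<longleftrightarrow> (\<forall>is x. iter_partial is f differentiable (at x))"

definition D_even :: "(real^'n::finite \<Rightarrow> complex) set" where
  "D_even = {f. smooth_fun f \<and> even_fun f \<and> compact (closure {x. f x \<noteq> 0})}"

definition S_even :: "(real^'n::finite \<Rightarrow> complex) set" where
  "S_even = {f. smooth_fun f \<and> even_fun f \<and>
     (\<forall>k is. bounded (range (\<lambda>x. (1 + norm x) ^ k * norm (iter_partial is f x))))}"

definition schwartz_seminorm ::
    "nat \<Rightarrow> 'n::finite list \<Rightarrow> (real^'n \<Rightarrow> complex) \<Rightarrow> real" where
  "schwartz_seminorm k is f = (SUP x. (1 + norm x) ^ k * norm (iter_partial is f x))"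

definition S_even_topology :: "(real^'n::finite \<Rightarrow> complex) topology" where
  "S_even_topology = topology_generated_by
     {{g \<in> S_even. schwartz_seminorm k is (\<lambda>x. g x - f x) < r} | k is f r.
        f \<in> S_even \<and> 0 < r}"

section \<open>Even tempered distributions\<close>

text \<open>
  A distribution is represented by a functional on all functions, of which only the
  values on \<open>S_even\<close> are relevant.
\<close>

type_synonym 'n functional = "(real^'n \<Rightarrow> complex) \<Rightarrow> complex"

definition tempered_even :: "('n::finite) functional set" where
  "tempered_even = {T.
     (\<forall>f\<in>S_even. \<forall>g\<in>S_even. \<forall>a b. T (\<lambda>x. a * f x + b * g x) = a * T f + b * T g) \<and>
     continuous_map S_even_topology euclidean T}"

definition mult_distr :: "(real^'n \<Rightarrow> complex) \<Rightarrow> 'n::finite functional \<Rightarrow> 'n functional" where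
  "mult_distr h T = (\<lambda>\<phi>. T (\<lambda>x. h x * \<phi> x))"

definition supported_in :: "'n::finite functional \<Rightarrow> (real^'n) set \<Rightarrow> bool" where
  "supported_in T B \<longleftrightarrow>
     (\<forall>\<phi>\<in>D_even. (\<exists>U. open U \<and> B \<subseteq> U \<and> (\<forall>x\<in>U. \<phi> x = 0)) \<longrightarrow> T \<phi> = 0)"

section \<open>The weighted measure and its square-integrable functions\<close>

definition pos_orthant :: "(real^'n::finite) set" where
  "pos_orthant = {x. \<forall>i. 0 < x $ i}"

definition mu :: "real^'n::finite \<Rightarrow> (real^'n) measure" where
  "mu \<alpha> = density (restrict_space lborel pos_orthant)
     (\<lambda>x. ennreal (\<Prod>i\<in>UNIV. (x $ i) powr (2 * \<alpha> $ i + 1)))"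

definition L2 :: "real^'n::finite \<Rightarrow> (real^'n \<Rightarrow> complex) set" where
  "L2 \<alpha> = {\<psi> \<in> borel_measurable (mu \<alpha>). integrable (mu \<alpha>) (\<lambda>x. (norm (\<psi> x))\<^sup>2)}"

definition L2_alpha_norm :: "real^'n::finite \<Rightarrow> (real^'n \<Rightarrow> complex) \<Rightarrow> real" where
  "L2_alpha_norm \<alpha> \<psi> = sqrt (\<integral>x. (norm (\<psi> x))\<^sup>2 \<partial>mu \<alpha>)"

definition distr_of_fun :: "real^'n::finite \<Rightarrow> (real^'n \<Rightarrow> complex) \<Rightarrow> 'n functional" where
  "distr_of_fun \<alpha> \<psi> = (\<lambda>f. \<integral>x. \<psi> x * f x \<partial>mu \<alpha>)"

section \<open>The Fourier-Bessel transform\<close>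

definition bessel_j :: "real \<Rightarrow> real \<Rightarrow> real" where
  "bessel_j \<gamma> t = Gamma (\<gamma> + 1) *
     (\<Sum>k. (-1) ^ k / (fact k * Gamma (real k + \<gamma> + 1)) * (t / 2) ^ (2 * k))"

definition fourier_bessel ::
    "real^'n::finite \<Rightarrow> (real^'n \<Rightarrow> complex) \<Rightarrow> real^'n \<Rightarrow> complex" where
  "fourier_bessel \<alpha> f \<xi> =
     (\<integral>x. f x * complex_of_real (\<Prod>i\<in>UNIV. bessel_j (\<alpha> $ i) (\<xi> $ i * x $ i)) \<partial>mu \<alpha>)"

definition fourier_bessel_distr :: "real^'n::finite \<Rightarrow> 'n functional \<Rightarrow> 'n functional" where
  "fourier_bessel_distr \<alpha> T = (\<lambda>\<phi>. T (fourier_bessel \<alpha> \<phi>))"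

definition c_const :: "real^'n::finite \<Rightarrow> real" where
  "c_const \<alpha> = 2 powr (- (\<Sum>i\<in>UNIV. \<alpha> $ i)) / (\<Prod>i\<in>UNIV. Gamma (\<alpha> $ i + 1))"

section \<open>Sobolev spaces\<close>

definition sobolev_weight :: "real \<Rightarrow> real^'n::finite \<Rightarrow> complex" where
  "sobolev_weight s \<xi> = complex_of_real ((1 + (norm \<xi>)\<^sup>2) powr s)"

text \<open>
  \<open>represents \<alpha> \<psi> T\<close>: the distribution \<open>T\<close> is identified with the function \<open>\<psi>\<close>.
\<close>

definition represents ::
    "real^'n::finite \<Rightarrow> (real^'n \<Rightarrow> complex) \<Rightarrow> 'n functional \<Rightarrow> bool" where
  "represents \<alpha> \<psi> T \<longleftrightarrow> (\<forall>\<phi>\<in>S_even. T \<phi> = distr_of_fun \<alpha> \<psi> \<phi>)"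

definition sobolev :: "real^'n::finite \<Rightarrow> real \<Rightarrow> 'n functional set" where
  "sobolev \<alpha> s = {T \<in> tempered_even. \<exists>\<psi>\<in>L2 \<alpha>.
     represents \<alpha> \<psi> (mult_distr (sobolev_weight s) (fourier_bessel_distr \<alpha> T))}"

text \<open>
  The representing function is unique up to null sets, so the choice does not affect the norm.
  The norm is meaningful only on \<open>sobolev \<alpha> s\<close>.
\<close>

definition sobolev_norm :: "real^'n::finite \<Rightarrow> real \<Rightarrow> 'n functional \<Rightarrow> real" where
  "sobolev_norm \<alpha> s T = c_const \<alpha> * L2_alpha_norm \<alpha> (SOME \<psi>. \<psi> \<in> L2 \<alpha> \<and>
     represents \<alpha> \<psi> (mult_distr (sobolev_weight s) (fourier_bessel_distr \<alpha> T)))"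

definition sobolev_supp :: "real^'n::finite \<Rightarrow> real \<Rightarrow> real \<Rightarrow> 'n functional set" where
  "sobolev_supp \<alpha> s \<epsilon> = {T \<in> sobolev \<alpha> s. supported_in T (cball 0 \<epsilon>)}"

end

theory Submission
  imports Defs
begin

text \<open>
  Write \<open>g\<close> for the Fourier-Bessel transform of \<open>T\<close>; since \<open>s \<ge> 0\<close> it is square-integrable. If \<open>T\<close> is
  supported in the ball of radius \<open>\<epsilon>\<close> and \<open>R = c / \<epsilon>\<close> with a small constant \<open>c\<close>, then at most half of
  the mass of \<open>|g|\<^sup>2\<close> lies in the ball of radius \<open>R\<close>. Hence the mass of \<open>|g|\<^sup>2\<close> is controlled by the part
  outside that ball, where \<open>(1 + |\<xi>|\<^sup>2)\<^sup>t\<close> is at most \<open>(1 + R\<^sup>2)\<^sup>t\<^sup>-\<^sup>s (1 + |\<xi>|\<^sup>2)\<^sup>s\<close>.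

  For the low-frequency bound, pair \<open>g\<close> with \<open>p\<close> times a Gaussian of width \<open>R\<close>. The pairing is
  \<open>T\<close> applied to a transform \<open>q\<close>, and \<open>q\<close> may be multiplied by a cutoff \<open>\<chi>\<close> of width \<open>\<epsilon>\<close>. By Plancherel it
  is at most a constant times \<open>\<parallel>g\<parallel> \<parallel>\<chi> q\<parallel>\<close>, while \<open>\<parallel>\<chi> q\<parallel>\<close> is at most the norm of \<open>\<chi>\<close> times the
  \<open>L\<^sup>1\<close>-norm of the function paired with \<open>g\<close>.

  The general inversion theorem is avoided: all test functions are finite sums of Gaussians, on which
  the transform is explicit. These sums are dense in \<open>L\<^sup>2\<close>, and the products of a cutoff with a Gaussian
  are limits of such sums in the Schwartz topology.
\<close>

section \<open>Even Schwartz functions\<close>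

text \<open>Gaussians carry the argument because they are closed under multiplication and the
  transform sends \<open>gauss a\<close> to a multiple of the Gaussian with exponents
  \<open>1 / (4 * a $ i)\<close>: inversion, symmetry and Plancherel become identities between Gamma
  factors. The price is that \<open>\<chi> q\<close> is no Gaussian sum, so its inverse transform is
  not explicit. Gaussian sums that approximate it in the Schwartz topology control \<open>T\<close>;
  since the errors also have a Gaussian majorant, the same sums converge in the weighted square
  norm. Uniformity in \<open>\<epsilon>\<close> is a scaling effect. The mass of a cutoff of width
  \<open>\<epsilon>\<close> times the mass of a Gaussian of width \<open>R\<close> depends only on
  \<open>\<epsilon> * R = c\<close>: each coordinate contributes \<open>c\<close> to the power
  \<open>2 * (\<alpha> $ i + 1)\<close>, an exponent greater than 1. A small \<open>c\<close>
  therefore makes the low-frequency share small for all \<open>\<epsilon>\<close> at once. The test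
  functions built here are products of functions of the squared coordinates, or sums of such
  products. This makes them even and reduces every Schwartz estimate to one variable
  \<open>r \<ge> 0\<close>.\<close>

lemma partial_derivative_eq:
  fixes f :: "real^'n::finite \<Rightarrow> complex"
  assumes "(f has_derivative f') (at x)"
  shows "partial_derivative i f x = f' (axis i 1)"
  using frechet_derivative_at[OF assms] by (simp add: partial_derivative_def)

lemma has_derivative_of_differentiable:
  assumes "f differentiable (at x)"
  shows "(f has_derivative frechet_derivative f (at x)) (at x)"
  using assms frechet_derivative_works by blast

lemma partial_derivative_add:
  assumes "f differentiable (at x)" "g differentiable (at x)"
  shows "partial_derivative i (\<lambda>x. f x + g x) x = partial_derivative i f x + partial_derivative i g x"
  using partial_derivative_eq[OF has_derivative_add[OF assms[THEN has_derivative_of_differentiable]]]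
  by (simp add: partial_derivative_def)

lemma partial_derivative_mult:
  assumes "f differentiable (at x)" "g differentiable (at x)"
  shows "partial_derivative i (\<lambda>x. f x * g x) x =
    f x * partial_derivative i g x + partial_derivative i f x * g x"
  using partial_derivative_eq[OF has_derivative_mult[OF assms[THEN has_derivative_of_differentiable]]]
  by (simp add: partial_derivative_def)

lemma partial_derivative_const: "partial_derivative i (\<lambda>x. c) = (\<lambda>x. 0)"
  by (rule ext) (simp add: partial_derivative_eq[OF has_derivative_const])

lemma partial_derivative_scale:
  assumes "f differentiable (at x)"
  shows "partial_derivative i (\<lambda>x. c * f x) x = c * partial_derivative i f x"
  using partial_derivative_mult[OF differentiable_const assms]
  by (simp add: partial_derivative_const)

lemma iter_partial_append:
  "iter_partial (is @ js) f = iter_partial is (iter_partial js f)"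
  by (induction "is") auto

lemma smooth_fun_differentiable:
  "smooth_fun f \<Longrightarrow> f differentiable (at x)"
  unfolding smooth_fun_def by (metis iter_partial.simps(1))

lemma smooth_fun_partial_derivative:
  assumes "smooth_fun f"
  shows "smooth_fun (partial_derivative i f)"
proof -
  have "iter_partial is (partial_derivative i f) = iter_partial (is @ [i]) f" for "is"
    by (simp add: iter_partial_append)
  then show ?thesis
    using assms by (simp add: smooth_fun_def)
qed

lemma iter_partial_lincomb:
  assumes "smooth_fun f" "smooth_fun g"
  shows "iter_partial is (\<lambda>x. a * f x + b * g x) =
    (\<lambda>x. a * iter_partial is f x + b * iter_partial is g x)"
proof (induction "is")
  case (Cons i "is")
  have d: "iter_partial is f differentiable (at x)" "iter_partial is g differentiable (at x)" for x
    using assms by (simp_all add: smooth_fun_def)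
  show ?case
    by (rule ext)
      (simp add: Cons partial_derivative_add partial_derivative_scale differentiable_mult d)
qed simp

definition rapidly_decreasing :: "(real^'n::finite \<Rightarrow> complex) \<Rightarrow> bool" where
  "rapidly_decreasing f \<longleftrightarrow> (\<forall>k. \<exists>K. \<forall>x. (1 + norm x) ^ k * norm (f x) \<le> K)"

text \<open>A partial derivative of an even function is odd in that variable, so
  \<open>S_even\<close> is not stable under differentiation. Evenness is split off and the stable
  part is studied alone.\<close>

definition Schwartz :: "(real^'n::finite \<Rightarrow> complex) set" where
  "Schwartz = {f. smooth_fun f \<and> (\<forall>is. rapidly_decreasing (iter_partial is f))}"

lemma bounded_range_norm_iff:
  "bounded (range (\<lambda>x. (1 + norm x) ^ k * norm (h x))) \<longleftrightarrow>
    (\<exists>K. \<forall>x. (1 + norm x) ^ k * norm (h x) \<le> K)"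
  unfolding bounded_iff by (auto simp: abs_mult)

lemma S_even_iff: "f \<in> S_even \<longleftrightarrow> f \<in> Schwartz \<and> even_fun f"
  by (auto simp: S_even_def Schwartz_def rapidly_decreasing_def bounded_range_norm_iff)

text \<open>Membership in a class of functions that is stable under partial derivatives yields bounds
  on all derivatives without any Leibniz formula.\<close>

lemma Schwartz_closed_class:
  assumes "f \<in> X"
    and "\<And>f x. f \<in> X \<Longrightarrow> f differentiable (at x)"
    and "\<And>f i. f \<in> X \<Longrightarrow> partial_derivative i f \<in> X"
    and "\<And>f. f \<in> X \<Longrightarrow> rapidly_decreasing f"
  shows "f \<in> Schwartz"
proof -
  have "iter_partial is f \<in> X" for "is"
    by (induction "is") (auto simp: assms)
  then show ?thesis
    using assms by (auto simp: Schwartz_def smooth_fun_def)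
qed

lemma
  assumes "f \<in> Schwartz"
  shows Schwartz_differentiable: "f differentiable (at x)"
    and Schwartz_partial_derivative: "partial_derivative i f \<in> Schwartz"
    and Schwartz_rapidly_decreasing: "rapidly_decreasing f"
proof -
  show "f differentiable (at x)"
    using assms by (simp add: Schwartz_def smooth_fun_differentiable)
  show "rapidly_decreasing f"
    using assms unfolding Schwartz_def by (metis (no_types, lifting) iter_partial.simps(1) mem_Collect_eq)
  have "iter_partial is (partial_derivative i f) = iter_partial (is @ [i]) f" for "is"
    by (simp add: iter_partial_append)
  then show "partial_derivative i f \<in> Schwartz"
    using assms by (simp add: Schwartz_def smooth_fun_partial_derivative)
qed

lemma rapidly_decreasing_add:
  assumes "rapidly_decreasing f" "rapidly_decreasing g"
  shows "rapidly_decreasing (\<lambda>x. f x + g x)"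
  unfolding rapidly_decreasing_def
proof
  fix k
  obtain K L where "\<And>x. (1 + norm x) ^ k * norm (f x) \<le> K" "\<And>x. (1 + norm x) ^ k * norm (g x) \<le> L"
    using assms unfolding rapidly_decreasing_def by metis
  moreover have "(1 + norm x) ^ k * norm (f x + g x) \<le>
      (1 + norm x) ^ k * norm (f x) + (1 + norm x) ^ k * norm (g x)" for x
    unfolding distrib_left[symmetric] by (intro mult_left_mono norm_triangle_ineq) auto
  ultimately show "\<exists>K. \<forall>x. (1 + norm x) ^ k * norm (f x + g x) \<le> K"
    by (intro exI[of _ "K + L"] allI) (meson add_mono order_trans)
qed

lemma rapidly_decreasing_scale:
  assumes "rapidly_decreasing f"
  shows "rapidly_decreasing (\<lambda>x. c * f x)"
  unfolding rapidly_decreasing_def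
proof
  fix k
  obtain K where "\<And>x. (1 + norm x) ^ k * norm (f x) \<le> K"
    using assms unfolding rapidly_decreasing_def by metis
  then have "norm c * ((1 + norm x) ^ k * norm (f x)) \<le> norm c * K" for x
    by (intro mult_left_mono) auto
  then show "\<exists>K. \<forall>x. (1 + norm x) ^ k * norm (c * f x) \<le> K"
    by (intro exI[of _ "norm c * K"] allI) (simp add: norm_mult mult_ac)
qed

lemma Schwartz_lincomb:
  assumes "f \<in> Schwartz" "g \<in> Schwartz"
  shows "(\<lambda>x. a * f x + b * g x) \<in> Schwartz"
proof (rule Schwartz_closed_class)
  let ?X = "{(\<lambda>x. a * f x + b * g x) | f g. f \<in> Schwartz \<and> g \<in> Schwartz}"
  show "(\<lambda>x. a * f x + b * g x) \<in> ?X"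
    using assms by blast
  fix h assume "h \<in> ?X"
  then obtain f g where h: "h = (\<lambda>x. a * f x + b * g x)" "f \<in> Schwartz" "g \<in> Schwartz"
    by blast
  show "h differentiable (at x)" for x
    unfolding h by (intro differentiable_add differentiable_mult differentiable_const
        Schwartz_differentiable h)
  have "partial_derivative i h = (\<lambda>x. a * partial_derivative i f x + b * partial_derivative i g x)" for i
    unfolding h by (rule ext)
      (simp add: partial_derivative_add partial_derivative_scale differentiable_mult
        Schwartz_differentiable h)
  then show "partial_derivative i h \<in> ?X" for i
    using Schwartz_partial_derivative h by blast
  show "rapidly_decreasing h"
    unfolding h by (intro rapidly_decreasing_add rapidly_decreasing_scale Schwartz_rapidly_decreasing h)
qed

lemma S_even_lincomb:
  assumes "f \<in> S_even" "g \<in> S_even"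
  shows "(\<lambda>x. a * f x + b * g x) \<in> S_even"
  using assms Schwartz_lincomb by (auto simp: S_even_iff even_fun_def)

lemma S_even_diff:
  assumes "f \<in> S_even" "g \<in> S_even"
  shows "(\<lambda>x. f x - g x) \<in> S_even"
  using S_even_lincomb[OF assms, of 1 "-1"] by simp

lemma S_even_zero: "(\<lambda>x. 0) \<in> (S_even :: (real^'n::finite \<Rightarrow> complex) set)"
proof -
  have "(\<lambda>x. 0) \<in> (Schwartz :: (real^'n \<Rightarrow> complex) set)"
    by (rule Schwartz_closed_class[of _ "{\<lambda>x. 0}"])
      (auto simp: partial_derivative_const rapidly_decreasing_def)
  then show ?thesis
    by (simp add: S_even_iff even_fun_def)
qed

subsection \<open>Multipliers\<close>

text \<open>A partial derivative of \<open>sobolev_weight s\<close> is a scalar times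
  \<open>sobolev_weight (s - 1)\<close> times a coordinate. The class is built to contain the
  weights, to be stable under partial derivatives and to grow at most polynomially.\<close>

inductive_set Mult_class :: "(real^'n::finite \<Rightarrow> complex) set" where
  weight: "sobolev_weight s \<in> Mult_class"
| coord: "(\<lambda>x. complex_of_real (x $ i)) \<in> Mult_class"
| const: "(\<lambda>x. c) \<in> Mult_class"
| mult: "f \<in> Mult_class \<Longrightarrow> g \<in> Mult_class \<Longrightarrow> (\<lambda>x. f x * g x) \<in> Mult_class"
| add: "f \<in> Mult_class \<Longrightarrow> g \<in> Mult_class \<Longrightarrow> (\<lambda>x. f x + g x) \<in> Mult_class"

lemma sobolev_weight_has_derivative:
  fixes x :: "real^'n::finite"
  shows "(sobolev_weight s has_derivative
    (\<lambda>h. complex_of_real (2 * s * (1 + (norm x)\<^sup>2) powr (s - 1) * (x \<bullet> h)))) (at x)"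
proof -
  have pos: "1 + x \<bullet> x > 0"
    by (smt (verit) inner_ge_zero)
  have "((\<lambda>x. (1 + x \<bullet> x) powr s) has_derivative
    (\<lambda>h. 2 * s * (1 + x \<bullet> x) powr (s - 1) * (x \<bullet> h))) (at x)"
    using pos by (auto intro!: derivative_eq_intros simp: inner_commute powr_diff field_simps)
  then show ?thesis
    unfolding sobolev_weight_def power2_norm_eq_inner by (rule has_derivative_of_real)
qed

lemma Mult_class_partial:
  fixes f :: "real^'n::finite \<Rightarrow> complex"
  assumes "f \<in> Mult_class"
  shows "(\<forall>x. f differentiable (at x)) \<and> (\<forall>i. partial_derivative i f \<in> Mult_class)"
  using assms
proof induction
  case (weight s)
  have "partial_derivative i (sobolev_weight s) =
      (\<lambda>x::real^'n. complex_of_real (2 * s) * (sobolev_weight (s - 1) x * complex_of_real (x $ i)))" for i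
    by (rule ext) (simp add: partial_derivative_eq[OF sobolev_weight_has_derivative]
        sobolev_weight_def inner_axis)
  then show ?case
    using sobolev_weight_has_derivative[of s]
    by (auto simp: differentiable_def intro!: Mult_class.intros)
next
  case (coord j)
  have d: "((\<lambda>x. complex_of_real (x $ j)) has_derivative (\<lambda>h. complex_of_real (h $ j))) (at x)" for x :: "real^'n"
    by (intro has_derivative_of_real bounded_linear_imp_has_derivative bounded_linear_vec_nth)
  have "partial_derivative i (\<lambda>x::real^'n. complex_of_real (x $ j)) = (\<lambda>x. if j = i then 1 else 0)" for i
    by (rule ext) (simp add: partial_derivative_eq[OF d] axis_def)
  then show ?case
    using d by (auto simp: differentiable_def intro!: Mult_class.intros)
next
  case (const c)
  then show ?case by (auto simp: partial_derivative_const intro: Mult_class.intros)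
next
  case (mult f g)
  have "partial_derivative i (\<lambda>x. f x * g x) =
      (\<lambda>x. f x * partial_derivative i g x + partial_derivative i f x * g x)" for i
    by (rule ext) (simp add: partial_derivative_mult mult)
  then show ?case
    using mult by (auto intro!: Mult_class.intros differentiable_mult)
next
  case (add f g)
  have "partial_derivative i (\<lambda>x. f x + g x) =
      (\<lambda>x. partial_derivative i f x + partial_derivative i g x)" for i
    by (rule ext) (simp add: partial_derivative_add add)
  then show ?case
    using add by (auto intro!: Mult_class.intros differentiable_add)
qed

lemma one_plus_square_powr_le:
  fixes r :: real
  assumes "0 \<le> r"
  shows "(1 + r\<^sup>2) powr s \<le> (1 + r) ^ (2 * nat \<lceil>\<bar>s\<bar>\<rceil>)"
proof -
  have "(1 + r\<^sup>2) powr s \<le> (1 + r\<^sup>2) powr (real (nat \<lceil>\<bar>s\<bar>\<rceil>))"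
    by (intro powr_mono) (linarith | simp)+
  also have "\<dots> = (1 + r\<^sup>2) ^ nat \<lceil>\<bar>s\<bar>\<rceil>"
    by (intro powr_realpow) (simp add: add_pos_nonneg)
  also have "\<dots> \<le> ((1 + r)\<^sup>2) ^ nat \<lceil>\<bar>s\<bar>\<rceil>"
    using assms by (intro power_mono) (auto simp: power2_sum)
  finally show ?thesis
    by (simp add: power_mult)
qed

lemma Mult_class_growth:
  fixes f :: "real^'n::finite \<Rightarrow> complex"
  assumes "f \<in> Mult_class"
  shows "\<exists>K N. 0 \<le> K \<and> (\<forall>x. norm (f x) \<le> K * (1 + norm x) ^ N)"
  using assms
proof induction
  case (weight s)
  then show ?case
    using one_plus_square_powr_le[OF norm_ge_zero]
    by (intro exI[of _ 1] exI[of _ "2 * nat \<lceil>\<bar>s\<bar>\<rceil>"]) (auto simp: sobolev_weight_def)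
next
  case (coord i)
  have "\<bar>x $ i\<bar> \<le> 1 + norm x" for x :: "real^'n"
    using component_le_norm_cart[of x i] by linarith
  then show ?case
    by (intro exI[of _ 1] exI[of _ 1]) auto
next
  case (const c)
  then show ?case by (intro exI[of _ "norm c"] exI[of _ 0]) auto
next
  case (mult f g)
  then obtain K N L M where *: "0 \<le> K" "0 \<le> L" "\<And>x. norm (f x) \<le> K * (1 + norm x) ^ N"
    "\<And>x. norm (g x) \<le> L * (1 + norm x) ^ M"
    by blast
  have "norm (f x * g x) \<le> (K * (1 + norm x) ^ N) * (L * (1 + norm x) ^ M)" for x
    unfolding norm_mult by (intro mult_mono *) (simp_all add: *)
  then show ?case
    using * by (intro exI[of _ "K * L"] exI[of _ "N + M"]) (auto simp: power_add mult_ac)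
next
  case (add f g)
  then obtain K N L M where *: "0 \<le> K" "0 \<le> L" "\<And>x. norm (f x) \<le> K * (1 + norm x) ^ N"
    "\<And>x. norm (g x) \<le> L * (1 + norm x) ^ M"
    by blast
  have "norm (f x + g x) \<le> (K + L) * (1 + norm x) ^ (max N M)" for x
  proof -
    have "norm (f x + g x) \<le> K * (1 + norm x) ^ N + L * (1 + norm x) ^ M"
      by (rule norm_triangle_le) (intro add_mono *)
    also have "\<dots> \<le> K * (1 + norm x) ^ max N M + L * (1 + norm x) ^ max N M"
      by (intro add_mono mult_left_mono power_increasing *) auto
    finally show ?thesis by (simp add: algebra_simps)
  qed
  then show ?case
    using * by (intro exI[of _ "K + L"] exI[of _ "max N M"]) auto
qed

text \<open>The product rule turns a multiplier times a Schwartz function into a sum of two such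
  products. Closing under sums gives a class to which \<open>Schwartz_closed_class\<close>
  applies.\<close>

inductive_set Mult_Schwartz :: "(real^'n::finite \<Rightarrow> complex) set" where
  base: "m \<in> Mult_class \<Longrightarrow> f \<in> Schwartz \<Longrightarrow> (\<lambda>x. m x * f x) \<in> Mult_Schwartz"
| add: "f \<in> Mult_Schwartz \<Longrightarrow> g \<in> Mult_Schwartz \<Longrightarrow> (\<lambda>x. f x + g x) \<in> Mult_Schwartz"

lemma Mult_Schwartz_partial:
  fixes f :: "real^'n::finite \<Rightarrow> complex"
  assumes "f \<in> Mult_Schwartz"
  shows "(\<forall>x. f differentiable (at x)) \<and> (\<forall>i. partial_derivative i f \<in> Mult_Schwartz) \<and>
    rapidly_decreasing f"
  using assms
proof induction
  case (base m f)
  note d = Mult_class_partial[OF base(1), THEN conjunct1, rule_format]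
    Schwartz_differentiable[OF base(2)]
  have "partial_derivative i (\<lambda>x. m x * f x) =
      (\<lambda>x. m x * partial_derivative i f x + partial_derivative i m x * f x)" for i
    by (rule ext) (simp add: partial_derivative_mult d)
  moreover have "rapidly_decreasing (\<lambda>x. m x * f x)"
    unfolding rapidly_decreasing_def
  proof
    fix k
    obtain K N where m: "0 \<le> K" "\<And>x. norm (m x) \<le> K * (1 + norm x) ^ N"
      using Mult_class_growth[OF base(1)] by blast
    obtain L where L: "\<And>x. (1 + norm x) ^ (k + N) * norm (f x) \<le> L"
      using Schwartz_rapidly_decreasing[OF base(2)] unfolding rapidly_decreasing_def by blast
    have "(1 + norm x) ^ k * norm (m x * f x) \<le> K * L" for x
    proof -
      have "(1 + norm x) ^ k * norm (m x * f x) \<le>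
          (1 + norm x) ^ k * ((K * (1 + norm x) ^ N) * norm (f x))"
        unfolding norm_mult by (intro mult_left_mono mult_right_mono m) auto
      also have "\<dots> = K * ((1 + norm x) ^ (k + N) * norm (f x))"
        by (simp add: power_add)
      also have "\<dots> \<le> K * L"
        by (intro mult_left_mono L m)
      finally show ?thesis .
    qed
    then show "\<exists>K. \<forall>x. (1 + norm x) ^ k * norm (m x * f x) \<le> K" by blast
  qed
  ultimately show ?case
    using d Mult_class_partial[OF base(1)] Schwartz_partial_derivative[OF base(2)] base
    by (auto intro!: differentiable_mult Mult_Schwartz.intros)
next
  case (add f g)
  have "partial_derivative i (\<lambda>x. f x + g x) =
      (\<lambda>x. partial_derivative i f x + partial_derivative i g x)" for i
    by (rule ext) (simp add: partial_derivative_add add)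
  then show ?case
    using add by (auto intro!: Mult_Schwartz.intros differentiable_add rapidly_decreasing_add)
qed

lemma sobolev_weight_mult_S_even:
  fixes f :: "real^'n::finite \<Rightarrow> complex"
  assumes "f \<in> S_even"
  shows "(\<lambda>x. sobolev_weight s x * f x) \<in> S_even"
proof -
  have "(\<lambda>x. sobolev_weight s x * f x) \<in> Schwartz"
  proof (rule Schwartz_closed_class)
    show "(\<lambda>x. sobolev_weight s x * f x) \<in> Mult_Schwartz"
      using assms by (auto simp: S_even_iff intro!: Mult_Schwartz.intros Mult_class.intros)
  qed (use Mult_Schwartz_partial in auto)
  moreover have "norm (\<chi> j. if j = i then - x $ j else x $ j) = norm x" for i and x :: "real^'n"
    by (auto simp: norm_vec_def L2_set_def intro!: arg_cong[where f = sqrt] sum.cong)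
  ultimately show ?thesis
    using assms by (simp add: S_even_iff even_fun_def sobolev_weight_def)
qed

subsection \<open>Sequential continuity of tempered distributions\<close>

lemma schwartz_seminorm_le:
  assumes "\<And>x. (1 + norm x) ^ k * norm (iter_partial is f x) \<le> K"
  shows "schwartz_seminorm k is f \<le> K"
  unfolding schwartz_seminorm_def by (rule cSUP_least) (auto simp: assms)

lemma schwartz_seminorm_upper:
  assumes "f \<in> S_even"
  shows "(1 + norm x) ^ k * norm (iter_partial is f x) \<le> schwartz_seminorm k is f"
proof -
  have "bdd_above (range (\<lambda>x. (1 + norm x) ^ k * norm (iter_partial is f x)))"
    using assms by (auto simp: S_even_def intro: bounded_imp_bdd_above)
  then show ?thesis
    unfolding schwartz_seminorm_def by (rule cSUP_upper[OF UNIV_I])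
qed

lemma S_even_smooth: "f \<in> S_even \<Longrightarrow> smooth_fun f"
  by (simp add: S_even_def)

lemma schwartz_seminorm_triangle:
  assumes "f \<in> S_even" "g \<in> S_even" "h \<in> S_even"
  shows "schwartz_seminorm k is (\<lambda>x. f x - h x) \<le>
    schwartz_seminorm k is (\<lambda>x. f x - g x) + schwartz_seminorm k is (\<lambda>x. g x - h x)"
proof (rule schwartz_seminorm_le)
  fix x
  have d: "(\<lambda>x. f x - g x) \<in> S_even" "(\<lambda>x. g x - h x) \<in> S_even"
    by (intro S_even_diff assms)+
  have "iter_partial is (\<lambda>x. f x - h x) = (\<lambda>x. iter_partial is (\<lambda>x. f x - g x) x + iter_partial is (\<lambda>x. g x - h x) x)"
    using iter_partial_lincomb[OF d[THEN S_even_smooth], of "is" 1 1] by simp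
  then have "(1 + norm x) ^ k * norm (iter_partial is (\<lambda>x. f x - h x) x) \<le>
      (1 + norm x) ^ k * (norm (iter_partial is (\<lambda>x. f x - g x) x) + norm (iter_partial is (\<lambda>x. g x - h x) x))"
    by (intro mult_left_mono) (auto intro: norm_triangle_ineq)
  also have "\<dots> \<le> schwartz_seminorm k is (\<lambda>x. f x - g x) + schwartz_seminorm k is (\<lambda>x. g x - h x)"
    unfolding distrib_left by (intro add_mono schwartz_seminorm_upper d)
  finally show "(1 + norm x) ^ k * norm (iter_partial is (\<lambda>x. f x - h x) x) \<le> \<dots>" .
qed

lemma topspace_S_even_topology: "topspace S_even_topology = S_even"
proof -
  have "f \<in> topspace S_even_topology" if "f \<in> S_even" for f :: "real^'n \<Rightarrow> complex"
  proof -
    let ?B = "{g \<in> S_even. schwartz_seminorm 0 [] (\<lambda>x. g x - f x) < 1}"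
    have "?B \<in> {{g \<in> S_even. schwartz_seminorm k is (\<lambda>x. g x - f x) < r} | k is f r. f \<in> S_even \<and> 0 < r}"
      using that zero_less_one by blast
    moreover have "schwartz_seminorm 0 [] (\<lambda>x. f x - f x) \<le> 0"
      by (rule schwartz_seminorm_le) simp
    then have "f \<in> ?B"
      using that by auto
    ultimately show ?thesis
      unfolding S_even_topology_def topology_generated_by_topspace by (rule UnionI)
  qed
  then show ?thesis
    unfolding S_even_topology_def topology_generated_by_topspace by auto
qed

lemma S_even_topology_eventually_in_open:
  assumes f: "f \<in> S_even" and F: "\<And>n. F n \<in> S_even"
    and lim: "\<And>k is. (\<lambda>n. schwartz_seminorm k is (\<lambda>x. F n x - f x)) \<longlonglongrightarrow> 0"
    and U: "openin S_even_topology U" "f \<in> U"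
  shows "eventually (\<lambda>n. F n \<in> U) sequentially"
  using U(1)[unfolded S_even_topology_def openin_topology_generated_by_iff] U(2)
proof (induction rule: generate_topology_on.induct)
  case (Int a b)
  then show ?case by (simp add: eventually_conj)
next
  case (UN K)
  then obtain k where "k \<in> K" "f \<in> k" by blast
  with UN.IH have "eventually (\<lambda>n. F n \<in> k) sequentially" by blast
  then show ?case
    by (rule eventually_mono) (use \<open>k \<in> K\<close> in blast)
next
  case (Basis s)
  then obtain k "is" h r where s: "s = {g \<in> S_even. schwartz_seminorm k is (\<lambda>x. g x - h x) < r}"
    "h \<in> S_even" by blast
  with Basis have "schwartz_seminorm k is (\<lambda>x. f x - h x) < r" by blast
  \<comment> \<open>The subbasic balls are centred at arbitrary functions \<open>h\<close>; the
    triangle inequality leaves exactly this radius around \<open>f\<close>.\<close>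
  then have "eventually (\<lambda>n. schwartz_seminorm k is (\<lambda>x. F n x - f x) < r - schwartz_seminorm k is (\<lambda>x. f x - h x)) sequentially"
    using lim by (intro order_tendstoD) auto
  then show ?case
  proof (rule eventually_mono)
    fix n assume "schwartz_seminorm k is (\<lambda>x. F n x - f x) < r - schwartz_seminorm k is (\<lambda>x. f x - h x)"
    with schwartz_seminorm_triangle[OF F f s(2), of k "is" n] show "F n \<in> s"
      using F s by auto
  qed
qed simp

text \<open>Continuity of \<open>T\<close> enters the development only through this sequential
  form.\<close>

lemma tempered_even_tendsto:
  assumes T: "T \<in> tempered_even" and f: "f \<in> S_even" and F: "\<And>n. F n \<in> S_even"
    and lim: "\<And>k is. (\<lambda>n. schwartz_seminorm k is (\<lambda>x. F n x - f x)) \<longlonglongrightarrow> 0"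
  shows "(\<lambda>n. T (F n)) \<longlonglongrightarrow> T f"
proof (rule topological_tendstoI)
  fix S :: "complex set" assume "open S" "T f \<in> S"
  have "openin S_even_topology {g \<in> topspace S_even_topology. T g \<in> S}"
    using T \<open>open S\<close> unfolding tempered_even_def by (auto intro: openin_continuous_map_preimage)
  from S_even_topology_eventually_in_open[OF f F lim this]
  show "eventually (\<lambda>n. T (F n) \<in> S) sequentially"
    using f \<open>T f \<in> S\<close> by (auto simp: topspace_S_even_topology elim: eventually_mono)
qed

lemma tempered_even_lincomb:
  assumes "T \<in> tempered_even" "f \<in> S_even" "g \<in> S_even"
  shows "T (\<lambda>x. a * f x + b * g x) = a * T f + b * T g"
  using assms by (auto simp: tempered_even_def)

lemma tempered_even_add:
  assumes "T \<in> tempered_even" "f \<in> S_even" "g \<in> S_even"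
  shows "T (\<lambda>x. f x + g x) = T f + T g"
  using tempered_even_lincomb[OF assms, of 1 1] by simp

lemma tempered_even_scale:
  assumes "T \<in> tempered_even" "f \<in> S_even"
  shows "T (\<lambda>x. c * f x) = c * T f"
  using tempered_even_lincomb[OF assms(1,2) S_even_zero, of c 0] by simp

section \<open>Products of functions of the squared coordinates\<close>

text \<open>A function travels together with all its derivatives, \<open>d m\<close> being the
  derivative of order \<open>m\<close>. Decay and convergence of every order then become statements
  about the family.\<close>

definition deriv_family :: "(nat \<Rightarrow> real \<Rightarrow> real) \<Rightarrow> bool" where
  "deriv_family d \<longleftrightarrow> (\<forall>m t. (d m has_real_derivative d (Suc m) t) (at t))"

definition exp_decay :: "real \<Rightarrow> (nat \<Rightarrow> real \<Rightarrow> real) \<Rightarrow> bool" where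
  "exp_decay b d \<longleftrightarrow> (\<forall>m. \<exists>K. \<forall>r\<ge>0. \<bar>d m r\<bar> \<le> K * exp (- b * r))"

text \<open>The restriction \<open>m \<le> k\<close> reflects the construction in
  \<open>exp_sum_approx\<close>, where the approximant with index \<open>k\<close> matches only the
  derivatives up to order \<open>k\<close>. Only \<open>r \<ge> 0\<close> occurs because
  \<open>r\<close> stands for a squared coordinate.\<close>

definition exp_conv :: "real \<Rightarrow> (nat \<Rightarrow> nat \<Rightarrow> real \<Rightarrow> real) \<Rightarrow> (nat \<Rightarrow> real \<Rightarrow> real) \<Rightarrow> bool" where
  "exp_conv b D d \<longleftrightarrow>
    (\<forall>m. \<exists>K. \<forall>k\<ge>m. \<forall>r\<ge>0. \<bar>D k m r - d m r\<bar> \<le> K / real (Suc k) * exp (- b * r))"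

lemma deriv_familyD: "deriv_family d \<Longrightarrow> (d m has_real_derivative d (Suc m) t) (at t)"
  by (simp add: deriv_family_def)

lemma power_le_exp:
  fixes t :: real
  assumes "0 \<le> t"
  shows "t ^ N \<le> fact N * exp t"
proof -
  have "(\<Sum>n\<in>{N}. t ^ n /\<^sub>R fact n) \<le> (\<Sum>n. t ^ n /\<^sub>R fact n)"
    by (rule sum_le_suminf[OF summable_exp_generic]) (use assms in auto)
  then show ?thesis
    by (simp add: exp_def field_simps)
qed

lemma power_le_exp_square:
  fixes b t :: real
  assumes "0 < b"
  shows "(1 + \<bar>t\<bar>) ^ N \<le> fact N * exp (1 + 1 / b) * exp (b * t\<^sup>2)"
proof -
  \<comment> \<open>If \<open>\<bar>t\<bar>\<close> exceeds \<open>1 / b\<close>, then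
    \<open>b * \<bar>t\<bar>\<close> exceeds 1 and the quadratic term alone suffices.\<close>
  have "\<bar>t\<bar> \<le> 1 / b + b * t\<^sup>2"
  proof (cases "\<bar>t\<bar> \<le> 1 / b")
    case True
    then show ?thesis using assms by (simp add: add_increasing2)
  next
    case False
    then have "1 * \<bar>t\<bar> \<le> (b * \<bar>t\<bar>) * \<bar>t\<bar>"
      using assms by (intro mult_right_mono) (auto simp: field_simps)
    then show ?thesis using assms by (simp add: power2_eq_square mult.assoc add_increasing)
  qed
  then have "exp (1 + \<bar>t\<bar>) \<le> exp (1 + 1 / b) * exp (b * t\<^sup>2)"
    unfolding exp_add[symmetric] by simp
  moreover have "(1 + \<bar>t\<bar>) ^ N \<le> fact N * exp (1 + \<bar>t\<bar>)"
    by (rule power_le_exp) simp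
  ultimately show ?thesis
    by (smt (verit, best) fact_gt_zero mult.assoc mult_left_mono)
qed

subsection \<open>Derivatives of \<open>t \<mapsto> u (t\<^sup>2)\<close>\<close>

text \<open>The derivative of order \<open>m\<close> of \<open>u (t\<^sup>2)\<close> is a
  combination of the derivatives of \<open>u\<close> at \<open>t\<^sup>2\<close> with polynomial
  coefficients in \<open>t\<close>. The recursion is the product rule together with the inner
  derivative \<open>[:0, 2:]\<close>.\<close>

fun sq_coeff :: "nat \<Rightarrow> nat \<Rightarrow> real poly" where
  "sq_coeff 0 j = (if j = 0 then 1 else 0)"
| "sq_coeff (Suc m) 0 = pderiv (sq_coeff m 0)"
| "sq_coeff (Suc m) (Suc j) = pderiv (sq_coeff m (Suc j)) + [:0, 2:] * sq_coeff m j"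

definition sq_family :: "(nat \<Rightarrow> real \<Rightarrow> real) \<Rightarrow> nat \<Rightarrow> real \<Rightarrow> real" where
  "sq_family u m t = (\<Sum>j\<le>m. poly (sq_coeff m j) t * u j (t\<^sup>2))"

lemma sq_coeff_eq_0: "m < j \<Longrightarrow> sq_coeff m j = 0"
proof (induction m arbitrary: j)
  case (Suc m)
  then obtain i where "j = Suc i" by (cases j) auto
  with Suc show ?case by simp
qed simp

lemma deriv_family_sq_family:
  assumes "deriv_family u"
  shows "deriv_family (sq_family u)"
  unfolding deriv_family_def
proof (intro allI)
  fix m t
  have "(sq_family u m has_real_derivative
      (\<Sum>j\<le>m. poly (pderiv (sq_coeff m j)) t * u j (t\<^sup>2) +
        poly (sq_coeff m j) t * (u (Suc j) (t\<^sup>2) * (2 * t)))) (at t)"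
    unfolding sq_family_def
  proof (intro DERIV_sum)
    fix j
    have "((\<lambda>t. u j (t\<^sup>2)) has_real_derivative u (Suc j) (t\<^sup>2) * (2 * t)) (at t)"
      by (rule DERIV_chain2[OF deriv_familyD[OF assms]]) (auto intro!: derivative_eq_intros)
    from DERIV_mult[OF poly_DERIV this]
    show "((\<lambda>t. poly (sq_coeff m j) t * u j (t\<^sup>2)) has_real_derivative
        poly (pderiv (sq_coeff m j)) t * u j (t\<^sup>2) + poly (sq_coeff m j) t * (u (Suc j) (t\<^sup>2) * (2 * t))) (at t)"
      by (simp add: mult_ac add_ac)
  qed
  \<comment> \<open>The first sum may be extended to \<open>Suc m\<close> because
    \<open>sq_coeff m (Suc m)\<close> is zero; this matches the index range of the next member of
    the family.\<close>
  also have "(\<Sum>j\<le>m. poly (pderiv (sq_coeff m j)) t * u j (t\<^sup>2) +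
        poly (sq_coeff m j) t * (u (Suc j) (t\<^sup>2) * (2 * t))) =
      (\<Sum>j\<le>Suc m. poly (pderiv (sq_coeff m j)) t * u j (t\<^sup>2)) +
      (\<Sum>j\<le>m. poly ([:0, 2:] * sq_coeff m j) t * u (Suc j) (t\<^sup>2))"
    by (simp add: sum.distrib sq_coeff_eq_0 algebra_simps)
  also have "\<dots> = sq_family u (Suc m) t"
    unfolding sq_family_def sum.atMost_Suc_shift
    by (simp add: sum.distrib algebra_simps)
  finally show "(sq_family u m has_real_derivative sq_family u (Suc m) t) (at t)" .
qed

lemma sq_family_0: "sq_family u 0 t = u 0 (t\<^sup>2)"
  by (simp add: sq_family_def)

lemma poly_le_power:
  fixes p :: "real poly"
  shows "\<exists>K\<ge>0. \<forall>t. \<bar>poly p t\<bar> \<le> K * (1 + \<bar>t\<bar>) ^ degree p"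
proof -
  have "\<bar>poly p t\<bar> \<le> (\<Sum>i\<le>degree p. \<bar>coeff p i\<bar>) * (1 + \<bar>t\<bar>) ^ degree p" for t
  proof -
    have "\<bar>poly p t\<bar> \<le> (\<Sum>i\<le>degree p. \<bar>coeff p i * t ^ i\<bar>)"
      unfolding poly_altdef by (rule sum_abs)
    also have "\<dots> \<le> (\<Sum>i\<le>degree p. \<bar>coeff p i\<bar> * (1 + \<bar>t\<bar>) ^ degree p)"
    proof (rule sum_mono)
      fix i assume "i \<in> {..degree p}"
      then have "\<bar>t\<bar> ^ i \<le> (1 + \<bar>t\<bar>) ^ degree p"
        by (intro order_trans[OF power_mono[of "\<bar>t\<bar>" "1 + \<bar>t\<bar>" i]] power_increasing) auto
      then show "\<bar>coeff p i * t ^ i\<bar> \<le> \<bar>coeff p i\<bar> * (1 + \<bar>t\<bar>) ^ degree p"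
        by (simp add: abs_mult power_abs mult_left_mono)
    qed
    finally show ?thesis by (simp add: sum_distrib_right)
  qed
  then show ?thesis
    by (intro exI[of _ "\<Sum>i\<le>degree p. \<bar>coeff p i\<bar>"]) (auto intro: sum_nonneg)
qed

lemma poly_le_exp_square:
  fixes p :: "real poly" and b :: real
  assumes "0 < b"
  shows "\<exists>K\<ge>0. \<forall>t. \<bar>poly p t\<bar> \<le> K * exp (b * t\<^sup>2)"
proof -
  obtain K where K: "0 \<le> K" "\<And>t. \<bar>poly p t\<bar> \<le> K * (1 + \<bar>t\<bar>) ^ degree p"
    using poly_le_power by blast
  have "\<bar>poly p t\<bar> \<le> K * (fact (degree p) * exp (1 + 1 / b)) * exp (b * t\<^sup>2)" for t
    using mult_left_mono[OF power_le_exp_square[OF assms] K(1)] K(2)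
    by (metis (no_types, lifting) mult.assoc order_trans)
  then show ?thesis
    using K(1) by (intro exI[of _ "K * (fact (degree p) * exp (1 + 1 / b))"]) auto
qed

text \<open>The loss of half of the exponential rate absorbs the polynomial coefficients.\<close>

lemma sq_family_bound:
  assumes "0 < b"
  obtains C where "0 \<le> C" "\<And>v t K. (\<And>j. j \<le> m \<Longrightarrow> \<bar>v j (t\<^sup>2)\<bar> \<le> K * exp (- b * t\<^sup>2)) \<Longrightarrow>
    \<bar>sq_family v m t\<bar> \<le> C * K * exp (- (b / 2) * t\<^sup>2)"
proof -
  have "\<forall>j. \<exists>C\<ge>0. \<forall>t. \<bar>poly (sq_coeff m j) t\<bar> \<le> C * exp ((b / 2) * t\<^sup>2)"
    using poly_le_exp_square[of "b / 2"] assms by simp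
  then obtain C where C: "\<And>j. 0 \<le> C j" "\<And>j t. \<bar>poly (sq_coeff m j) t\<bar> \<le> C j * exp ((b / 2) * t\<^sup>2)"
    by metis
  have "\<bar>sq_family v m t\<bar> \<le> (\<Sum>j\<le>m. C j) * K * exp (- (b / 2) * t\<^sup>2)"
    if *: "\<And>j. j \<le> m \<Longrightarrow> \<bar>v j (t\<^sup>2)\<bar> \<le> K * exp (- b * t\<^sup>2)" for v t K
  proof -
    have "\<bar>sq_family v m t\<bar> \<le> (\<Sum>j\<le>m. \<bar>poly (sq_coeff m j) t * v j (t\<^sup>2)\<bar>)"
      unfolding sq_family_def by (rule sum_abs)
    also have "\<dots> \<le> (\<Sum>j\<le>m. (C j * exp ((b / 2) * t\<^sup>2)) * (K * exp (- b * t\<^sup>2)))"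
      unfolding abs_mult by (intro sum_mono mult_mono C *) (auto simp: C)
    also have "\<dots> = (\<Sum>j\<le>m. C j * K * exp (- (b / 2) * t\<^sup>2))"
    proof (intro sum.cong refl)
      fix j
      have "exp ((b / 2) * t\<^sup>2) * exp (- b * t\<^sup>2) = exp (- (b / 2) * t\<^sup>2)"
        unfolding exp_add[symmetric] by (simp add: field_simps)
      then show "(C j * exp ((b / 2) * t\<^sup>2)) * (K * exp (- b * t\<^sup>2)) = C j * K * exp (- (b / 2) * t\<^sup>2)"
        by (metis (no_types, opaque_lifting) mult.assoc mult.left_commute)
    qed
    finally show ?thesis by (simp add: sum_distrib_right mult.assoc)
  qed
  then show thesis
    using C by (intro that[of "\<Sum>j\<le>m. C j"]) (auto intro: sum_nonneg)
qed

lemma exp_decay_nonneg_bound: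
  assumes "exp_decay b d"
  shows "\<exists>K\<ge>0. \<forall>j\<le>m. \<forall>r\<ge>0. \<bar>d j r\<bar> \<le> K * exp (- b * r)"
proof -
  obtain K where K: "\<And>j r. 0 \<le> r \<Longrightarrow> \<bar>d j r\<bar> \<le> K j * exp (- b * r)"
    using assms unfolding exp_decay_def by metis
  have "\<bar>d j r\<bar> \<le> (\<Sum>j\<le>m. \<bar>K j\<bar>) * exp (- b * r)" if "j \<le> m" "0 \<le> r" for j r
  proof -
    have "\<bar>K j\<bar> \<le> (\<Sum>j\<le>m. \<bar>K j\<bar>)"
      using that by (intro member_le_sum) auto
    then have "K j \<le> (\<Sum>j\<le>m. \<bar>K j\<bar>)" by linarith
    then show ?thesis
      using K[OF that(2), of j] by (meson exp_ge_zero mult_right_mono order_trans)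
  qed
  then show ?thesis
    by (intro exI[of _ "\<Sum>j\<le>m. \<bar>K j\<bar>"]) (auto intro: sum_nonneg)
qed

lemma exp_conv_nonneg_bound:
  assumes "exp_conv b D d"
  shows "\<exists>K\<ge>0. \<forall>j\<le>m. \<forall>k\<ge>m. \<forall>r\<ge>0. \<bar>D k j r - d j r\<bar> \<le> K / real (Suc k) * exp (- b * r)"
proof -
  obtain K where K: "\<And>j k r. j \<le> k \<Longrightarrow> 0 \<le> r \<Longrightarrow> \<bar>D k j r - d j r\<bar> \<le> K j / real (Suc k) * exp (- b * r)"
    using assms unfolding exp_conv_def by metis
  have "\<bar>D k j r - d j r\<bar> \<le> (\<Sum>j\<le>m. \<bar>K j\<bar>) / real (Suc k) * exp (- b * r)"
    if "j \<le> m" "m \<le> k" "0 \<le> r" for j k r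
  proof -
    have "\<bar>K j\<bar> \<le> (\<Sum>j\<le>m. \<bar>K j\<bar>)"
      using that by (intro member_le_sum) auto
    then have "K j \<le> (\<Sum>j\<le>m. \<bar>K j\<bar>)" by linarith
    then have "K j / real (Suc k) * exp (- b * r) \<le> (\<Sum>j\<le>m. \<bar>K j\<bar>) / real (Suc k) * exp (- b * r)"
      by (intro mult_right_mono divide_right_mono) auto
    then show ?thesis
      using K[of j k r] that by linarith
  qed
  then show ?thesis
    by (intro exI[of _ "\<Sum>j\<le>m. \<bar>K j\<bar>"]) (auto intro: sum_nonneg)
qed

lemma sq_family_decay:
  assumes "0 < b" "exp_decay b u"
  shows "\<exists>K\<ge>0. \<forall>t. \<bar>sq_family u m t\<bar> \<le> K * exp (- (b / 2) * t\<^sup>2)"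
proof -
  obtain C where C: "0 \<le> C" "\<And>v t K. (\<And>j. j \<le> m \<Longrightarrow> \<bar>v j (t\<^sup>2)\<bar> \<le> K * exp (- b * t\<^sup>2)) \<Longrightarrow>
      \<bar>sq_family v m t\<bar> \<le> C * K * exp (- (b / 2) * t\<^sup>2)"
    by (rule sq_family_bound[OF assms(1), of m]) auto
  obtain K where K: "0 \<le> K" "\<And>j r. j \<le> m \<Longrightarrow> 0 \<le> r \<Longrightarrow> \<bar>u j r\<bar> \<le> K * exp (- b * r)"
    using exp_decay_nonneg_bound[OF assms(2), of m] by meson
  have "\<bar>sq_family u m t\<bar> \<le> C * K * exp (- (b / 2) * t\<^sup>2)" for t
    by (rule C(2)) (rule K(2), auto)
  then show ?thesis
    using C K by (intro exI[of _ "C * K"]) auto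
qed

lemma sq_family_conv:
  assumes "0 < b" "exp_conv b U u"
  shows "\<exists>K\<ge>0. \<forall>k\<ge>m. \<forall>t. \<bar>sq_family (U k) m t - sq_family u m t\<bar> \<le>
    K / real (Suc k) * exp (- (b / 2) * t\<^sup>2)"
proof -
  obtain C where C: "0 \<le> C" "\<And>v t K. (\<And>j. j \<le> m \<Longrightarrow> \<bar>v j (t\<^sup>2)\<bar> \<le> K * exp (- b * t\<^sup>2)) \<Longrightarrow>
      \<bar>sq_family v m t\<bar> \<le> C * K * exp (- (b / 2) * t\<^sup>2)"
    by (rule sq_family_bound[OF assms(1), of m]) auto
  obtain K where K: "0 \<le> K"
    "\<And>j k r. j \<le> m \<Longrightarrow> m \<le> k \<Longrightarrow> 0 \<le> r \<Longrightarrow> \<bar>U k j r - u j r\<bar> \<le> K / real (Suc k) * exp (- b * r)"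
    using exp_conv_nonneg_bound[OF assms(2), of m] by meson
  have "\<bar>sq_family (U k) m t - sq_family u m t\<bar> \<le> C * K / real (Suc k) * exp (- (b / 2) * t\<^sup>2)"
    if "m \<le> k" for k t
  proof -
    \<comment> \<open>\<open>sq_family\<close> is linear in the family, so the bound for a single
      family applies to the difference.\<close>
    have "sq_family (U k) m t - sq_family u m t = sq_family (\<lambda>j r. U k j r - u j r) m t"
      by (simp add: sq_family_def sum_subtractf right_diff_distrib)
    moreover have "\<bar>sq_family (\<lambda>j r. U k j r - u j r) m t\<bar> \<le> C * (K / real (Suc k)) * exp (- (b / 2) * t\<^sup>2)"
      by (rule C(2)) (intro K that, auto)
    ultimately show ?thesis by simp
  qed
  then show ?thesis
    using C K by (intro exI[of _ "C * K"]) auto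
qed

subsection \<open>The product functions\<close>

definition prod_fun :: "('n \<Rightarrow> real \<Rightarrow> real) \<Rightarrow> real^'n::finite \<Rightarrow> complex" where
  "prod_fun f x = complex_of_real (\<Prod>i\<in>UNIV. f i (x $ i))"

lemma prod_fun_has_derivative:
  fixes x :: "real^'n::finite"
  assumes "\<And>i. (f i has_real_derivative f' i (x $ i)) (at (x $ i))"
  shows "(prod_fun f has_derivative (\<lambda>h. complex_of_real
    (\<Sum>i\<in>UNIV. (f' i (x $ i) * h $ i) * (\<Prod>j\<in>UNIV - {i}. f j (x $ j))))) (at x)"
proof -
  have "((\<lambda>x. f i (x $ i)) has_derivative (\<lambda>h. f' i (x $ i) * h $ i)) (at x)" for i
  proof -
    have "((\<lambda>x. x $ i) has_derivative (\<lambda>h. h $ i)) (at x)"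
      by (intro bounded_linear_imp_has_derivative bounded_linear_vec_nth)
    from has_derivative_compose[OF this assms[of i, unfolded has_field_derivative_def]]
    show ?thesis .
  qed
  then show ?thesis
    unfolding prod_fun_def by (intro has_derivative_of_real has_derivative_prod)
qed

text \<open>Each partial derivative hits exactly one factor, so only the multiplicity of each
  direction in the list survives.\<close>

lemma iter_partial_prod_fun:
  fixes d :: "'n::finite \<Rightarrow> nat \<Rightarrow> real \<Rightarrow> real"
  assumes "\<And>i. deriv_family (d i)"
  shows "iter_partial is (prod_fun (\<lambda>i. d i 0)) = prod_fun (\<lambda>i. d i (count_list is i))"
proof (induction "is")
  case (Cons j "is")
  let ?m = "\<lambda>i. count_list is i"
  have "partial_derivative j (prod_fun (\<lambda>i. d i (?m i))) x = prod_fun (\<lambda>i. d i (count_list (j # is) i)) x" for x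
  proof -
    have "partial_derivative j (prod_fun (\<lambda>i. d i (?m i))) x = complex_of_real
      (\<Sum>i\<in>UNIV. (d i (Suc (?m i)) (x $ i) * axis j 1 $ i) * (\<Prod>l\<in>UNIV - {i}. d l (?m l) (x $ l)))"
      by (rule partial_derivative_eq, rule prod_fun_has_derivative) (rule deriv_familyD[OF assms])
    also have "(\<Sum>i\<in>UNIV. (d i (Suc (?m i)) (x $ i) * axis j 1 $ i) * (\<Prod>l\<in>UNIV - {i}. d l (?m l) (x $ l))) =
       (\<Sum>i\<in>UNIV. if i = j then d i (Suc (?m i)) (x $ i) * (\<Prod>l\<in>UNIV - {i}. d l (?m l) (x $ l)) else 0)"
      by (intro sum.cong refl) (auto simp: axis_def)
    also have "\<dots> = d j (Suc (?m j)) (x $ j) * (\<Prod>l\<in>UNIV - {j}. d l (?m l) (x $ l))"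
      by simp
    also have "\<dots> = (\<Prod>l\<in>UNIV. d l (count_list (j # is) l) (x $ l))"
      by (subst prod.remove[of UNIV j]) (auto intro!: prod.cong)
    finally show ?thesis by (simp only: prod_fun_def[of _ x])
  qed
  then show ?case by (simp add: Cons fun_eq_iff)
qed simp

lemma smooth_fun_prod_fun:
  fixes d :: "'n::finite \<Rightarrow> nat \<Rightarrow> real \<Rightarrow> real"
  assumes "\<And>i. deriv_family (d i)"
  shows "smooth_fun (prod_fun (\<lambda>i. d i 0))"
  unfolding smooth_fun_def iter_partial_prod_fun[OF assms] differentiable_def
proof (intro allI exI)
  show "(prod_fun (\<lambda>i. d i (count_list is i)) has_derivative (\<lambda>h. complex_of_real
      (\<Sum>i\<in>UNIV. (d i (Suc (count_list is i)) (x $ i) * h $ i) *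
        (\<Prod>j\<in>UNIV - {i}. d j (count_list is j) (x $ j))))) (at x)" for "is" x
    by (rule prod_fun_has_derivative) (rule deriv_familyD[OF assms])
qed

text \<open>Each factor depends on a squared coordinate. Hence decay of rate \<open>b\<close> in
  every factor multiplies up to Gaussian decay in \<open>norm x\<close>.\<close>

definition prodsq :: "('n \<Rightarrow> nat \<Rightarrow> real \<Rightarrow> real) \<Rightarrow> real^'n::finite \<Rightarrow> complex" where
  "prodsq u x = complex_of_real (\<Prod>i\<in>UNIV. u i 0 ((x $ i)\<^sup>2))"

lemma prodsq_eq_prod_fun: "prodsq u = prod_fun (\<lambda>i. sq_family (u i) 0)"
  by (simp add: prodsq_def prod_fun_def sq_family_0 fun_eq_iff)

lemma iter_partial_prodsq:
  assumes "\<And>i. deriv_family (u i)"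
  shows "iter_partial is (prodsq u) = prod_fun (\<lambda>i. sq_family (u i) (count_list is i))"
  unfolding prodsq_eq_prod_fun by (intro iter_partial_prod_fun deriv_family_sq_family assms)

lemma smooth_fun_prodsq:
  assumes "\<And>i. deriv_family (u i)"
  shows "smooth_fun (prodsq u)"
  unfolding prodsq_eq_prod_fun by (intro smooth_fun_prod_fun deriv_family_sq_family assms)

lemma even_fun_prodsq: "even_fun (prodsq u)"
  unfolding even_fun_def prodsq_def by (auto intro!: arg_cong[where f = complex_of_real] prod.cong)

lemma prod_exp_square:
  fixes x :: "real^'n::finite"
  shows "(\<Prod>i\<in>UNIV. exp (- b * (x $ i)\<^sup>2)) = exp (- b * (norm x)\<^sup>2)"
  by (simp add: exp_sum[symmetric] norm_vec_def L2_set_def sum_nonneg sum_distrib_left sum_negf)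

lemma norm_power_exp_bound:
  assumes "0 < b"
  shows "\<exists>C\<ge>0. \<forall>x :: 'a::real_normed_vector. (1 + norm x) ^ k * exp (- b * (norm x)\<^sup>2) \<le> C"
proof (intro exI[of _ "fact k * exp (1 + 1 / b)"] conjI allI)
  fix x :: 'a
  show "(1 + norm x) ^ k * exp (- b * (norm x)\<^sup>2) \<le> fact k * exp (1 + 1 / b)"
    using power_le_exp_square[OF assms, of "norm x" k] by (simp add: exp_minus field_simps)
qed simp

lemma prodsq_S_even:
  fixes u :: "'n::finite \<Rightarrow> nat \<Rightarrow> real \<Rightarrow> real"
  assumes b: "0 < b" and u: "\<And>i. deriv_family (u i)" "\<And>i. exp_decay b (u i)"
  shows "prodsq u \<in> S_even"
proof -
  have "\<exists>K. \<forall>x. (1 + norm x) ^ k * norm (iter_partial is (prodsq u) x) \<le> K" for k "is"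
  proof -
    have "\<forall>i. \<exists>K\<ge>0. \<forall>t. \<bar>sq_family (u i) (count_list is i) t\<bar> \<le> K * exp (- (b / 2) * t\<^sup>2)"
      using sq_family_decay[OF b u(2)] by blast
    then obtain K where K: "\<And>i. 0 \<le> K i"
      "\<And>i t. \<bar>sq_family (u i) (count_list is i) t\<bar> \<le> K i * exp (- (b / 2) * t\<^sup>2)"
      by metis
    obtain C where C: "\<And>x::real^'n. (1 + norm x) ^ k * exp (- (b / 2) * (norm x)\<^sup>2) \<le> C"
      using norm_power_exp_bound[of "b / 2"] b by (meson half_gt_zero)
    have "(1 + norm x) ^ k * norm (iter_partial is (prodsq u) x) \<le> (\<Prod>i\<in>UNIV. K i) * C" for x
    proof -
      have "norm (iter_partial is (prodsq u) x) \<le> (\<Prod>i\<in>UNIV. K i * exp (- (b / 2) * (x $ i)\<^sup>2))"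
        unfolding iter_partial_prodsq[OF u(1)] prod_fun_def norm_of_real abs_prod
        by (intro prod_mono conjI abs_ge_zero K)
      also have "\<dots> = (\<Prod>i\<in>UNIV. K i) * exp (- (b / 2) * (norm x)\<^sup>2)"
        by (simp only: prod.distrib prod_exp_square)
      finally have "(1 + norm x) ^ k * norm (iter_partial is (prodsq u) x) \<le>
          (1 + norm x) ^ k * ((\<Prod>i\<in>UNIV. K i) * exp (- (b / 2) * (norm x)\<^sup>2))"
        by (intro mult_left_mono) auto
      also have "\<dots> = (\<Prod>i\<in>UNIV. K i) * ((1 + norm x) ^ k * exp (- (b / 2) * (norm x)\<^sup>2))"
        by (simp only: mult_ac)
      also have "\<dots> \<le> (\<Prod>i\<in>UNIV. K i) * C"
        by (intro mult_left_mono C prod_nonneg K)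
      finally show ?thesis .
    qed
    then show ?thesis by blast
  qed
  then show ?thesis
    using smooth_fun_prodsq[OF u(1)] even_fun_prodsq
    by (auto simp: S_even_def bounded_range_norm_iff)
qed

text \<open>Telescoping, one factor at a time. Since \<open>\<delta> \<le> 1\<close>, a factor
  \<open>a j\<close> is at most twice \<open>K j * e j\<close>; together with the change of the
  factor itself this gives the 3 per index.\<close>

lemma abs_prod_diff_le:
  fixes a b c e :: "'i \<Rightarrow> real"
  assumes "finite I" "0 \<le> \<delta>" "\<delta> \<le> 1" "\<And>i. i \<in> I \<Longrightarrow> 0 \<le> K i" "\<And>i. i \<in> I \<Longrightarrow> 0 \<le> e i"
    and "\<And>i. i \<in> I \<Longrightarrow> \<bar>b i\<bar> \<le> K i * e i" "\<And>i. i \<in> I \<Longrightarrow> \<bar>a i - b i\<bar> \<le> \<delta> * K i * e i"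
  shows "\<bar>(\<Prod>i\<in>I. a i) - (\<Prod>i\<in>I. b i)\<bar> \<le> \<delta> * ((\<Prod>i\<in>I. 3 * K i) * (\<Prod>i\<in>I. e i))"
  using assms
proof (induction I rule: finite_induct)
  case (insert j I)
  let ?A = "\<Prod>i\<in>I. a i" and ?B = "\<Prod>i\<in>I. b i"
  let ?P = "(\<Prod>i\<in>I. 3 * K i) * (\<Prod>i\<in>I. e i)"
  have P: "0 \<le> ?P"
    using insert by (intro mult_nonneg_nonneg prod_nonneg) auto
  have nn: "0 \<le> K j * e j" using insert by auto
  have IH: "\<bar>?A - ?B\<bar> \<le> \<delta> * ?P"
    using insert by auto
  have "\<bar>?B\<bar> \<le> (\<Prod>i\<in>I. 3 * K i * e i)"
    unfolding abs_prod
  proof (intro prod_mono conjI abs_ge_zero)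
    fix i assume i: "i \<in> I"
    then have "0 \<le> K i * e i" using insert by auto
    then show "\<bar>b i\<bar> \<le> 3 * K i * e i" using insert.prems(5)[of i] i by simp
  qed
  then have B: "\<bar>?B\<bar> \<le> ?P" by (simp add: prod.distrib)
  have "\<delta> * (K j * e j) \<le> 1 * (K j * e j)"
    using insert nn by (intro mult_right_mono) auto
  then have a: "\<bar>a j\<bar> \<le> 2 * (K j * e j)"
    using insert.prems(5)[of j] insert.prems(6)[of j] by (auto simp: mult.assoc)
  have "a j * ?A - b j * ?B = a j * (?A - ?B) + (a j - b j) * ?B"
    by (simp add: algebra_simps)
  then have "\<bar>a j * ?A - b j * ?B\<bar> \<le> \<bar>a j\<bar> * \<bar>?A - ?B\<bar> + \<bar>a j - b j\<bar> * \<bar>?B\<bar>"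
    by (metis abs_mult abs_triangle_ineq)
  also have "\<dots> \<le> (2 * (K j * e j)) * (\<delta> * ?P) + (\<delta> * K j * e j) * ?P"
    using insert.prems by (intro add_mono mult_mono IH a B) (auto simp: P nn)
  also have "\<dots> = \<delta> * ((3 * K j * (\<Prod>i\<in>I. 3 * K i)) * (e j * (\<Prod>i\<in>I. e i)))"
    by (simp add: algebra_simps)
  finally show ?case
    using insert(1,2) by simp
qed simp

lemma prod_fun_diff_bound:
  fixes F :: "nat \<Rightarrow> 'n::finite \<Rightarrow> real \<Rightarrow> real"
  assumes K: "\<And>i. 0 \<le> K i" "\<And>i t. \<bar>f i t\<bar> \<le> K i * exp (- b * t\<^sup>2)"
    and L: "\<And>i. 0 \<le> L i" "\<And>i k t. k0 \<le> k \<Longrightarrow> \<bar>F k i t - f i t\<bar> \<le> L i / real (Suc k) * exp (- b * t\<^sup>2)"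
    and k: "k0 \<le> k"
  shows "norm (prod_fun (F k) x - prod_fun f x) \<le>
    (\<Prod>i\<in>UNIV. 3 * (K i + L i)) / real (Suc k) * exp (- b * (norm x)\<^sup>2)"
proof -
  let ?e = "\<lambda>i. exp (- b * (x $ i)\<^sup>2)"
  have "\<bar>(\<Prod>i\<in>UNIV. F k i (x $ i)) - (\<Prod>i\<in>UNIV. f i (x $ i))\<bar> \<le>
     1 / real (Suc k) * ((\<Prod>i\<in>UNIV. 3 * (K i + L i)) * (\<Prod>i\<in>UNIV. ?e i))"
  \<comment> \<open>The sum \<open>K i + L i\<close> serves both as the size of the factor and,
    times \<open>1 / real (Suc k)\<close>, as the size of its error.\<close>
  proof (rule abs_prod_diff_le)
    fix i
    show "\<bar>f i (x $ i)\<bar> \<le> (K i + L i) * ?e i"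
      by (rule order_trans[OF K(2)]) (simp add: L)
    show "\<bar>F k i (x $ i) - f i (x $ i)\<bar> \<le> 1 / real (Suc k) * (K i + L i) * ?e i"
    proof (rule order_trans[OF L(2)[OF k]], rule mult_right_mono)
      show "L i / real (Suc k) \<le> 1 / real (Suc k) * (K i + L i)"
        using K(1)[of i] by (simp add: divide_right_mono)
    qed simp
  qed (auto simp: K L)
  then show ?thesis
    unfolding prod_fun_def of_real_diff[symmetric] norm_of_real prod_exp_square by simp
qed

text \<open>In order zero there are no polynomial coefficients to absorb: the estimate keeps the
  full rate \<open>b\<close> and holds for every \<open>k\<close>. It supplies the Gaussian majorant
  for convergence in the square norm.\<close>

lemma prodsq_diff_bound:
  fixes U :: "nat \<Rightarrow> 'n::finite \<Rightarrow> nat \<Rightarrow> real \<Rightarrow> real"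
  assumes u: "\<And>i. exp_decay b (u i)" and conv: "\<And>i. exp_conv b (\<lambda>k. U k i) (u i)"
  shows "\<exists>K. \<forall>k x. norm (prodsq (U k) x - prodsq u x) \<le> K / real (Suc k) * exp (- b * (norm x)\<^sup>2)"
proof -
  have "\<forall>i. \<exists>K\<ge>0. \<forall>j\<le>0. \<forall>r\<ge>0. \<bar>u i j r\<bar> \<le> K * exp (- b * r)"
    using exp_decay_nonneg_bound[OF u] by blast
  then obtain K where K: "\<And>i. 0 \<le> K i" "\<And>i r. 0 \<le> r \<Longrightarrow> \<bar>u i 0 r\<bar> \<le> K i * exp (- b * r)"
    by (metis order_refl)
  have "\<forall>i. \<exists>K\<ge>0. \<forall>j\<le>0. \<forall>k\<ge>0. \<forall>r\<ge>0. \<bar>U k i j r - u i j r\<bar> \<le> K / real (Suc k) * exp (- b * r)"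
    using exp_conv_nonneg_bound[OF conv] by blast
  then obtain L where L: "\<And>i. 0 \<le> L i"
    "\<And>i k r. 0 \<le> r \<Longrightarrow> \<bar>U k i 0 r - u i 0 r\<bar> \<le> L i / real (Suc k) * exp (- b * r)"
    by (metis order_refl le0)
  have "norm (prod_fun (\<lambda>i. sq_family (U k i) 0) x - prod_fun (\<lambda>i. sq_family (u i) 0) x) \<le>
      (\<Prod>i\<in>UNIV. 3 * (K i + L i)) / real (Suc k) * exp (- b * (norm x)\<^sup>2)" for k x
    by (rule prod_fun_diff_bound[where ?k0.0 = 0 and F = "\<lambda>k i. sq_family (U k i) 0"])
      (use K L in \<open>simp_all only: sq_family_0 zero_le_power2 le0\<close>)
  then show ?thesis
    unfolding prodsq_eq_prod_fun by blast
qed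

lemma tempered_even_prodsq_tendsto:
  fixes U :: "nat \<Rightarrow> 'n::finite \<Rightarrow> nat \<Rightarrow> real \<Rightarrow> real"
  assumes T: "T \<in> tempered_even" and b: "0 < b"
    and u: "\<And>i. deriv_family (u i)" "\<And>i. exp_decay b (u i)"
    and U: "\<And>k i. deriv_family (U k i)" "\<And>k. prodsq (U k) \<in> S_even"
    and conv: "\<And>i. exp_conv b (\<lambda>k. U k i) (u i)"
  shows "(\<lambda>k. T (prodsq (U k))) \<longlonglongrightarrow> T (prodsq u)"
proof (rule tempered_even_tendsto[OF T prodsq_S_even[OF b u] U(2)])
  fix N and "is" :: "'n list"
  let ?c = "count_list is"
  \<comment> \<open>No direction occurs more often than the list is long, so
    \<open>m \<le> k\<close> puts the estimates of all coordinates in force at once.\<close>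
  define m where "m = length is"
  have m: "?c i \<le> m" for i
    by (simp add: m_def count_le_length)
  have "\<forall>i. \<exists>K\<ge>0. \<forall>t. \<bar>sq_family (u i) (?c i) t\<bar> \<le> K * exp (- (b / 2) * t\<^sup>2)"
    using sq_family_decay[OF b u(2)] by blast
  then obtain K where K: "\<And>i. 0 \<le> K i"
    "\<And>i t. \<bar>sq_family (u i) (?c i) t\<bar> \<le> K i * exp (- (b / 2) * t\<^sup>2)"
    by metis
  have "\<forall>i. \<exists>L\<ge>0. \<forall>k\<ge>?c i. \<forall>t. \<bar>sq_family (U k i) (?c i) t - sq_family (u i) (?c i) t\<bar> \<le>
      L / real (Suc k) * exp (- (b / 2) * t\<^sup>2)"
    using sq_family_conv[OF b conv] by blast
  then obtain L where L: "\<And>i. 0 \<le> L i"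
    "\<And>i k t. ?c i \<le> k \<Longrightarrow> \<bar>sq_family (U k i) (?c i) t - sq_family (u i) (?c i) t\<bar> \<le>
      L i / real (Suc k) * exp (- (b / 2) * t\<^sup>2)"
    by metis
  define A where "A = (\<Prod>i\<in>UNIV. 3 * (K i + L i))"
  have A: "0 \<le> A" unfolding A_def by (intro prod_nonneg) (simp add: K L)
  obtain C where C: "\<And>x::real^'n. (1 + norm x) ^ N * exp (- (b / 2) * (norm x)\<^sup>2) \<le> C"
    using norm_power_exp_bound[of "b / 2"] b by (meson half_gt_zero)
  let ?sn = "\<lambda>k. schwartz_seminorm N is (\<lambda>x. prodsq (U k) x - prodsq u x)"
  have upper: "?sn k \<le> A * C / real (Suc k)" if "m \<le> k" for k
  proof (rule schwartz_seminorm_le)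
    fix x
    have eq: "iter_partial is (\<lambda>x. prodsq (U k) x - prodsq u x) x =
        prod_fun (\<lambda>i. sq_family (U k i) (?c i)) x - prod_fun (\<lambda>i. sq_family (u i) (?c i)) x"
      using iter_partial_lincomb[OF smooth_fun_prodsq[OF U(1)[of k]] smooth_fun_prodsq[of u, OF u(1)], where a = 1 and b = "-1"]
      by (simp add: iter_partial_prodsq U u)
    have "norm (iter_partial is (\<lambda>x. prodsq (U k) x - prodsq u x) x) \<le>
        A / real (Suc k) * exp (- (b / 2) * (norm x)\<^sup>2)"
      unfolding eq A_def
      by (rule prod_fun_diff_bound[where F = "\<lambda>k i. sq_family (U k i) (?c i)" and ?k0.0 = m])
        (rule K L(1) L(2)[OF order_trans[OF m]] that | assumption)+
    then have "(1 + norm x) ^ N * norm (iter_partial is (\<lambda>x. prodsq (U k) x - prodsq u x) x) \<le>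
        (1 + norm x) ^ N * (A / real (Suc k) * exp (- (b / 2) * (norm x)\<^sup>2))"
      by (intro mult_left_mono) auto
    also have "\<dots> = A / real (Suc k) * ((1 + norm x) ^ N * exp (- (b / 2) * (norm x)\<^sup>2))"
      by (simp only: mult_ac)
    also have "\<dots> \<le> A / real (Suc k) * C"
      by (intro mult_left_mono C) (simp add: A)
    finally show "(1 + norm x) ^ N * norm (iter_partial is (\<lambda>x. prodsq (U k) x - prodsq u x) x) \<le> A * C / real (Suc k)"
      by simp
  qed
  have lower: "0 \<le> ?sn k" for k
    by (rule order_trans[OF _ schwartz_seminorm_upper[where x = 0]])
      (auto intro: S_even_diff U prodsq_S_even[OF b u])
  have "(\<lambda>k. A * C / real (Suc k)) \<longlonglongrightarrow> 0"
    by (rule LIMSEQ_Suc) (rule lim_const_over_n)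
  then show "?sn \<longlonglongrightarrow> 0"
    by (rule tendsto_sandwich[rotated 2, OF tendsto_const])
      (use lower upper in \<open>auto simp: eventually_sequentially\<close>)
qed

section \<open>A smooth cutoff function\<close>

lemma deriv_family_affine:
  assumes "deriv_family d"
  shows "deriv_family (\<lambda>m t. a ^ m * d m (a * t + c))"
  unfolding deriv_family_def
proof (intro allI)
  fix m t
  have "((\<lambda>t. d m (a * t + c)) has_real_derivative d (Suc m) (a * t + c) * a) (at t)"
    by (rule DERIV_chain2[OF deriv_familyD[OF assms]]) (auto intro!: derivative_eq_intros)
  from DERIV_cmult[OF this, of "a ^ m"]
  show "((\<lambda>t. a ^ m * d m (a * t + c)) has_real_derivative a ^ Suc m * d (Suc m) (a * t + c)) (at t)"
    by (simp add: mult_ac)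
qed

text \<open>Leibniz' formula for all derivatives of a product.\<close>

definition mult_family ::
    "(nat \<Rightarrow> real \<Rightarrow> real) \<Rightarrow> (nat \<Rightarrow> real \<Rightarrow> real) \<Rightarrow> nat \<Rightarrow> real \<Rightarrow> real" where
  "mult_family A B m t = (\<Sum>i\<le>m. real (m choose i) * (A i t * B (m - i) t))"

lemma mult_family_0: "mult_family A B 0 t = A 0 t * B 0 t"
  by (simp add: mult_family_def)

lemma deriv_family_mult:
  assumes A: "deriv_family A" and B: "deriv_family B"
  shows "deriv_family (mult_family A B)"
  unfolding deriv_family_def
proof (intro allI)
  fix m t
  have "(mult_family A B m has_real_derivative
      (\<Sum>i\<le>m. real (m choose i) * (A (Suc i) t * B (m - i) t + A i t * B (Suc (m - i)) t))) (at t)"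
    unfolding mult_family_def
  proof (intro DERIV_sum DERIV_cmult)
    fix i
    show "((\<lambda>t. A i t * B (m - i) t) has_real_derivative
        A (Suc i) t * B (m - i) t + A i t * B (Suc (m - i)) t) (at t)"
      using DERIV_mult[OF deriv_familyD[OF A, of i t] deriv_familyD[OF B, of "m - i" t]]
      by (simp add: mult_ac add_ac)
  qed
  also have "(\<Sum>i\<le>m. real (m choose i) * (A (Suc i) t * B (m - i) t + A i t * B (Suc (m - i)) t)) =
      (\<Sum>i\<le>m. real (m choose i) * (A (Suc i) t * B (m - i) t)) +
      (\<Sum>i\<le>Suc m. real (m choose i) * (A i t * B (Suc m - i) t))"
    by (simp add: sum.distrib distrib_left Suc_diff_le)
  also have "(\<Sum>i\<le>Suc m. real (m choose i) * (A i t * B (Suc m - i) t)) =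
      A 0 t * B (Suc m) t + (\<Sum>i\<le>m. real (m choose Suc i) * (A (Suc i) t * B (m - i) t))"
    unfolding sum.atMost_Suc_shift by simp
  also have "(\<Sum>i\<le>m. real (m choose i) * (A (Suc i) t * B (m - i) t)) +
      (A 0 t * B (Suc m) t + (\<Sum>i\<le>m. real (m choose Suc i) * (A (Suc i) t * B (m - i) t))) =
      mult_family A B (Suc m) t"
    unfolding mult_family_def sum.atMost_Suc_shift
    by (simp add: sum.distrib distrib_right)
  finally show "(mult_family A B m has_real_derivative mult_family A B (Suc m) t) (at t)" .
qed

text \<open>Every derivative of the flat function \<open>exp (- (1 / t))\<close>, extended by zero,
  has this form, so one family indexed by polynomials is closed under differentiation.\<close>

definition flat :: "real poly \<Rightarrow> real \<Rightarrow> real" where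
  "flat p t = (if t \<le> 0 then 0 else poly p (1 / t) * exp (- (1 / t)))"

text \<open>With \<open>y = 1 / t\<close> the claim is that
  \<open>y\<^sup>2 * poly p y * exp (- y)\<close> is bounded for \<open>y > 0\<close>. The quadratic
  order is what the difference quotient at 0 requires.\<close>

lemma flat_le_square: "\<exists>K. \<forall>t. \<bar>flat p t\<bar> \<le> K * t\<^sup>2"
proof -
  define q where "q = [:0, 0, 1:] * p"
  obtain K where K: "0 \<le> K" "\<And>t. \<bar>poly q t\<bar> \<le> K * (1 + \<bar>t\<bar>) ^ degree q"
    using poly_le_power by blast
  define L where "L = K * (fact (degree q) * exp 1)"
  have "\<bar>flat p t\<bar> \<le> L * t\<^sup>2" if t: "t > 0" for t
  proof -
    define y where "y = 1 / t"
    have y: "0 < y" using t by (simp add: y_def)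
    have "\<bar>poly q y\<bar> \<le> K * (1 + y) ^ degree q"
      using K(2)[of y] y by simp
    also have "\<dots> \<le> K * (fact (degree q) * exp (1 + y))"
      using y by (intro mult_left_mono power_le_exp K) auto
    finally have "\<bar>poly q y\<bar> * exp (- y) \<le> L"
      by (simp add: L_def exp_add exp_minus field_simps)
    moreover have "poly q y = y\<^sup>2 * poly p y"
      by (simp add: q_def power2_eq_square)
    ultimately have "y\<^sup>2 * \<bar>poly p y * exp (- y)\<bar> \<le> L"
      by (simp add: abs_mult)
    then show ?thesis
      using t by (simp add: flat_def y_def field_simps)
  qed
  moreover have "\<bar>flat p t\<bar> \<le> L * t\<^sup>2" if "t \<le> 0" for t
    using that K(1) by (simp add: flat_def L_def)
  ultimately show ?thesis
    by (metis not_le)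
qed

text \<open>In \<open>y = 1 / t\<close> the chain rule contributes the factor
  \<open>- (y\<^sup>2)\<close>, which explains \<open>[:0, 0, 1:]\<close> and the sign in
  \<open>p - pderiv p\<close>. At 0 the quadratic bound forces the derivative 0.\<close>

lemma flat_has_derivative:
  "(flat p has_real_derivative flat ([:0, 0, 1:] * (p - pderiv p)) t) (at t)"
proof (cases t "0::real" rule: linorder_cases)
  case less
  have "(flat p has_real_derivative 0) (at t)"
    by (rule has_field_derivative_transform_within_open[of "\<lambda>_. 0" _ _ "{..<0}"])
      (use less in \<open>auto simp: flat_def\<close>)
  then show ?thesis
    using less by (simp add: flat_def)
next
  case equal
  obtain K where K: "\<And>t. \<bar>flat p t\<bar> \<le> K * t\<^sup>2"
    using flat_le_square by blast
  have "((\<lambda>h. flat p h / h) \<longlongrightarrow> 0) (at 0)"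
  proof (rule Lim_null_comparison)
    show "eventually (\<lambda>h. norm (flat p h / h) \<le> K * \<bar>h\<bar>) (at 0)"
      unfolding eventually_at_filter
    proof (intro always_eventually allI impI)
      fix h :: real assume "h \<noteq> 0"
      then show "norm (flat p h / h) \<le> K * \<bar>h\<bar>"
        using K[of h] by (simp add: pos_divide_le_eq power2_eq_square mult.assoc)
    qed
    show "((\<lambda>h. K * \<bar>h\<bar>) \<longlongrightarrow> 0) (at 0)"
      by (auto intro!: tendsto_eq_intros)
  qed
  then have "(flat p has_real_derivative 0) (at 0)"
    by (simp add: DERIV_def flat_def)
  then show ?thesis
    using equal by (simp add: flat_def)
next
  case greater
  have "((\<lambda>t. poly p (1 / t) * exp (- (1 / t))) has_real_derivative
      (poly (pderiv p) (1 / t) * (- 1 / t\<^sup>2)) * exp (- (1 / t)) + poly p (1 / t) * (exp (- (1 / t)) * (1 / t\<^sup>2))) (at t)"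
    using greater
    by (intro DERIV_mult' DERIV_chain2[OF poly_DERIV] derivative_eq_intros | simp add: power2_eq_square)+
  moreover have "(poly (pderiv p) (1 / t) * (- 1 / t\<^sup>2)) * exp (- (1 / t)) + poly p (1 / t) * (exp (- (1 / t)) * (1 / t\<^sup>2)) =
      flat ([:0, 0, 1:] * (p - pderiv p)) t"
    using greater by (simp add: flat_def field_simps power2_eq_square)
  ultimately have "((\<lambda>t. poly p (1 / t) * exp (- (1 / t))) has_real_derivative
      flat ([:0, 0, 1:] * (p - pderiv p)) t) (at t)"
    by simp
  then show ?thesis
    by (rule has_field_derivative_transform_within_open[of _ _ _ "{0<..}"])
      (use greater in \<open>auto simp: flat_def\<close>)
qed

primrec flat_poly :: "nat \<Rightarrow> real poly" where
  "flat_poly 0 = 1"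
| "flat_poly (Suc m) = [:0, 0, 1:] * (flat_poly m - pderiv (flat_poly m))"

lemma deriv_family_flat: "deriv_family (\<lambda>m. flat (flat_poly m))"
  unfolding deriv_family_def using flat_has_derivative by simp

text \<open>The product of \<open>flat 1\<close> at \<open>t - 1\<close> and at
  \<open>2 - t\<close>, hence concentrated on the interval from 1 to 2. The factors
  \<open>1 ^ m\<close> and \<open>1 * t\<close> keep the shape of
  \<open>deriv_family_affine\<close>.\<close>

definition bump :: "nat \<Rightarrow> real \<Rightarrow> real" where
  "bump = mult_family (\<lambda>m t. 1 ^ m * flat (flat_poly m) (1 * t + (- 1)))
    (\<lambda>m t. (- 1) ^ m * flat (flat_poly m) (- 1 * t + 2))"

lemma deriv_family_bump: "deriv_family bump"
  unfolding bump_def by (intro deriv_family_mult deriv_family_affine deriv_family_flat)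

lemma bump_eq_0: "t \<le> 1 \<or> 2 \<le> t \<Longrightarrow> bump m t = 0"
  by (auto simp: bump_def mult_family_def flat_def intro!: sum.neutral)

lemma bump_pos: "1 < t \<Longrightarrow> t < 2 \<Longrightarrow> 0 < bump 0 t"
  by (simp add: bump_def mult_family_0 flat_def)

lemma bump_nonneg: "0 \<le> bump 0 t"
  by (metis bump_eq_0 bump_pos less_eq_real_def not_le)

lemma deriv_family_continuous: "deriv_family d \<Longrightarrow> continuous_on S (d m)"
  by (meson DERIV_isCont continuous_at_imp_continuous_on deriv_familyD)

definition bump_mass :: real where "bump_mass = integral {0..2} (bump 0)"

lemma bump_integrable: "bump 0 integrable_on {a..b}"
  by (intro integrable_continuous_interval deriv_family_continuous deriv_family_bump)

text \<open>A continuous nonnegative function with integral zero on an interval vanishes there, but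
  the bump is positive at \<open>3/2\<close>.\<close>

lemma bump_mass_pos: "0 < bump_mass"
proof -
  have "bump_mass \<noteq> 0"
  proof
    assume "bump_mass = 0"
    then have "(bump 0 has_integral 0) (cbox 0 2)"
      using bump_integrable[of 0 2] by (simp add: bump_mass_def has_integral_integral)
    then have "bump 0 (3/2) = 0"
      by (rule has_integral_0_cbox_imp_0[OF deriv_family_continuous[OF deriv_family_bump] bump_nonneg])
        auto
    then show False using bump_pos[of "3/2"] by simp
  qed
  moreover have "0 \<le> bump_mass"
    unfolding bump_mass_def by (intro integral_nonneg bump_integrable bump_nonneg)
  ultimately show ?thesis by simp
qed

text \<open>A normalized primitive of the bump that descends from 1 for \<open>r \<le> 1\<close> to
  0 for \<open>r \<ge> 2\<close>. For negative \<open>r\<close> the interval \<open>{0..r}\<close>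
  is empty, which also gives the value 1.\<close>

fun cutoff :: "nat \<Rightarrow> real \<Rightarrow> real" where
  "cutoff 0 r = 1 - integral {0..r} (bump 0) / bump_mass"
| "cutoff (Suc m) r = - bump m r / bump_mass"

lemma integral_bump_low: "r \<le> 1 \<Longrightarrow> integral {0..r} (bump 0) = 0"
  by (subst integral_cong[of _ _ "\<lambda>_. 0"]) (auto simp: bump_eq_0)

lemma cutoff_eq_1: "r \<le> 1 \<Longrightarrow> cutoff 0 r = 1"
  by (simp add: integral_bump_low)

lemma cutoff_eq_0:
  assumes "2 \<le> r"
  shows "cutoff m r = 0"
proof (cases m)
  case 0
  have "integral {0..2} (bump 0) + integral {2..r} (bump 0) = integral {0..r} (bump 0)"
    using assms by (intro Henstock_Kurzweil_Integration.integral_combine bump_integrable) auto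
  moreover have "integral {2..r} (bump 0) = 0"
    by (subst integral_cong[of _ _ "\<lambda>_. 0"]) (auto simp: bump_eq_0)
  ultimately show ?thesis
    using 0 bump_mass_pos by (simp add: bump_mass_def)
qed (use assms in \<open>simp add: bump_eq_0\<close>)

lemma deriv_family_cutoff: "deriv_family cutoff"
  unfolding deriv_family_def
proof (intro allI)
  fix m r
  show "(cutoff m has_real_derivative cutoff (Suc m) r) (at r)"
  proof (cases m)
    case 0
    have "((\<lambda>r. integral {0..r} (bump 0)) has_real_derivative bump 0 r) (at r)"
    \<comment> \<open>The fundamental theorem covers points inside the interval of integration. At
      and below 0 the integral is instead locally constant, because the bump vanishes up to
      1.\<close>
    proof (cases "r < 1")
      case True
      have "((\<lambda>r. integral {0..r} (bump 0)) has_real_derivative 0) (at r)"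
        by (rule has_field_derivative_transform_within_open[of "\<lambda>_. 0" _ _ "{..<1}"])
          (use True integral_bump_low in auto)
      then show ?thesis using True by (simp add: bump_eq_0)
    next
      case False
      have "((\<lambda>r. integral {0..r} (bump 0)) has_real_derivative bump 0 r) (at r within {0..r+1})"
        by (rule integral_has_real_derivative) (use False in \<open>auto intro: deriv_family_continuous deriv_family_bump\<close>)
      moreover have "at r within {0..r+1} = at r"
        by (rule at_within_interior) (use False in auto)
      ultimately show ?thesis by simp
    qed
    then have "((\<lambda>r. 1 - integral {0..r} (bump 0) / bump_mass) has_real_derivative - bump 0 r / bump_mass) (at r)"
      using bump_mass_pos by (auto intro!: derivative_eq_intros)
    moreover have "cutoff 0 = (\<lambda>r. 1 - integral {0..r} (bump 0) / bump_mass)"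
      by (simp add: fun_eq_iff)
    ultimately show ?thesis
      using 0 by (simp del: cutoff.simps(1))
  next
    case (Suc l)
    have "((\<lambda>r. - bump l r / bump_mass) has_real_derivative - bump (Suc l) r / bump_mass) (at r)"
      by (intro DERIV_cdivide DERIV_minus deriv_familyD deriv_family_bump)
    moreover have "cutoff (Suc l) = (\<lambda>r. - bump l r / bump_mass)"
      by (simp add: fun_eq_iff)
    ultimately show ?thesis
      unfolding Suc by (simp del: cutoff.simps(1))
  qed
qed

lemma cutoff_bounded: "\<exists>K\<ge>0. \<forall>r. \<bar>cutoff m r\<bar> \<le> K"
proof -
  have "compact (cutoff m ` {1..2})"
    by (intro compact_continuous_image deriv_family_continuous deriv_family_cutoff) auto
  then obtain K where K: "\<And>r. r \<in> {1..2} \<Longrightarrow> \<bar>cutoff m r\<bar> \<le> K"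
    by (metis (no_types, lifting) bounded_iff compact_imp_bounded imageI real_norm_def)
  have "\<bar>cutoff m r\<bar> \<le> max 1 K" for r
  proof -
    consider "r < 1" | "r \<in> {1..2}" | "2 < r" by force
    then show ?thesis
    proof cases
      case 1
      then show ?thesis
        by (cases m) (auto simp: cutoff_eq_1 bump_eq_0 simp del: cutoff.simps(1))
    next
      case 2
      then show ?thesis using K[of r] by (simp add: max.coboundedI2)
    next
      case 3
      then show ?thesis by (simp add: cutoff_eq_0)
    qed
  qed
  then show ?thesis
    by (intro exI[of _ "max 1 K"]) auto
qed

section \<open>Approximation in one variable\<close>

definition exp_family :: "real \<Rightarrow> nat \<Rightarrow> real \<Rightarrow> real" where
  "exp_family b m r = (- b) ^ m * exp (- b * r)"

lemma deriv_family_exp: "deriv_family (exp_family b)"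
  unfolding deriv_family_def exp_family_def by (auto intro!: derivative_eq_intros)

lemma exp_decay_exp:
  assumes "c \<le> b"
  shows "exp_decay c (exp_family b)"
  unfolding exp_decay_def
proof
  fix m
  have "\<bar>exp_family b m r\<bar> \<le> \<bar>b\<bar> ^ m * exp (- c * r)" if "0 \<le> r" for r
  proof -
    have "exp (- b * r) \<le> exp (- c * r)"
      using assms that by (simp add: mult_right_mono)
    then show ?thesis
      by (simp add: exp_family_def abs_mult power_abs mult_left_mono)
  qed
  then show "\<exists>K. \<forall>r\<ge>0. \<bar>exp_family b m r\<bar> \<le> K * exp (- c * r)" by blast
qed

text \<open>The trailing \<open>+ 0\<close> makes this an instance of
  \<open>deriv_family_affine\<close>.\<close>

definition scaled_cutoff :: "real \<Rightarrow> nat \<Rightarrow> real \<Rightarrow> real" where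
  "scaled_cutoff c m r = (1 / c) ^ m * cutoff m (1 / c * r + 0)"

definition cut_exp :: "real \<Rightarrow> real \<Rightarrow> nat \<Rightarrow> real \<Rightarrow> real" where
  "cut_exp c b = mult_family (scaled_cutoff c) (exp_family b)"

lemma deriv_family_scaled_cutoff: "deriv_family (scaled_cutoff c)"
  unfolding scaled_cutoff_def by (intro deriv_family_affine deriv_family_cutoff)

lemma deriv_family_cut_exp: "deriv_family (cut_exp c b)"
  unfolding cut_exp_def by (intro deriv_family_mult deriv_family_scaled_cutoff deriv_family_exp)

lemma cut_exp_0: "cut_exp c b 0 r = cutoff 0 (r / c) * exp (- b * r)"
  by (simp add: cut_exp_def mult_family_0 scaled_cutoff_def exp_family_def del: cutoff.simps)

lemma cut_exp_eq_0: "0 < c \<Longrightarrow> 2 * c \<le> r \<Longrightarrow> cut_exp c b m r = 0"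
  unfolding cut_exp_def mult_family_def scaled_cutoff_def
  by (intro sum.neutral) (auto simp: cutoff_eq_0 field_simps simp del: cutoff.simps)

lemma exp_decay_compact_support:
  assumes d: "deriv_family d" and 0: "\<And>m r. R \<le> r \<Longrightarrow> d m r = 0"
  shows "exp_decay b d"
  unfolding exp_decay_def
proof
  fix m
  have "compact ((\<lambda>r. d m r * exp (b * r)) ` {0..R})"
    by (intro compact_continuous_image continuous_intros deriv_family_continuous d) auto
  then obtain K where K: "\<And>r. r \<in> {0..R} \<Longrightarrow> \<bar>d m r * exp (b * r)\<bar> \<le> K"
    by (metis (no_types, lifting) bounded_iff compact_imp_bounded imageI real_norm_def)
  have "\<bar>d m r\<bar> \<le> max 0 K * exp (- b * r)" if "0 \<le> r" for r
  proof (cases "r \<le> R")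
    case True
    then show ?thesis using K[of r] that by (auto simp: abs_mult exp_minus field_simps max_def)
  next
    case False
    then show ?thesis by (simp add: 0)
  qed
  then show "\<exists>K. \<forall>r\<ge>0. \<bar>d m r\<bar> \<le> K * exp (- b * r)" by blast
qed

lemma exp_decay_cut_exp: "0 < c \<Longrightarrow> exp_decay b' (cut_exp c b)"
  by (rule exp_decay_compact_support[where R = "2 * c"]) (auto simp: deriv_family_cut_exp cut_exp_eq_0)

text \<open>In Leibniz' formula a term that differentiates the cutoff carries at least one factor
  \<open>1 / c\<close>. The remaining term contains \<open>cutoff 0 (r / c) - 1\<close>, which
  vanishes for \<open>r \<le> c\<close> and is thus at most a constant times \<open>r / c\<close>;
  half of the exponential rate absorbs this \<open>r\<close>.\<close>

lemma exp_conv_cut_exp: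
  assumes b: "0 < b"
  shows "exp_conv (b / 2) (\<lambda>k. cut_exp (real (Suc k)) b) (exp_family b)"
  unfolding exp_conv_def
proof
  fix m
  obtain K where K: "\<And>i. 0 \<le> K i" "\<And>i r. \<bar>cutoff i r\<bar> \<le> K i"
    using cutoff_bounded by metis
  define B where "B = (\<Sum>i<m. real (m choose Suc i) * (K (Suc i) * b ^ (m - Suc i)))"
  have B: "0 \<le> B" unfolding B_def using K b by (intro sum_nonneg mult_nonneg_nonneg) auto
  define A where "A = (K 0 + 1) * b ^ m"
  have A: "0 \<le> A" using K b by (simp add: A_def)
  have "\<bar>cut_exp c b m r - exp_family b m r\<bar> \<le> (A * (2 / b) + B) / c * exp (- (b / 2) * r)"
    if r: "0 \<le> r" and c: "1 \<le> c" for c r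
  proof -
    have "cut_exp c b m r - exp_family b m r = (cutoff 0 (r / c) - 1) * exp_family b m r +
        (\<Sum>i<m. real (m choose Suc i) * (((1 / c) ^ Suc i * cutoff (Suc i) (r / c)) * exp_family b (m - Suc i) r))"
      unfolding cut_exp_def mult_family_def sum.atMost_shift
      by (simp add: scaled_cutoff_def algebra_simps del: cutoff.simps)
    moreover have "\<bar>(cutoff 0 (r / c) - 1) * exp_family b m r\<bar> \<le> A * (r / c) * exp (- b * r)"
    proof -
      have "\<bar>cutoff 0 (r / c) - 1\<bar> \<le> (K 0 + 1) * (r / c)"
      proof (cases "r / c \<le> 1")
        case True
        then show ?thesis using K r c by (simp add: cutoff_eq_1 del: cutoff.simps)
      next
        case False
        have "\<bar>cutoff 0 (r / c) - 1\<bar> \<le> (K 0 + 1) * 1"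
          using K(2)[of 0 "r / c"] by (simp del: cutoff.simps)
        also have "\<dots> \<le> (K 0 + 1) * (r / c)"
          using False K(1)[of 0] by (intro mult_left_mono) auto
        finally show ?thesis .
      qed
      then have "\<bar>cutoff 0 (r / c) - 1\<bar> * \<bar>exp_family b m r\<bar> \<le> (K 0 + 1) * (r / c) * (b ^ m * exp (- b * r))"
        using b r c K by (intro mult_mono) (auto simp: exp_family_def abs_mult power_abs)
      then show ?thesis by (simp add: A_def abs_mult mult_ac del: cutoff.simps)
    qed
    moreover have "\<bar>\<Sum>i<m. real (m choose Suc i) * (((1 / c) ^ Suc i * cutoff (Suc i) (r / c)) * exp_family b (m - Suc i) r)\<bar>
        \<le> B / c * exp (- b * r)"
    proof -
      have "\<bar>\<Sum>i<m. real (m choose Suc i) * (((1 / c) ^ Suc i * cutoff (Suc i) (r / c)) * exp_family b (m - Suc i) r)\<bar>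
        \<le> (\<Sum>i<m. real (m choose Suc i) * ((1 / c * K (Suc i)) * (b ^ (m - Suc i) * exp (- b * r))))"
      proof (rule order_trans[OF sum_abs], rule sum_mono)
        fix i
        have "(1 / c) ^ Suc i \<le> (1 / c) ^ 1"
          using c by (intro power_decreasing) auto
        then have "\<bar>(1 / c) ^ Suc i * cutoff (Suc i) (r / c)\<bar> \<le> 1 / c * K (Suc i)"
          unfolding abs_mult using c by (intro mult_mono K) (auto simp: power_abs)
        moreover have "\<bar>exp_family b (m - Suc i) r\<bar> \<le> b ^ (m - Suc i) * exp (- b * r)"
          using b by (simp add: exp_family_def abs_mult power_abs)
        ultimately have "\<bar>(1 / c) ^ Suc i * cutoff (Suc i) (r / c)\<bar> * \<bar>exp_family b (m - Suc i) r\<bar> \<le>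
            (1 / c * K (Suc i)) * (b ^ (m - Suc i) * exp (- b * r))"
          using K c by (intro mult_mono) auto
        then show "\<bar>real (m choose Suc i) * (((1 / c) ^ Suc i * cutoff (Suc i) (r / c)) * exp_family b (m - Suc i) r)\<bar>
            \<le> real (m choose Suc i) * ((1 / c * K (Suc i)) * (b ^ (m - Suc i) * exp (- b * r)))"
          unfolding abs_mult abs_of_nat by (intro mult_left_mono) (auto simp: mult_ac)
      qed
      also have "\<dots> = B / c * exp (- b * r)"
        unfolding B_def sum_divide_distrib sum_distrib_right by (intro sum.cong refl) simp
      finally show ?thesis .
    qed
    ultimately have "\<bar>cut_exp c b m r - exp_family b m r\<bar> \<le> A * (r / c) * exp (- b * r) + B / c * exp (- b * r)"
      by linarith
    also have "\<dots> = (A * r + B) * exp (- (b / 2) * r) / c * exp (- (b / 2) * r)"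
    proof -
      have "exp (- b * r) = exp (- (b / 2) * r) * exp (- (b / 2) * r)"
        unfolding exp_add[symmetric] by simp
      then show ?thesis using c by (simp add: field_simps)
    qed
    also have "\<dots> \<le> (A * (2 / b) + B) / c * exp (- (b / 2) * r)"
    proof (intro mult_right_mono divide_right_mono)
      have "r * exp (- (b / 2) * r) \<le> 2 / b"
      proof -
        have "b / 2 * r \<le> exp (b / 2 * r)"
          using exp_ge_add_one_self[of "b / 2 * r"] by linarith
        then show ?thesis using b by (simp add: exp_minus field_simps)
      qed
      then have "A * (r * exp (- (b / 2) * r)) \<le> A * (2 / b)"
        using A by (intro mult_left_mono)
      moreover have "exp (- (b / 2) * r) \<le> 1"
        using b r by simp
      then have "B * exp (- (b / 2) * r) \<le> B * 1"
        using B by (intro mult_left_mono)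
      ultimately show "(A * r + B) * exp (- (b / 2) * r) \<le> A * (2 / b) + B"
        by (simp add: algebra_simps)
    qed (use c in auto)
    finally show ?thesis .
  qed
  then show "\<exists>K. \<forall>k\<ge>m. \<forall>r\<ge>0. \<bar>cut_exp (real (Suc k)) b m r - exp_family b m r\<bar>
      \<le> K / real (Suc k) * exp (- (b / 2) * r)"
    by (intro exI[of _ "A * (2 / b) + B"]) auto
qed

text \<open>The exponents start at 1, which gives all these sums the common decay rate 1.\<close>

definition exp_sum_family :: "(nat \<Rightarrow> real) \<Rightarrow> nat \<Rightarrow> nat \<Rightarrow> real \<Rightarrow> real" where
  "exp_sum_family c M m r = (\<Sum>l\<le>M. c l * exp_family (real (Suc l)) m r)"

lemma deriv_family_exp_sum: "deriv_family (exp_sum_family c M)"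
  unfolding deriv_family_def exp_sum_family_def
  by (intro allI DERIV_sum DERIV_cmult deriv_familyD deriv_family_exp)

lemma exp_decay_exp_sum: "exp_decay 1 (exp_sum_family c M)"
  unfolding exp_decay_def
proof
  fix m
  have "\<exists>K. \<forall>r\<ge>0. \<bar>exp_family (real (Suc l)) m r\<bar> \<le> K * exp (- 1 * r)" for l
    using exp_decay_exp[of 1 "real (Suc l)"] unfolding exp_decay_def by simp
  then obtain K where K: "\<And>l r. 0 \<le> r \<Longrightarrow> \<bar>exp_family (real (Suc l)) m r\<bar> \<le> K l * exp (- 1 * r)"
    by metis
  have "\<bar>exp_sum_family c M m r\<bar> \<le> (\<Sum>l\<le>M. \<bar>c l\<bar> * K l) * exp (- 1 * r)" if "0 \<le> r" for r
    unfolding exp_sum_family_def sum_distrib_right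
    by (rule order_trans[OF sum_abs], rule sum_mono)
      (use K[OF that] in \<open>auto simp: abs_mult mult.assoc intro!: mult_left_mono\<close>)
  then show "\<exists>K. \<forall>r\<ge>0. \<bar>exp_sum_family c M m r\<bar> \<le> K * exp (- 1 * r)" by blast
qed

lemma exp_decay_tendsto_0:
  assumes "exp_decay b d" "0 < b"
  shows "(d m \<longlongrightarrow> 0) at_top"
proof -
  obtain K where K: "\<And>r. 0 \<le> r \<Longrightarrow> \<bar>d m r\<bar> \<le> K * exp (- b * r)"
    using assms(1) unfolding exp_decay_def by metis
  show ?thesis
  proof (rule Lim_null_comparison)
    show "eventually (\<lambda>r. norm (d m r) \<le> K * exp (- b * r)) at_top"
      using eventually_ge_at_top[of 0] by eventually_elim (use K in auto)
    have "((\<lambda>r. exp (- b * r)) \<longlongrightarrow> 0) at_top"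
      using assms(2)
      by (intro filterlim_compose[OF exp_at_bot]
          filterlim_tendsto_neg_mult_at_bot[OF tendsto_const] filterlim_ident) auto
    then show "((\<lambda>r. K * exp (- b * r)) \<longlongrightarrow> 0) at_top"
      by (rule tendsto_mult_right_zero)
  qed
qed

text \<open>Both \<open>\<delta> * exp (- r) + d r\<close> and
  \<open>\<delta> * exp (- r) - d r\<close> are nonincreasing on \<open>r \<ge> 0\<close> and tend
  to 0, hence are nonnegative. The weight \<open>exp (- r)\<close> reproduces itself under
  integration, so no constant is lost.\<close>

lemma exp_bound_antiderivative:
  fixes d d' :: "real \<Rightarrow> real"
  assumes d: "\<And>r. (d has_real_derivative d' r) (at r)"
    and d': "\<And>r. 0 \<le> r \<Longrightarrow> \<bar>d' r\<bar> \<le> \<delta> * exp (- r)"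
    and lim: "(d \<longlongrightarrow> 0) at_top" and r: "0 \<le> r"
  shows "\<bar>d r\<bar> \<le> \<delta> * exp (- r)"
proof -
  have e: "((\<lambda>r. exp (- r) :: real) \<longlongrightarrow> 0) at_top"
    by (intro filterlim_compose[OF exp_at_bot] filterlim_uminus_at_bot_at_top)
  have lb: "0 \<le> g r" if g: "\<And>r. 0 \<le> r \<Longrightarrow> \<exists>y. (g has_real_derivative y) (at r) \<and> y \<le> 0"
    and gl: "(g \<longlongrightarrow> 0) at_top" for g :: "real \<Rightarrow> real"
  proof (rule tendsto_upperbound[OF gl])
    show "eventually (\<lambda>x. g x \<le> g r) at_top"
      using eventually_ge_at_top[of r]
    proof eventually_elim
      case (elim x)
      show ?case
        by (rule DERIV_nonpos_imp_nonincreasing[OF elim]) (use g r in auto)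
    qed
  qed simp
  have "0 \<le> d r + \<delta> * exp (- r)"
  proof (rule lb[of "\<lambda>r. d r + \<delta> * exp (- r)"])
    show "((\<lambda>r. d r + \<delta> * exp (- r)) \<longlongrightarrow> 0) at_top"
      using tendsto_add[OF lim tendsto_mult_right_zero[OF e, of \<delta>]] by simp
    fix x :: real assume "0 \<le> x"
    then show "\<exists>y. ((\<lambda>r. d r + \<delta> * exp (- r)) has_real_derivative y) (at x) \<and> y \<le> 0"
      using d'[of x] by (intro exI[of _ "d' x + \<delta> * (- exp (- x))"]) (auto intro!: derivative_eq_intros d)
  qed
  moreover have "0 \<le> \<delta> * exp (- r) - d r"
  proof (rule lb[of "\<lambda>r. \<delta> * exp (- r) - d r"])
    show "((\<lambda>r. \<delta> * exp (- r) - d r) \<longlongrightarrow> 0) at_top"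
      using tendsto_diff[OF tendsto_mult_right_zero[OF e, of \<delta>] lim] by simp
    fix x :: real assume "0 \<le> x"
    then show "\<exists>y. ((\<lambda>r. \<delta> * exp (- r) - d r) has_real_derivative y) (at x) \<and> y \<le> 0"
      using d'[of x] by (intro exI[of _ "\<delta> * (- exp (- x)) - d' x"]) (auto intro!: derivative_eq_intros d)
  qed
  ultimately show ?thesis by linarith
qed

text \<open>Only the highest derivative is approximated, by the Weierstrass theorem in \<open>y = exp (- r)\<close>.
  Integrating from infinity carries the estimate down to the function itself, and exponential sums
  remain exponential sums.\<close>

lemma exp_sum_approx_step:
  assumes u: "deriv_family u" "\<And>m r. R \<le> r \<Longrightarrow> u m r = 0" and \<delta>: "0 < \<delta>"
  shows "\<exists>c M. \<forall>j\<le>J. \<forall>r\<ge>0. \<bar>exp_sum_family c M j r - u j r\<bar> \<le> \<delta> * exp (- r)"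
proof -
  \<comment> \<open>An exponential sum with exponents from 1 on is \<open>y\<close> times a
    polynomial in \<open>y = exp (- r)\<close>; this accounts for the division by \<open>y\<close>.
    Since \<open>u\<close> vanishes from \<open>R\<close> on, \<open>v\<close> is zero near
    \<open>y = 0\<close> and therefore continuous on the closed interval.\<close>
  define v where "v y = (if y \<le> 0 then 0 else u J (- ln y) / y)" for y :: real
  have "continuous_on {0..1} v"
  proof -
    have "continuous_on ({..<exp (- R)} \<union> {0<..}) v"
    proof (rule continuous_on_open_Un)
      have "v y = 0" if "y < exp (- R)" for y
      proof (cases "0 < y")
        case True
        then have "ln y \<le> - R"
          using that by (metis less_imp_le ln_exp ln_le_cancel_iff exp_gt_zero)
        then show ?thesis by (simp add: v_def u)
      qed (simp add: v_def)
      then show "continuous_on {..<exp (- R)} v"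
        by (subst continuous_on_cong[OF refl, where g = "\<lambda>_. 0"]) auto
      have "continuous_on {0<..} (\<lambda>y. u J (- ln y) / y)"
        by (intro continuous_intros continuous_on_compose2[OF deriv_family_continuous[OF u(1), of UNIV J]]) auto
      then show "continuous_on {0<..} v"
        by (rule continuous_on_eq) (auto simp: v_def)
    qed auto
    then show ?thesis
    proof (rule continuous_on_subset)
      show "{0..1} \<subseteq> {..<exp (- R)} \<union> {0<..}"
        by (smt (verit) UnI1 UnI2 atLeastAtMost_iff exp_gt_zero greaterThan_iff lessThan_iff subsetI)
    qed
  qed
  then obtain p where p: "real_polynomial_function p" "\<And>y. y \<in> {0..1} \<Longrightarrow> \<bar>v y - p y\<bar> < \<delta>"
    using Stone_Weierstrass_real_polynomial_function[of "{0..1}" v \<delta>] \<delta> by auto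
  obtain a n where a: "p = (\<lambda>x. \<Sum>i\<le>n. a i * x ^ i)"
    using p(1) real_polynomial_function_iff_sum by auto
  \<comment> \<open>Differentiating \<open>exp (- real (Suc i) * r)\<close> exactly \<open>J\<close>
    times produces the power that is divided out here.\<close>
  define c where "c i = a i / (- real (Suc i)) ^ J" for i
  let ?D = "\<lambda>j r. exp_sum_family c n j r - u j r"
  have base: "\<bar>?D J r\<bar> \<le> \<delta> * exp (- r)" if "0 \<le> r" for r
  proof -
    have "exp_sum_family c n J r = (\<Sum>i\<le>n. a i * exp (- r) ^ i) * exp (- r)"
      unfolding exp_sum_family_def sum_distrib_right
    proof (rule sum.cong[OF refl])
      fix i
      have "exp (- real (Suc i) * r) = exp (- r) ^ i * exp (- r)"
        by (metis exp_of_nat_mult mult_minus_left mult_minus_right power_Suc2)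
      then show "c i * exp_family (real (Suc i)) J r = a i * exp (- r) ^ i * exp (- r)"
        by (simp add: c_def exp_family_def)
    qed
    then have "exp_sum_family c n J r = p (exp (- r)) * exp (- r)"
      by (simp add: a)
    moreover have "u J r = v (exp (- r)) * exp (- r)"
      by (simp add: v_def not_le)
    ultimately have "\<bar>?D J r\<bar> = \<bar>v (exp (- r)) - p (exp (- r))\<bar> * exp (- r)"
      by (metis (no_types, lifting) abs_exp_cancel abs_minus_commute abs_mult left_diff_distrib)
    then show ?thesis
      using p(2)[of "exp (- r)"] that by simp
  qed
  have "\<bar>?D (J - i) r\<bar> \<le> \<delta> * exp (- r)" if "i \<le> J" "0 \<le> r" for i r
    using that
  proof (induction i arbitrary: r)
    case (Suc i)
    define j where "j = J - Suc i"
    have j: "J - i = Suc j" using Suc.prems by (simp add: j_def)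
    show ?case
      unfolding j_def[symmetric]
    proof (rule exp_bound_antiderivative)
      show "(?D j has_real_derivative ?D (Suc j) r) (at r)" for r
        by (intro DERIV_diff deriv_familyD deriv_family_exp_sum u)
      show "\<bar>?D (Suc j) r\<bar> \<le> \<delta> * exp (- r)" if "0 \<le> r" for r
        using Suc.IH[of r] Suc.prems that j by simp
      show "(?D j \<longlongrightarrow> 0) at_top"
        using tendsto_diff[OF exp_decay_tendsto_0[OF exp_decay_exp_sum[of c n], of j]
            exp_decay_tendsto_0[OF exp_decay_compact_support[of u R 1], of j]] u by auto
    qed (use Suc in auto)
  qed (use base in auto)
  then have "\<bar>?D j r\<bar> \<le> \<delta> * exp (- r)" if "j \<le> J" "0 \<le> r" for j r
    using that by (metis diff_diff_cancel diff_le_self)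
  then show ?thesis by blast
qed

text \<open>A diagonal choice: the approximant with index \<open>k\<close> has accuracy
  \<open>1 / real (Suc k)\<close> in all derivatives up to order \<open>k\<close>.\<close>

lemma exp_sum_approx:
  assumes "deriv_family u" "\<And>m r. R \<le> r \<Longrightarrow> u m r = 0"
  shows "\<exists>c M. exp_conv 1 (\<lambda>k. exp_sum_family (c k) (M k)) u"
proof -
  have "\<forall>k. \<exists>c M. \<forall>j\<le>k. \<forall>r\<ge>0. \<bar>exp_sum_family c M j r - u j r\<bar> \<le> 1 / real (Suc k) * exp (- r)"
    by (intro allI exp_sum_approx_step[where R = R]) (use assms in auto)
  then obtain c M where "\<And>k j r. j \<le> k \<Longrightarrow> 0 \<le> r \<Longrightarrow>
      \<bar>exp_sum_family (c k) (M k) j r - u j r\<bar> \<le> 1 / real (Suc k) * exp (- r)"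
    by metis
  then have "exp_conv 1 (\<lambda>k. exp_sum_family (c k) (M k)) u"
    unfolding exp_conv_def by (intro allI exI[of _ 1]) auto
  then show ?thesis by blast
qed

section \<open>The span of the Gaussians\<close>

definition gauss :: "real^'n::finite \<Rightarrow> real^'n \<Rightarrow> real" where
  "gauss a x = exp (- (\<Sum>i\<in>UNIV. a $ i * (x $ i)\<^sup>2))"

lemma gauss_pos: "0 < gauss a x"
  by (simp add: gauss_def)

lemma gauss_prod: "gauss a x = (\<Prod>i\<in>UNIV. exp (- (a $ i) * (x $ i)\<^sup>2))"
  by (simp add: gauss_def exp_sum[symmetric] sum_negf)

lemma gauss_add: "gauss (a + b) x = gauss a x * gauss b x"
  by (simp add: gauss_def exp_add[symmetric] sum.distrib distrib_right)

lemma gauss_const: "gauss (\<chi> i. c) x = exp (- c * (norm x)\<^sup>2)"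
  unfolding gauss_prod using prod_exp_square[of c x] by simp

text \<open>The exponents may differ from coordinate to coordinate. Density relies on this, since
  there a Gaussian sum is multiplied by Gaussians in a single coordinate.\<close>

inductive_set gauss_span :: "(real^'n::finite \<Rightarrow> complex) set" where
  single: "(\<And>i. 0 < a $ i) \<Longrightarrow> (\<lambda>x. c * complex_of_real (gauss a x)) \<in> gauss_span"
| add: "f \<in> gauss_span \<Longrightarrow> g \<in> gauss_span \<Longrightarrow> (\<lambda>x. f x + g x) \<in> gauss_span"

lemma gauss_eq_prodsq: "(\<lambda>x. complex_of_real (gauss a x)) = prodsq (\<lambda>i. exp_family (a $ i))"
  by (simp add: fun_eq_iff gauss_prod prodsq_def exp_family_def)

lemma common_lower_bound:
  fixes a :: "real^'n::finite"
  assumes "\<And>i. 0 < a $ i"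
  obtains b where "0 < b" "\<And>i. b \<le> a $ i"
proof
  show "0 < Min (range (\<lambda>i. a $ i))" using assms by simp
  show "Min (range (\<lambda>i. a $ i)) \<le> a $ i" for i by simp
qed

lemma gauss_S_even:
  assumes "\<And>i. 0 < a $ i"
  shows "(\<lambda>x. complex_of_real (gauss a x)) \<in> S_even"
proof -
  obtain b where "0 < b" "\<And>i. b \<le> a $ i"
    using common_lower_bound[OF assms] by blast
  then show ?thesis
    unfolding gauss_eq_prodsq by (intro prodsq_S_even[of b] deriv_family_exp exp_decay_exp)
qed

lemma S_even_add: "f \<in> S_even \<Longrightarrow> g \<in> S_even \<Longrightarrow> (\<lambda>x. f x + g x) \<in> S_even"
  using S_even_lincomb[of f g 1 1] by simp

lemma S_even_scale: "f \<in> S_even \<Longrightarrow> (\<lambda>x. c * f x) \<in> S_even"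
  using S_even_lincomb[of f f c 0] by simp

lemma gauss_span_S_even: "f \<in> gauss_span \<Longrightarrow> f \<in> S_even"
  by (induction rule: gauss_span.induct) (rule S_even_add S_even_scale gauss_S_even | assumption)+

lemma gauss_span_zero: "(\<lambda>x. 0) \<in> gauss_span"
  using gauss_span.single[of "\<chi> i. 1" 0] by simp

lemma gauss_span_scale: "f \<in> gauss_span \<Longrightarrow> (\<lambda>x. c * f x) \<in> gauss_span"
proof (induction rule: gauss_span.induct)
  case (single a d)
  then show ?case using gauss_span.single[of a "c * d"] by (simp add: mult.assoc)
next
  case (add f g)
  then show ?case using gauss_span.add[of "\<lambda>x. c * f x" "\<lambda>x. c * g x"] by (simp add: distrib_left)
qed

lemma gauss_span_sum:
  assumes "finite I" "\<And>i. i \<in> I \<Longrightarrow> f i \<in> gauss_span"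
  shows "(\<lambda>x. \<Sum>i\<in>I. f i x) \<in> gauss_span"
  using assms by (induction rule: finite_induct) (auto intro: gauss_span_zero gauss_span.add)

lemma gauss_span_mult_gauss:
  assumes "f \<in> gauss_span" "\<And>i. 0 \<le> b $ i"
  shows "(\<lambda>x. f x * complex_of_real (gauss b x)) \<in> gauss_span"
  using assms(1)
proof (induction rule: gauss_span.induct)
  case (single a c)
  then have "0 < (a + b) $ i" for i using assms(2) by (simp add: add_pos_nonneg)
  from gauss_span.single[OF this, of c] show ?case by (simp add: gauss_add mult.assoc)
next
  case (add f g)
  then show ?case
    using gauss_span.add[of "\<lambda>x. f x * complex_of_real (gauss b x)" "\<lambda>x. g x * complex_of_real (gauss b x)"]
    by (simp add: distrib_right)
qed

lemma gauss_span_cnj: "f \<in> gauss_span \<Longrightarrow> (\<lambda>x. cnj (f x)) \<in> gauss_span"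
proof (induction rule: gauss_span.induct)
  case (single a d)
  then show ?case using gauss_span.single[of a "cnj d"] by simp
next
  case (add f g)
  then show ?case using gauss_span.add by simp
qed

lemma gauss_span_norm_le:
  assumes "f \<in> gauss_span"
  shows "\<exists>K b. 0 \<le> K \<and> 0 < b \<and> (\<forall>x. norm (f x) \<le> K * exp (- b * (norm x)\<^sup>2))"
  using assms
proof (induction rule: gauss_span.induct)
  case (single a c)
  obtain b where b: "0 < b" "\<And>i. b \<le> a $ i"
    using common_lower_bound[OF single] by blast
  have "gauss a x \<le> exp (- b * (norm x)\<^sup>2)" for x
    unfolding gauss_prod prod_exp_square[symmetric]
    by (intro prod_mono conjI) (auto intro!: mult_right_mono b)
  then have "norm (c * complex_of_real (gauss a x)) \<le> norm c * exp (- b * (norm x)\<^sup>2)" for x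
    using gauss_pos[of a x] by (simp add: norm_mult mult_left_mono)
  then show ?case
    using b by (intro exI[of _ "norm c"] exI[of _ b]) auto
next
  case (add f g)
  then obtain K b L c where *: "0 \<le> K" "0 < b" "\<And>x. norm (f x) \<le> K * exp (- b * (norm x)\<^sup>2)"
    "0 \<le> L" "0 < c" "\<And>x. norm (g x) \<le> L * exp (- c * (norm x)\<^sup>2)"
    by blast
  have "norm (f x + g x) \<le> (K + L) * exp (- min b c * (norm x)\<^sup>2)" for x
  proof -
    have "norm (f x + g x) \<le> K * exp (- b * (norm x)\<^sup>2) + L * exp (- c * (norm x)\<^sup>2)"
      by (rule norm_triangle_le) (intro add_mono *)
    also have "\<dots> \<le> K * exp (- min b c * (norm x)\<^sup>2) + L * exp (- min b c * (norm x)\<^sup>2)"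
      using * by (intro add_mono mult_left_mono) (auto intro!: mult_right_mono)
    finally show ?thesis by (simp add: distrib_right)
  qed
  then show ?case
    using * by (intro exI[of _ "K + L"] exI[of _ "min b c"]) auto
qed

lemma gauss_span_continuous:
  assumes "f \<in> gauss_span"
  shows "continuous_on UNIV f"
  using assms
proof (induction rule: gauss_span.induct)
  case (single a c)
  show ?case unfolding gauss_def by (intro continuous_intros)
qed (intro continuous_intros)

section \<open>Localisation\<close>

text \<open>Equal to 1 where all \<open>(x $ i)\<^sup>2 \<le> c\<close> and to 0 where some
  \<open>(x $ i)\<^sup>2 \<ge> 2 * c\<close>. A cutoff of product form, rather than a radial one,
  fits \<open>prodsq\<close>.\<close>

definition cube_cutoff :: "real \<Rightarrow> real^'n::finite \<Rightarrow> real" where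
  "cube_cutoff c x = (\<Prod>i\<in>UNIV. cutoff 0 ((x $ i)\<^sup>2 / c))"

lemma prodsq_cut_exp:
  "prodsq (\<lambda>i. cut_exp c (a $ i)) = (\<lambda>x. complex_of_real (cube_cutoff c x) * complex_of_real (gauss a x))"
  by (simp add: fun_eq_iff prodsq_def cut_exp_0 prod.distrib gauss_prod cube_cutoff_def del: cutoff.simps)

lemma prodsq_cut_exp_S_even:
  assumes "0 < c"
  shows "prodsq (\<lambda>i. cut_exp c (a $ i)) \<in> S_even"
  by (rule prodsq_S_even[of 1]) (auto simp: assms deriv_family_cut_exp exp_decay_cut_exp)

lemma prodsq_cut_exp_D_even:
  fixes a :: "real^'n::finite"
  assumes "0 < c"
  shows "prodsq (\<lambda>i. cut_exp c (a $ i)) \<in> D_even"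
proof -
  have "norm x \<le> real CARD('n) * sqrt (2 * c)" if "prodsq (\<lambda>i. cut_exp c (a $ i)) x \<noteq> 0" for x
  proof -
    have "\<bar>x $ i\<bar> \<le> sqrt (2 * c)" for i
    proof (rule ccontr)
      assume "\<not> \<bar>x $ i\<bar> \<le> sqrt (2 * c)"
      then have "2 * c \<le> (x $ i)\<^sup>2"
        by (metis linorder_not_le nle_le real_sqrt_abs real_sqrt_le_iff)
      then have "cut_exp c (a $ i) 0 ((x $ i)\<^sup>2) = 0"
        using assms by (intro cut_exp_eq_0)
      then show False
        using that by (auto simp: prodsq_def)
    qed
    then have "(\<Sum>i\<in>UNIV. \<bar>x $ i\<bar>) \<le> real CARD('n) * sqrt (2 * c)"
      using sum_bounded_above[of UNIV "\<lambda>i. \<bar>x $ i\<bar>" "sqrt (2 * c)"] by simp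
    then show ?thesis
      using norm_le_l1_cart[of x] by linarith
  qed
  then have "bounded {x. prodsq (\<lambda>i. cut_exp c (a $ i)) x \<noteq> 0}"
    by (auto simp: bounded_iff)
  then show ?thesis
    by (simp add: D_even_def smooth_fun_prodsq deriv_family_cut_exp even_fun_prodsq compact_closure)
qed

lemma smooth_fun_diff:
  assumes "smooth_fun f" "smooth_fun g"
  shows "smooth_fun (\<lambda>x. f x - g x)"
  unfolding smooth_fun_def
proof (intro allI)
  fix "is" x
  have "iter_partial is (\<lambda>x. f x - g x) = (\<lambda>x. iter_partial is f x - iter_partial is g x)"
    using iter_partial_lincomb[OF assms, of "is" 1 "-1"] by simp
  then show "iter_partial is (\<lambda>x. f x - g x) differentiable (at x)"
    using assms by (simp add: smooth_fun_def differentiable_diff)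
qed

lemma D_even_diff:
  assumes "f \<in> D_even" "g \<in> D_even"
  shows "(\<lambda>x. f x - g x) \<in> D_even"
proof -
  have "bounded {x. f x \<noteq> 0}" "bounded {x. g x \<noteq> 0}"
    using assms by (auto simp: D_even_def dest!: compact_imp_bounded intro: bounded_subset[OF _ closure_subset])
  then have "bounded {x. f x - g x \<noteq> 0}"
    by (rule bounded_subset[OF bounded_Un[THEN iffD2, OF conjI]]) auto
  then show ?thesis
    using assms by (auto simp: D_even_def smooth_fun_diff even_fun_def compact_closure)
qed

lemma exp_conv_mono:
  assumes "exp_conv b D d" "c \<le> b"
  shows "exp_conv c D d"
  unfolding exp_conv_def
proof
  fix m
  obtain K where K: "0 \<le> K" "\<And>k r. m \<le> k \<Longrightarrow> 0 \<le> r \<Longrightarrow> \<bar>D k m r - d m r\<bar> \<le> K / real (Suc k) * exp (- b * r)"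
    using exp_conv_nonneg_bound[OF assms(1), of m] by (meson order_refl)
  have "\<bar>D k m r - d m r\<bar> \<le> K / real (Suc k) * exp (- c * r)" if "m \<le> k" "0 \<le> r" for k r
  proof -
    have "K / real (Suc k) * exp (- b * r) \<le> K / real (Suc k) * exp (- c * r)"
      using K(1) assms(2) that by (intro mult_left_mono) (auto intro: mult_right_mono)
    then show ?thesis using K(2)[OF that] by linarith
  qed
  then show "\<exists>K. \<forall>k\<ge>m. \<forall>r\<ge>0. \<bar>D k m r - d m r\<bar> \<le> K / real (Suc k) * exp (- c * r)"
    by blast
qed

lemma cube_cutoff_eq_1:
  assumes "0 < \<epsilon>" "4 * \<epsilon>\<^sup>2 \<le> c" "norm x \<le> 2 * \<epsilon>"
  shows "cube_cutoff c x = 1"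
  unfolding cube_cutoff_def
proof (rule prod.neutral, rule ballI)
  fix i
  have "\<bar>x $ i\<bar> \<le> 2 * \<epsilon>"
    using component_le_norm_cart[of x i] assms by linarith
  then have "(x $ i)\<^sup>2 \<le> (2 * \<epsilon>)\<^sup>2"
    by (metis abs_ge_zero power2_abs power_mono)
  also have "\<dots> \<le> c" using assms by (simp add: power2_eq_square)
  finally have "(x $ i)\<^sup>2 \<le> c" .
  moreover have "0 < c"
    using assms by (intro less_le_trans[OF _ assms(2)]) simp
  ultimately show "cutoff 0 ((x $ i)\<^sup>2 / c) = 1"
    by (intro cutoff_eq_1) simp
qed

text \<open>The support condition speaks of compactly supported test functions only. Expanding
  cutoffs approximate the Gaussian in the Schwartz topology, and any two sufficiently wide cutoffs
  differ by an element of \<open>D_even\<close> vanishing near the ball.\<close>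

lemma supported_gauss_eq:
  fixes T :: "'n::finite functional"
  assumes T: "T \<in> tempered_even" and supp: "supported_in T (cball 0 \<epsilon>)" and \<epsilon>: "0 < \<epsilon>"
    and a: "\<And>i. 0 < a $ i"
  shows "T (\<lambda>x. complex_of_real (gauss a x)) = T (prodsq (\<lambda>i. cut_exp (4 * \<epsilon>\<^sup>2) (a $ i)))"
proof -
  let ?c = "4 * \<epsilon>\<^sup>2"
  let ?V = "\<lambda>k i. cut_exp (real (Suc k)) (a $ i)"
  let ?w = "prodsq (\<lambda>i. cut_exp ?c (a $ i))"
  obtain b where b: "0 < b" "\<And>i. b \<le> a $ i"
    using common_lower_bound[OF a] by blast
  have "(\<lambda>k. T (prodsq (?V k))) \<longlonglongrightarrow> T (prodsq (\<lambda>i. exp_family (a $ i)))"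
  proof (rule tempered_even_prodsq_tendsto[OF T, of "b / 2"])
    show "exp_conv (b / 2) (\<lambda>k. ?V k i) (exp_family (a $ i))" for i
      by (rule exp_conv_mono[OF exp_conv_cut_exp[OF a]]) (simp add: b)
    show "exp_decay (b / 2) (exp_family (a $ i))" for i
      using b(1) b(2)[of i] by (intro exp_decay_exp) linarith
  qed (auto simp: b deriv_family_exp deriv_family_cut_exp prodsq_cut_exp_S_even simp del: of_nat_Suc)
  moreover have "T (prodsq (?V k)) = T ?w" if k: "?c \<le> real (Suc k)" for k
  proof -
    have S: "prodsq (?V k) \<in> S_even" "?w \<in> S_even"
      using \<epsilon> by (auto intro!: prodsq_cut_exp_S_even simp del: of_nat_Suc)
    have "T (\<lambda>x. prodsq (?V k) x - ?w x) = 0"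
    proof (rule supp[unfolded supported_in_def, rule_format])
      show "(\<lambda>x. prodsq (?V k) x - ?w x) \<in> D_even"
        using \<epsilon> by (auto intro!: D_even_diff prodsq_cut_exp_D_even simp del: of_nat_Suc)
      \<comment> \<open>The cutoff parameter \<open>4 * \<epsilon>\<^sup>2\<close> makes both
        cutoffs equal to 1 on the ball of radius \<open>2 * \<epsilon>\<close>, which serves as the
        neighbourhood.\<close>
      show "\<exists>U. open U \<and> cball 0 \<epsilon> \<subseteq> U \<and> (\<forall>x\<in>U. prodsq (?V k) x - ?w x = 0)"
        by (rule exI[of _ "ball 0 (2 * \<epsilon>)"])
          (use \<epsilon> k in \<open>auto simp: prodsq_cut_exp cube_cutoff_eq_1 simp del: of_nat_Suc\<close>)
    qed
    then show ?thesis
      using tempered_even_lincomb[OF T S, of 1 "-1"] by simp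
  qed
  then have "eventually (\<lambda>k. T (prodsq (?V k)) = T ?w) sequentially"
  proof (rule eventually_mono[rotated])
    obtain N :: nat where "?c \<le> real N" using real_arch_simple by blast
    then show "eventually (\<lambda>k. ?c \<le> real (Suc k)) sequentially"
      unfolding eventually_sequentially by (intro exI[of _ N]) auto
  qed
  ultimately have "(\<lambda>k. T ?w) \<longlonglongrightarrow> T (prodsq (\<lambda>i. exp_family (a $ i)))"
    by (rule Lim_transform_eventually)
  then show ?thesis
    by (metis LIMSEQ_const_iff gauss_eq_prodsq)
qed

lemma prodsq_exp_sum_gauss_span:
  fixes c :: "'n::finite \<Rightarrow> nat \<Rightarrow> real"
  shows "prodsq (\<lambda>i. exp_sum_family (c i) (M i)) \<in> gauss_span"
proof -
  \<comment> \<open>Expanding the product of sums gives one Gaussian for each choice of an exponent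
    in every coordinate.\<close>
  let ?P = "PiE UNIV (\<lambda>i. {..M i})"
  have "prodsq (\<lambda>i. exp_sum_family (c i) (M i)) =
      (\<lambda>x. \<Sum>g\<in>?P. complex_of_real (\<Prod>i\<in>UNIV. c i (g i)) * complex_of_real (gauss (\<chi> i. real (Suc (g i))) x))"
  proof (rule ext)
    fix x :: "real^'n"
    have "(\<Prod>i\<in>UNIV. exp_sum_family (c i) (M i) 0 ((x $ i)\<^sup>2)) =
        (\<Sum>g\<in>?P. \<Prod>i\<in>UNIV. c i (g i) * exp (- real (Suc (g i)) * (x $ i)\<^sup>2))"
      unfolding exp_sum_family_def exp_family_def by (subst prod_sum_PiE) auto
    also have "\<dots> = (\<Sum>g\<in>?P. (\<Prod>i\<in>UNIV. c i (g i)) * gauss (\<chi> i. real (Suc (g i))) x)"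
      by (simp only: prod.distrib gauss_prod vec_lambda_beta)
    finally show "prodsq (\<lambda>i. exp_sum_family (c i) (M i)) x =
      (\<Sum>g\<in>?P. complex_of_real (\<Prod>i\<in>UNIV. c i (g i)) * complex_of_real (gauss (\<chi> i. real (Suc (g i))) x))"
      by (simp only: prodsq_def of_real_sum of_real_mult)
  qed
  also have "\<dots> \<in> gauss_span"
    by (intro gauss_span_sum gauss_span.single finite_PiE) auto
  finally show ?thesis .
qed

text \<open>The same Gaussian sums serve two topologies: the Schwartz topology, in which
  \<open>T\<close> is continuous and sees \<open>q\<close> as its cut-off version, and the weighted
  square norm, for which the pointwise Gaussian bound is stated.\<close>

lemma supported_gauss_span_approx:
  fixes T :: "'n::finite functional"
  assumes T: "T \<in> tempered_even" and supp: "supported_in T (cball 0 \<epsilon>)" and \<epsilon>: "0 < \<epsilon>"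
    and q: "q \<in> gauss_span"
  shows "\<exists>\<Theta> K. (\<forall>k. \<Theta> k \<in> gauss_span) \<and> (\<lambda>k. T (\<Theta> k)) \<longlonglongrightarrow> T q \<and>
    (\<forall>k x. norm (\<Theta> k x - complex_of_real (cube_cutoff (4 * \<epsilon>\<^sup>2) x) * q x) \<le>
      K / real (Suc k) * exp (- (norm x)\<^sup>2))"
  using q
proof (induction rule: gauss_span.induct)
  case (single a d)
  let ?c = "4 * \<epsilon>\<^sup>2"
  let ?u = "\<lambda>i. cut_exp ?c (a $ i)"
  have "\<forall>i. \<exists>c M. exp_conv 1 (\<lambda>k. exp_sum_family (c k) (M k)) (?u i)"
    by (intro allI exp_sum_approx[where R = "2 * ?c"]) (use \<epsilon> in \<open>auto simp: deriv_family_cut_exp cut_exp_eq_0\<close>)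
  then obtain c M where cM: "\<And>i. exp_conv 1 (\<lambda>k. exp_sum_family (c i k) (M i k)) (?u i)"
    by metis
  let ?U = "\<lambda>k i. exp_sum_family (c i k) (M i k)"
  have decay: "exp_decay 1 (?u i)" for i
    using \<epsilon> by (intro exp_decay_cut_exp) simp
  have span: "prodsq (?U k) \<in> gauss_span" for k
    by (rule prodsq_exp_sum_gauss_span)
  have "(\<lambda>k. T (prodsq (?U k))) \<longlonglongrightarrow> T (prodsq ?u)"
    by (rule tempered_even_prodsq_tendsto[OF T, of 1])
      (auto simp: deriv_family_cut_exp deriv_family_exp_sum decay cM intro: gauss_span_S_even span)
  then have "(\<lambda>k. d * T (prodsq (?U k))) \<longlonglongrightarrow> d * T (\<lambda>x. complex_of_real (gauss a x))"
    unfolding supported_gauss_eq[OF T supp \<epsilon> single] by (rule tendsto_mult_left)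
  then have lim: "(\<lambda>k. T (\<lambda>x. d * prodsq (?U k) x)) \<longlonglongrightarrow> T (\<lambda>x. d * complex_of_real (gauss a x))"
    by (simp add: tempered_even_scale[OF T] gauss_span_S_even span gauss_S_even single)
  obtain K where K: "\<And>k x. norm (prodsq (?U k) x - prodsq ?u x) \<le> K / real (Suc k) * exp (- 1 * (norm x)\<^sup>2)"
    using prodsq_diff_bound[of 1 ?u ?U] decay cM by blast
  have "norm (d * prodsq (?U k) x - complex_of_real (cube_cutoff ?c x) * (d * complex_of_real (gauss a x))) \<le>
      (norm d * K) / real (Suc k) * exp (- (norm x)\<^sup>2)" for k x
  proof -
    have "d * prodsq (?U k) x - complex_of_real (cube_cutoff ?c x) * (d * complex_of_real (gauss a x)) =
        d * (prodsq (?U k) x - prodsq ?u x)"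
      by (simp add: prodsq_cut_exp algebra_simps)
    then show ?thesis
      using mult_left_mono[OF K, of "norm d" k x] by (simp add: norm_mult mult.assoc)
  qed
  then show ?case
    using lim span by (intro exI[of _ "\<lambda>k x. d * prodsq (?U k) x"] exI[of _ "norm d * K"])
      (auto intro: gauss_span_scale)
next
  case (add f g)
  let ?\<chi> = "\<lambda>x. complex_of_real (cube_cutoff (4 * \<epsilon>\<^sup>2) x)"
  obtain F K where F: "\<And>k. F k \<in> gauss_span" "(\<lambda>k. T (F k)) \<longlonglongrightarrow> T f"
    "\<And>k x. norm (F k x - ?\<chi> x * f x) \<le> K / real (Suc k) * exp (- (norm x)\<^sup>2)"
    using add.IH(1) by blast
  obtain G L where G: "\<And>k. G k \<in> gauss_span" "(\<lambda>k. T (G k)) \<longlonglongrightarrow> T g"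
    "\<And>k x. norm (G k x - ?\<chi> x * g x) \<le> L / real (Suc k) * exp (- (norm x)\<^sup>2)"
    using add.IH(2) by blast
  have "(\<lambda>k. T (\<lambda>x. F k x + G k x)) \<longlonglongrightarrow> T (\<lambda>x. f x + g x)"
    using tendsto_add[OF F(2) G(2)]
    by (simp add: tempered_even_add[OF T] gauss_span_S_even F(1) G(1) add)
  moreover have "norm ((F k x + G k x) - ?\<chi> x * (f x + g x)) \<le> (K + L) / real (Suc k) * exp (- (norm x)\<^sup>2)" for k x
  proof -
    have eq: "(F k x + G k x) - ?\<chi> x * (f x + g x) = (F k x - ?\<chi> x * f x) + (G k x - ?\<chi> x * g x)"
      by (simp add: algebra_simps)
    have "norm ((F k x + G k x) - ?\<chi> x * (f x + g x)) \<le>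
        K / real (Suc k) * exp (- (norm x)\<^sup>2) + L / real (Suc k) * exp (- (norm x)\<^sup>2)"
      unfolding eq by (rule norm_triangle_le[OF add_mono[OF F(3)[of k x] G(3)[of k x]]])
    then show ?thesis by (simp add: add_divide_distrib distrib_right)
  qed
  ultimately show ?case
    using F(1) G(1) by (intro exI[of _ "\<lambda>k x. F k x + G k x"] exI[of _ "K + L"])
      (auto intro: gauss_span.add)
qed

section \<open>The normalized Bessel function\<close>

definition bessel_coeff :: "real \<Rightarrow> nat \<Rightarrow> real" where
  "bessel_coeff \<gamma> k = (- 1) ^ k / (fact k * Gamma (real k + \<gamma> + 1) * 4 ^ k)"

definition bessel_series :: "real \<Rightarrow> real \<Rightarrow> real" where
  "bessel_series \<gamma> z = (\<Sum>k. bessel_coeff \<gamma> k * z ^ k)"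

lemma bessel_j_eq: "bessel_j \<gamma> t = Gamma (\<gamma> + 1) * bessel_series \<gamma> (t\<^sup>2)"
proof -
  have "(- 1) ^ k / (fact k * Gamma (real k + \<gamma> + 1)) * (t / 2) ^ (2 * k) =
      bessel_coeff \<gamma> k * (t\<^sup>2) ^ k" for k
    by (simp add: bessel_coeff_def power_divide power_mult)
  then show ?thesis
    by (simp add: bessel_j_def bessel_series_def)
qed

context
  fixes \<gamma> :: real
  assumes \<gamma>: "- 1 / 2 < \<gamma>"
begin

text \<open>This recurrence yields both the ratio test for convergence and, coefficient by
  coefficient, Bessel's equation.\<close>

lemma bessel_coeff_Suc:
  "4 * real (Suc k) * (real k + \<gamma> + 1) * bessel_coeff \<gamma> (Suc k) = - bessel_coeff \<gamma> k"
proof -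
  define g where "g = real k + \<gamma> + 1"
  have pos: "0 < g" using \<gamma> by (simp add: g_def)
  have "g \<notin> \<int>\<^sub>\<le>\<^sub>0" using pos by (auto elim!: nonpos_Ints_cases)
  then have "Gamma (real (Suc k) + \<gamma> + 1) = g * Gamma g"
    using Gamma_plus1[of g] by (simp add: g_def add_ac)
  moreover have "4 * p * g * ((- 1) ^ Suc k / ((p * fact k) * (g * G) * 4 ^ Suc k)) =
     - ((- 1) ^ k / (fact k * G * 4 ^ k))" if "0 < p" "0 < G" for p G :: real
    using pos that by (simp add: field_simps)
  from this[of "real (Suc k)" "Gamma g"]
  have "4 * real (Suc k) * g * ((- 1) ^ Suc k / ((real (Suc k) * fact k) * (g * Gamma g) * 4 ^ Suc k)) =
     - ((- 1) ^ k / (fact k * Gamma g * 4 ^ k))"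
    using Gamma_real_pos[OF pos] by simp
  ultimately show ?thesis
    by (simp only: bessel_coeff_def g_def[symmetric] fact_Suc of_nat_mult)
qed

lemma summable_bessel: "summable (\<lambda>k. bessel_coeff \<gamma> k * z ^ k)"
proof -
  obtain N :: nat where N: "\<bar>z\<bar> \<le> real N" using real_arch_simple by blast
  show ?thesis
  proof (rule summable_ratio_test[where c = "1 / 2" and N = N])
    fix k assume k: "N \<le> k"
    define a where "a = \<bar>bessel_coeff \<gamma> (Suc k)\<bar>"
    have eq: "\<bar>bessel_coeff \<gamma> k\<bar> = 4 * real (Suc k) * (real k + \<gamma> + 1) * a"
    proof -
      have "0 \<le> 4 * real (Suc k) * (real k + \<gamma> + 1)"
        using \<gamma> by (intro mult_nonneg_nonneg) auto
      then show ?thesis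
        by (metis a_def abs_minus_cancel abs_mult abs_of_nonneg bessel_coeff_Suc)
    qed
    have "2 * (real (Suc k) * a) \<le> 4 * real (Suc k) * (real k + \<gamma> + 1) * a"
    proof -
      have "2 * real (Suc k) * a * 1 \<le> 2 * real (Suc k) * a * (2 * (real k + \<gamma> + 1))"
        using \<gamma> by (intro mult_left_mono) (auto simp: a_def)
      then show ?thesis by (simp add: algebra_simps)
    qed
    moreover have "\<bar>z\<bar> * a \<le> real (Suc k) * a"
      using N k by (intro mult_right_mono) (auto simp: a_def)
    ultimately have "\<bar>z\<bar> * a \<le> 1 / 2 * \<bar>bessel_coeff \<gamma> k\<bar>"
      unfolding eq by linarith
    then have "\<bar>z\<bar> * a * \<bar>z\<bar> ^ k \<le> 1 / 2 * \<bar>bessel_coeff \<gamma> k\<bar> * \<bar>z\<bar> ^ k"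
      by (rule mult_right_mono) simp
    then show "norm (bessel_coeff \<gamma> (Suc k) * z ^ Suc k) \<le> 1 / 2 * norm (bessel_coeff \<gamma> k * z ^ k)"
      by (simp add: abs_mult power_abs a_def mult_ac)
  qed simp
qed

text \<open>Bessel's equation in the variable \<open>z = t\<^sup>2\<close>, where it has no singular point, shows that
  \<open>\<phi>\<^sup>2 + 4 z \<phi>'\<^sup>2\<close> is nonincreasing.\<close>

lemma bessel_series_derivatives:
  obtains \<phi>1 \<phi>2 where
    "\<And>z. (bessel_series \<gamma> has_real_derivative \<phi>1 z) (at z)"
    "\<And>z. (\<phi>1 has_real_derivative \<phi>2 z) (at z)"
    "\<And>z. 4 * z * \<phi>2 z + 4 * (\<gamma> + 1) * \<phi>1 z + bessel_series \<gamma> z = 0"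
proof
  let ?a = "bessel_coeff \<gamma>"
  note s0 = summable_bessel
  note s1 = termdiff_converges_all[OF s0]
  note s2 = termdiff_converges_all[OF s1]
  show "(bessel_series \<gamma> has_real_derivative (\<Sum>k. diffs ?a k * z ^ k)) (at z)" for z
    unfolding bessel_series_def by (rule termdiffs_strong_converges_everywhere[OF s0])
  show "((\<lambda>z. \<Sum>k. diffs ?a k * z ^ k) has_real_derivative (\<Sum>k. diffs (diffs ?a) k * z ^ k)) (at z)" for z
    by (rule termdiffs_strong_converges_everywhere[OF s1])
  show "4 * z * (\<Sum>k. diffs (diffs ?a) k * z ^ k) + 4 * (\<gamma> + 1) * (\<Sum>k. diffs ?a k * z ^ k) +
      bessel_series \<gamma> z = 0" for z
  proof -
    have "(\<lambda>k. z * (of_nat k * diffs ?a k * z ^ (k - Suc 0))) sums (z * (\<Sum>k. diffs (diffs ?a) k * z ^ k))"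
      by (intro sums_mult diffs_equiv s2)
    moreover have "z * (of_nat k * diffs ?a k * z ^ (k - Suc 0)) = of_nat k * diffs ?a k * z ^ k" for k
      by (cases k) auto
    ultimately have "(\<lambda>k. of_nat k * diffs ?a k * z ^ k) sums (z * (\<Sum>k. diffs (diffs ?a) k * z ^ k))"
      by simp
    then have "(\<lambda>k. 4 * (of_nat k * diffs ?a k * z ^ k) + 4 * (\<gamma> + 1) * (diffs ?a k * z ^ k) + ?a k * z ^ k) sums
        (4 * (z * (\<Sum>k. diffs (diffs ?a) k * z ^ k)) + 4 * (\<gamma> + 1) * (\<Sum>k. diffs ?a k * z ^ k) + bessel_series \<gamma> z)"
      unfolding bessel_series_def by (intro sums_add sums_mult summable_sums s0 s1)
    moreover have "4 * (of_nat k * diffs ?a k * z ^ k) + 4 * (\<gamma> + 1) * (diffs ?a k * z ^ k) + ?a k * z ^ k = 0" for k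
    proof -
      have "4 * (of_nat k * diffs ?a k * z ^ k) + 4 * (\<gamma> + 1) * (diffs ?a k * z ^ k) + ?a k * z ^ k =
          (4 * real (Suc k) * (real k + \<gamma> + 1) * ?a (Suc k) + ?a k) * z ^ k"
        by (simp add: diffs_def algebra_simps)
      also have "\<dots> = 0" unfolding bessel_coeff_Suc by simp
      finally show ?thesis .
    qed
    ultimately show ?thesis
      by (simp add: mult.assoc sums_unique2[OF _ sums_zero])
  qed
qed

lemma bessel_series_continuous: "continuous_on UNIV (bessel_series \<gamma>)"
  by (rule bessel_series_derivatives) (blast intro: DERIV_continuous_on has_field_derivative_at_within)

lemma bessel_series_le:
  assumes "0 \<le> z"
  shows "\<bar>Gamma (\<gamma> + 1) * bessel_series \<gamma> z\<bar> \<le> 1"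
proof -
  obtain \<phi>1 \<phi>2 where d1: "\<And>z. (bessel_series \<gamma> has_real_derivative \<phi>1 z) (at z)"
    and d2: "\<And>z. (\<phi>1 has_real_derivative \<phi>2 z) (at z)"
    and ode: "\<And>z. 4 * z * \<phi>2 z + 4 * (\<gamma> + 1) * \<phi>1 z + bessel_series \<gamma> z = 0"
    by (rule bessel_series_derivatives) blast
  define E where "E z = (bessel_series \<gamma> z)\<^sup>2 + 4 * z * (\<phi>1 z)\<^sup>2" for z
  have "E z \<le> E 0"
  proof (rule DERIV_nonpos_imp_nonincreasing[OF assms])
    fix x
    have "(E has_real_derivative (2 * bessel_series \<gamma> x * \<phi>1 x + (4 * (\<phi>1 x)\<^sup>2 + 4 * x * (2 * \<phi>1 x * \<phi>2 x)))) (at x)"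
      unfolding E_def by (auto intro!: derivative_eq_intros d1 d2)
    \<comment> \<open>Bessel's equation annihilates the first summand; what remains is nonpositive
      because \<open>\<gamma> > - 1 / 2\<close>.\<close>
    moreover have "2 * bessel_series \<gamma> x * \<phi>1 x + (4 * (\<phi>1 x)\<^sup>2 + 4 * x * (2 * \<phi>1 x * \<phi>2 x)) =
        2 * \<phi>1 x * (4 * x * \<phi>2 x + 4 * (\<gamma> + 1) * \<phi>1 x + bessel_series \<gamma> x) - 4 * (2 * \<gamma> + 1) * (\<phi>1 x)\<^sup>2"
      by (simp add: algebra_simps power2_eq_square)
    moreover have "0 \<le> 4 * (2 * \<gamma> + 1) * (\<phi>1 x)\<^sup>2"
      using \<gamma> by (intro mult_nonneg_nonneg) auto
    ultimately show "\<exists>y. (E has_real_derivative y) (at x) \<and> y \<le> 0"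
      unfolding ode by (intro exI conjI) auto
  qed
  moreover have "bessel_series \<gamma> 0 = 1 / Gamma (\<gamma> + 1)"
    using powser_zero[of "bessel_coeff \<gamma>"] by (simp add: bessel_series_def) (simp add: bessel_coeff_def)
  ultimately have "(bessel_series \<gamma> z)\<^sup>2 \<le> (1 / Gamma (\<gamma> + 1))\<^sup>2"
    using assms by (auto simp: E_def intro: order_trans[rotated])
  moreover have g: "0 < Gamma (\<gamma> + 1)"
    using \<gamma> by (intro Gamma_real_pos) auto
  ultimately have "\<bar>bessel_series \<gamma> z\<bar> \<le> 1 / Gamma (\<gamma> + 1)"
    by (metis abs_le_square_iff abs_of_pos divide_pos_pos zero_less_one)
  then show ?thesis
    using g by (simp add: abs_mult field_simps)
qed

lemma abs_bessel_j_le_1: "\<bar>bessel_j \<gamma> t\<bar> \<le> 1"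
  unfolding bessel_j_eq by (rule bessel_series_le) simp

lemma bessel_j_continuous: "continuous_on UNIV (bessel_j \<gamma>)"
  unfolding bessel_j_eq
  by (intro continuous_intros continuous_on_compose2[OF bessel_series_continuous]) auto

end

section \<open>The Fourier-Bessel transform of a Gaussian\<close>

text \<open>The substitution \<open>t = a * x\<^sup>2\<close> turns Euler's integral for
  \<open>Gamma z\<close> into this moment.\<close>

lemma gauss_moment:
  fixes a z :: real
  assumes a: "0 < a" and z: "0 < z"
  shows "has_bochner_integral lborel
    (\<lambda>x. indicator {0<..} x * (x powr (2 * z - 1) * exp (- a * x\<^sup>2))) (Gamma z / (2 * a powr z))"
proof -
  let ?f = "\<lambda>t::real. t powr (z - 1) / exp t"
  let ?g = "\<lambda>x. a * x\<^sup>2"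
  let ?h = "\<lambda>x::real. x powr (2 * z - 1) * exp (- a * x\<^sup>2)"
  have im: "?g ` {0<..} = {0<..}"
  proof (rule set_eqI, rule iffI)
    fix y :: real assume "y \<in> {0<..}"
    then have "y = ?g (sqrt (y / a))" "sqrt (y / a) \<in> {0<..}" using a by auto
    then show "y \<in> ?g ` {0<..}" by blast
  qed (use a in auto)
  have f0: "(?f has_integral Gamma z) {0<..}"
    using Gamma_integral_real[OF z]
    by (rule has_integral_spike_set_eq[THEN iffD1, rotated 2]) (auto intro: negligible_subset[of "{0}"])
  then have "?f absolutely_integrable_on {0<..}"
    by (intro nonnegative_absolutely_integrable_1) (auto simp: has_integral_integrable)
  then have "(\<lambda>x. \<bar>2 * a * x\<bar> * ?f (?g x)) absolutely_integrable_on {0<..} \<and>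
      integral {0<..} (\<lambda>x. \<bar>2 * a * x\<bar> * ?f (?g x)) = Gamma z"
    using f0 a
    by (subst has_absolute_integral_change_of_variables_1')
      (auto simp: im integral_unique inj_on_def power2_eq_iff_nonneg intro!: derivative_eq_intros)
  moreover have eq: "\<bar>2 * a * x\<bar> * ?f (?g x) = (2 * a powr z) * ?h x" if "0 < x" for x
  proof -
    have "(a * x\<^sup>2) powr (z - 1) = a powr (z - 1) * x powr (2 * (z - 1))"
      using a that by (simp add: powr_mult powr_powr flip: powr_numeral)
    moreover have "a powr z = a powr (z - 1) * a" "x powr (2 * z - 1) = x powr (2 * (z - 1)) * x"
      using a that by (simp_all add: powr_mult_base[symmetric] powr_diff power2_eq_square flip: powr_add)
    ultimately show ?thesis
      using a that by (simp add: exp_minus field_simps)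
  qed
  moreover have "(\<lambda>x. \<bar>2 * a * x\<bar> * ?f (?g x)) absolutely_integrable_on {0<..} \<longleftrightarrow>
      (\<lambda>x. (2 * a powr z) * ?h x) absolutely_integrable_on {0<..}"
    by (rule set_integrable_cong) (simp_all only: eq greaterThan_iff)
  moreover have "integral {0<..} (\<lambda>x. \<bar>2 * a * x\<bar> * ?f (?g x)) = integral {0<..} (\<lambda>x. (2 * a powr z) * ?h x)"
    by (rule Henstock_Kurzweil_Integration.integral_cong) (simp only: eq greaterThan_iff)
  ultimately have A: "(\<lambda>x. (2 * a powr z) * ?h x) absolutely_integrable_on {0<..}"
    and I: "integral {0<..} (\<lambda>x. (2 * a powr z) * ?h x) = Gamma z"
    by simp_all
  have ap: "2 * a powr z \<noteq> 0" using a by simp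
  have Ah: "?h absolutely_integrable_on {0<..}"
    using set_integrable_mult_right[of "1 / (2 * a powr z)", OF A] ap by simp
  have Ih: "integral {0<..} ?h = Gamma z / (2 * a powr z)"
    using I ap by (simp add: field_simps)
  have m: "(\<lambda>x. indicator {0<..} x * ?h x) \<in> borel_measurable borel"
    by measurable
  \<comment> \<open>The change of variables lives on the completed Lebesgue measure; Borel
    measurability brings the result back to \<open>lborel\<close>.\<close>
  have "integrable lborel (\<lambda>x. indicator {0<..} x * ?h x)"
    using Ah m by (simp add: set_integrable_def integrable_completion)
  moreover have "(\<integral>x. indicator {0<..} x * ?h x \<partial>lborel) = integral {0<..} ?h"
    using set_lebesgue_integral_eq_integral(2)[OF Ah] m
    by (simp add: set_lebesgue_integral_def integral_completion)
  ultimately show ?thesis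
    using Ih by (simp add: has_bochner_integral_iff)
qed

text \<open>Termwise integration of the Bessel series. The moment of order \<open>k\<close> contains
  the same Gamma value that stands in the denominator of the coefficient; after cancellation the
  exponential series at \<open>- (\<xi>\<^sup>2 / (4 * a))\<close> remains.\<close>

lemma gauss_bessel_integral:
  fixes a \<gamma> \<xi> :: real
  assumes a: "0 < a" and \<gamma>: "- 1 / 2 < \<gamma>"
  shows "has_bochner_integral lborel
    (\<lambda>x. indicator {0<..} x * (x powr (2 * \<gamma> + 1) * (exp (- a * x\<^sup>2) * bessel_j \<gamma> (\<xi> * x))))
    (Gamma (\<gamma> + 1) / (2 * a powr (\<gamma> + 1)) * exp (- (1 / (4 * a)) * \<xi>\<^sup>2))"
proof -
  let ?G = "Gamma (\<gamma> + 1)" and ?A = "2 * a powr (\<gamma> + 1)"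
  define c where "c k = ?G * bessel_coeff \<gamma> k * (\<xi>\<^sup>2) ^ k" for k
  define h where "h k x = indicator {0<..} x * (x powr (2 * (real k + \<gamma> + 1) - 1) * exp (- a * x\<^sup>2))" for k and x :: real
  have G: "0 < ?G" using \<gamma> by (intro Gamma_real_pos) auto
  have h: "has_bochner_integral lborel (h k) (Gamma (real k + \<gamma> + 1) / (2 * a powr (real k + \<gamma> + 1)))" for k
    unfolding h_def by (rule gauss_moment) (use a \<gamma> in auto)
  have h_eq: "h k x = h 0 x * (x\<^sup>2) ^ k" for k x
  proof (cases "0 < x")
    case True
    have "x powr (2 * (real k + \<gamma> + 1) - 1) = x powr (2 * (\<gamma> + 1) - 1) * x powr (real (2 * k))"
      unfolding powr_add[symmetric] by (simp add: algebra_simps)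
    also have "x powr (real (2 * k)) = (x\<^sup>2) ^ k"
      using True by (subst powr_realpow) (auto simp: power_mult)
    finally show ?thesis by (simp add: h_def mult_ac)
  qed (simp add: h_def)
  have h_nonneg: "0 \<le> h k x" for k x by (simp add: h_def indicator_def)
  define y where "y = - (\<xi>\<^sup>2 / (4 * a))"
  have coeff: "c k * (Gamma (real k + \<gamma> + 1) / (2 * a powr (real k + \<gamma> + 1))) = ?G / ?A * (y ^ k /\<^sub>R fact k)" for k
  proof -
    have "0 < Gamma (real k + \<gamma> + 1)" using \<gamma> by (intro Gamma_real_pos) auto
    moreover have "a powr (real k + \<gamma> + 1) = a powr (\<gamma> + 1) * a ^ k"
      using a by (simp add: powr_add powr_realpow mult_ac)
    moreover have "y ^ k = (- 1) ^ k * (\<xi>\<^sup>2) ^ k / (4 ^ k * a ^ k)"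
      unfolding y_def by (metis (no_types, opaque_lifting) power_divide power_minus power_mult_distrib times_divide_eq_right)
    ultimately show ?thesis
      by (simp add: c_def bessel_coeff_def field_simps)
  qed
  \<comment> \<open>The same computation with absolute values gives the exponential series at
    \<open>\<bar>y\<bar>\<close>, whose convergence justifies exchanging sum and integral.\<close>
  have abs_c: "\<bar>c k\<bar> * (Gamma (real k + \<gamma> + 1) / (2 * a powr (real k + \<gamma> + 1))) = ?G / ?A * (\<bar>y\<bar> ^ k /\<^sub>R fact k)" for k
  proof -
    have "0 < Gamma (real k + \<gamma> + 1)" using \<gamma> by (intro Gamma_real_pos) auto
    then have "\<bar>c k\<bar> * (Gamma (real k + \<gamma> + 1) / (2 * a powr (real k + \<gamma> + 1))) =
        \<bar>c k * (Gamma (real k + \<gamma> + 1) / (2 * a powr (real k + \<gamma> + 1)))\<bar>"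
      by (simp add: abs_mult)
    also have "\<dots> = ?G / ?A * (\<bar>y\<bar> ^ k /\<^sub>R fact k)"
      unfolding coeff using G by (simp add: abs_mult power_abs)
    finally show ?thesis .
  qed
  let ?F = "\<lambda>k x. c k * h k x"
  have int: "integrable lborel (?F k)" and int_eq: "integral\<^sup>L lborel (?F k) = ?G / ?A * (y ^ k /\<^sub>R fact k)" for k
    using has_bochner_integral_mult_right[OF h[of k], where c = "c k"] coeff[of k] by (auto simp: has_bochner_integral_iff)
  have norm_int: "(\<integral>x. norm (?F k x) \<partial>lborel) = ?G / ?A * (\<bar>y\<bar> ^ k /\<^sub>R fact k)" for k
  proof -
    have "norm (?F k x) = \<bar>c k\<bar> * h k x" for x using h_nonneg by (simp add: abs_mult)
    then show ?thesis
      using has_bochner_integral_mult_right[OF h[of k], where c = "\<bar>c k\<bar>"] abs_c[of k] by (simp add: has_bochner_integral_iff)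
  qed
  have F_eq: "?F k x = h 0 x * ?G * (bessel_coeff \<gamma> k * ((\<xi> * x)\<^sup>2) ^ k)" for k x
    by (subst h_eq) (simp add: c_def power_mult_distrib mult_ac)
  have summ: "summable (\<lambda>k. norm (?F k x))" for x
  proof -
    \<comment> \<open>Absolute convergence of a power series follows from convergence at a point of
      strictly larger modulus, hence the \<open>+ 1\<close>.\<close>
    have "summable (\<lambda>k. norm (bessel_coeff \<gamma> k * ((\<xi> * x)\<^sup>2) ^ k))"
      by (rule powser_insidea[OF summable_bessel[OF \<gamma>], of _ "(\<xi> * x)\<^sup>2 + 1"])
        (auto simp: abs_if add_nonneg_nonneg)
    from summable_mult[OF this, of "norm (h 0 x * ?G)"] show ?thesis
      unfolding F_eq norm_mult[symmetric] .
  qed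
  have sum_eq: "(\<Sum>k. ?F k x) = indicator {0<..} x * (x powr (2 * \<gamma> + 1) * (exp (- a * x\<^sup>2) * bessel_j \<gamma> (\<xi> * x)))" for x
    unfolding F_eq suminf_mult[OF summable_bessel[OF \<gamma>]] bessel_j_eq bessel_series_def[symmetric]
    by (simp add: h_def algebra_simps)
  have summ_int: "summable (\<lambda>k. \<integral>x. norm (?F k x) \<partial>lborel)"
    unfolding norm_int by (intro summable_mult summable_exp_generic)
  have "(\<lambda>k. integral\<^sup>L lborel (?F k)) sums (\<integral>x. (\<Sum>k. ?F k x) \<partial>lborel)"
    by (rule sums_integral[OF int _ summ_int]) (use summ in auto)
  moreover have "(\<lambda>k. integral\<^sup>L lborel (?F k)) sums (?G / ?A * exp y)"
    unfolding int_eq by (intro sums_mult exp_converges)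
  ultimately have "(\<integral>x. (\<Sum>k. ?F k x) \<partial>lborel) = ?G / ?A * exp y"
    by (rule sums_unique2)
  moreover have "integrable lborel (\<lambda>x. \<Sum>k. ?F k x)"
    by (rule integrable_suminf[OF int _ summ_int]) (use summ in auto)
  ultimately show ?thesis
    unfolding sum_eq has_bochner_integral_iff by (simp add: y_def)
qed

text \<open>Fubini for products. \<open>lborel\<close> is the image of the product measure over
  \<open>Basis\<close>, so coordinates indexed by \<open>'n\<close> are reindexed by the axis
  vectors.\<close>

lemma lborel_vec_prod:
  fixes g :: "'n::finite \<Rightarrow> real \<Rightarrow> real"
  assumes g: "\<And>i. has_bochner_integral lborel (g i) (I i)"
  shows "has_bochner_integral (lborel :: (real^'n) measure) (\<lambda>x. \<Prod>i\<in>UNIV. g i (x $ i)) (\<Prod>i\<in>UNIV. I i)"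
proof -
  define e :: "'n \<Rightarrow> real^'n" where "e i = axis i 1" for i
  have inj: "inj e" by (auto simp: inj_def e_def axis_eq_axis)
  have B: "(Basis :: (real^'n) set) = range e"
    by (auto simp: Basis_vec_def e_def)
  let ?M = "Pi\<^sub>M (Basis :: (real^'n) set) (\<lambda>b. lborel :: real measure)"
  let ?s = "\<lambda>f. \<Sum>b\<in>(Basis :: (real^'n) set). f b *\<^sub>R b"
  interpret product_sigma_finite "\<lambda>b :: real^'n. lborel :: real measure" ..
  have gi[measurable]: "g i \<in> borel_measurable borel" for i
    using g[of i] by (auto simp: has_bochner_integral_iff dest: borel_measurable_integrable)
  have comp: "?s f $ i = f (e i)" for f i
  proof -
    have "?s f $ i = (\<Sum>j\<in>UNIV. f (e j) * (e j $ i))"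
      unfolding B by (simp add: sum.reindex[OF inj])
    also have "\<dots> = (\<Sum>j\<in>UNIV. if j = i then f (e j) else 0)"
      by (intro sum.cong refl) (auto simp: e_def axis_def)
    finally show ?thesis by simp
  qed
  let ?h = "\<lambda>b. g (inv e b)"
  have prod_eq: "(\<Prod>i\<in>UNIV. g i (?s f $ i)) = (\<Prod>b\<in>Basis. ?h b (f b))" for f
    unfolding comp by (simp add: B prod.reindex[OF inj] inv_f_f[OF inj])
  have hi: "integrable lborel (?h b)" for b
    using g by (auto simp: has_bochner_integral_iff)
  have m: "?s \<in> measurable ?M borel" by measurable
  have m2: "(\<lambda>x::real^'n. \<Prod>i\<in>UNIV. g i (x $ i)) \<in> borel_measurable borel"
    by measurable
  have "integrable (lborel :: (real^'n) measure) (\<lambda>x. \<Prod>i\<in>UNIV. g i (x $ i))"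
    unfolding lborel_eq[where 'a = "real^'n"] integrable_distr_eq[OF m m2] prod_eq
    by (rule product_integrable_prod) (auto simp: hi)
  moreover have "(\<integral>x. (\<Prod>i\<in>UNIV. g i (x $ i)) \<partial>(lborel :: (real^'n) measure)) = (\<Prod>i\<in>UNIV. I i)"
  proof -
    have "(\<integral>x. (\<Prod>i\<in>UNIV. g i (x $ i)) \<partial>(lborel :: (real^'n) measure)) = (\<Prod>b\<in>Basis. integral\<^sup>L lborel (?h b))"
      unfolding lborel_eq[where 'a = "real^'n"] integral_distr[OF m m2] prod_eq
      by (rule product_integral_prod) (auto simp: hi)
    also have "\<dots> = (\<Prod>i\<in>UNIV. I i)"
      unfolding B by (simp add: prod.reindex[OF inj] inv_f_f[OF inj] has_bochner_integral_integral_eq[OF g])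
    finally show ?thesis .
  qed
  ultimately show ?thesis by (simp add: has_bochner_integral_iff)
qed

lemma pos_orthant_borel[measurable]: "pos_orthant \<in> sets borel"
  unfolding pos_orthant_def by measurable

lemma sets_mu: "sets (mu \<alpha>) = sets (restrict_space borel pos_orthant)"
  unfolding mu_def by (simp add: sets_restrict_space)

lemma space_mu: "space (mu \<alpha>) = pos_orthant"
  by (simp add: mu_def space_restrict_space)

lemma measurable_mu:
  assumes "f \<in> borel_measurable borel"
  shows "f \<in> borel_measurable (mu \<alpha>)"
  using measurable_restrict_space1[OF assms, of pos_orthant] sets_mu
  by (metis measurable_cong_sets)

text \<open>Both the weight and the indicator of the orthant factor over the coordinates, so the
  integral reduces to one-variable integrals over the positive half-line.\<close>

lemma mu_prod:
  fixes f :: "'n::finite \<Rightarrow> real \<Rightarrow> real" and \<alpha> :: "real^'n"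
  assumes f[measurable]: "\<And>i. f i \<in> borel_measurable borel"
    and I: "\<And>i. has_bochner_integral lborel (\<lambda>t. indicator {0<..} t * (t powr (2 * \<alpha> $ i + 1) * f i t)) (I i)"
  shows "has_bochner_integral (mu \<alpha>) (\<lambda>x. \<Prod>i\<in>UNIV. f i (x $ i)) (\<Prod>i\<in>UNIV. I i)"
  unfolding mu_def
proof (rule has_bochner_integral_density)
  let ?w = "\<lambda>x::real^'n. \<Prod>i\<in>UNIV. (x $ i) powr (2 * \<alpha> $ i + 1)"
  let ?F = "\<lambda>x::real^'n. \<Prod>i\<in>UNIV. f i (x $ i)"
  show "?F \<in> borel_measurable (restrict_space lborel pos_orthant)"
    by (rule measurable_restrict_space1) measurable
  show "?w \<in> borel_measurable (restrict_space lborel pos_orthant)"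
    by (rule measurable_restrict_space1) measurable
  show "AE x in restrict_space lborel pos_orthant. 0 \<le> ?w x"
    by (rule AE_I2) (simp add: prod_nonneg)
  have "indicator pos_orthant x *\<^sub>R (?w x *\<^sub>R ?F x) =
      (\<Prod>i\<in>UNIV. indicator {0<..} (x $ i) * ((x $ i) powr (2 * \<alpha> $ i + 1) * f i (x $ i)))" for x :: "real^'n"
  proof (cases "x \<in> pos_orthant")
    case True
    then show ?thesis by (simp add: pos_orthant_def prod.distrib)
  next
    case False
    then obtain i where "\<not> 0 < x $ i" by (auto simp: pos_orthant_def)
    then have "(\<Prod>i\<in>UNIV. indicator {0<..} (x $ i) * ((x $ i) powr (2 * \<alpha> $ i + 1) * f i (x $ i))) = 0"
      by (intro prod_zero bexI[of _ i]) auto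
    then show ?thesis using False by simp
  qed
  then have "has_bochner_integral lborel (\<lambda>x. indicator pos_orthant x *\<^sub>R (?w x *\<^sub>R ?F x)) (\<Prod>i\<in>UNIV. I i)"
    using lborel_vec_prod[OF I] by simp
  then show "has_bochner_integral (restrict_space lborel pos_orthant) (\<lambda>x. ?w x *\<^sub>R ?F x) (\<Prod>i\<in>UNIV. I i)"
    by (simp add: has_bochner_integral_iff integral_restrict_space integrable_restrict_space)
qed

section \<open>Square-integrable functions\<close>

lemma integrable_mult_square:
  fixes f g :: "'a \<Rightarrow> complex"
  assumes [measurable]: "f \<in> borel_measurable M" "g \<in> borel_measurable M"
    and "integrable M (\<lambda>x. (norm (f x))\<^sup>2)" "integrable M (\<lambda>x. (norm (g x))\<^sup>2)"
  shows "integrable M (\<lambda>x. f x * g x)"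
proof (rule Bochner_Integration.integrable_bound)
  show "integrable M (\<lambda>x. (norm (f x))\<^sup>2 + (norm (g x))\<^sup>2)"
    by (intro Bochner_Integration.integrable_add assms)
  show "AE x in M. norm (f x * g x) \<le> norm ((norm (f x))\<^sup>2 + (norm (g x))\<^sup>2)"
  proof (rule AE_I2)
    fix x
    have "norm (f x) * norm (g x) \<le> (norm (f x))\<^sup>2 + (norm (g x))\<^sup>2"
      using sum_squares_bound[of "norm (f x)" "norm (g x)", unfolded mult.assoc]
        mult_nonneg_nonneg[OF norm_ge_zero norm_ge_zero, of "f x" "g x"]
      by linarith
    then show "norm (f x * g x) \<le> norm ((norm (f x))\<^sup>2 + (norm (g x))\<^sup>2)"
      by (simp add: norm_mult)
  qed
qed measurable

lemma integrable_square_add: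
  fixes f g :: "'a \<Rightarrow> complex"
  assumes [measurable]: "f \<in> borel_measurable M" "g \<in> borel_measurable M"
    and i: "integrable M (\<lambda>x. (norm (f x))\<^sup>2)" "integrable M (\<lambda>x. (norm (g x))\<^sup>2)"
  shows "integrable M (\<lambda>x. (norm (f x + g x))\<^sup>2)"
    and "(\<integral>x. (norm (f x + g x))\<^sup>2 \<partial>M) \<le> 2 * (\<integral>x. (norm (f x))\<^sup>2 \<partial>M) + 2 * (\<integral>x. (norm (g x))\<^sup>2 \<partial>M)"
proof -
  have le: "(norm (f x + g x))\<^sup>2 \<le> 2 * (norm (f x))\<^sup>2 + 2 * (norm (g x))\<^sup>2" for x
  proof -
    have "(norm (f x + g x))\<^sup>2 \<le> (norm (f x) + norm (g x))\<^sup>2"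
      by (intro power_mono norm_triangle_ineq) auto
    also have "\<dots> \<le> 2 * (norm (f x))\<^sup>2 + 2 * (norm (g x))\<^sup>2"
      using sum_squares_bound[of "norm (f x)" "norm (g x)"] by (simp add: power2_sum)
    finally show ?thesis .
  qed
  have int: "integrable M (\<lambda>x. 2 * (norm (f x))\<^sup>2 + 2 * (norm (g x))\<^sup>2)"
    using i by simp
  show *: "integrable M (\<lambda>x. (norm (f x + g x))\<^sup>2)"
    by (rule Bochner_Integration.integrable_bound[OF int]) (use le in \<open>auto simp: order_trans[OF le abs_ge_self]\<close>)
  have "(\<integral>x. (norm (f x + g x))\<^sup>2 \<partial>M) \<le> (\<integral>x. 2 * (norm (f x))\<^sup>2 + 2 * (norm (g x))\<^sup>2 \<partial>M)"
    by (intro integral_mono * int le)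
  also have "\<dots> = 2 * (\<integral>x. (norm (f x))\<^sup>2 \<partial>M) + 2 * (\<integral>x. (norm (g x))\<^sup>2 \<partial>M)"
    using i by simp
  finally show "(\<integral>x. (norm (f x + g x))\<^sup>2 \<partial>M) \<le> \<dots>" .
qed

lemma Cauchy_Schwarz_norm_integral:
  fixes f g :: "'a \<Rightarrow> complex"
  assumes [measurable]: "f \<in> borel_measurable M" "g \<in> borel_measurable M"
    and i: "integrable M (\<lambda>x. (norm (f x))\<^sup>2)" "integrable M (\<lambda>x. (norm (g x))\<^sup>2)"
  shows "(\<integral>x. norm (f x * g x) \<partial>M)
    \<le> sqrt (\<integral>x. (norm (f x))\<^sup>2 \<partial>M) * sqrt (\<integral>x. (norm (g x))\<^sup>2 \<partial>M)"
proof -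
  let ?I = "\<integral>x. norm (f x * g x) \<partial>M" and ?F = "\<integral>x. (norm (f x))\<^sup>2 \<partial>M" and ?G = "\<integral>x. (norm (g x))\<^sup>2 \<partial>M"
  have int: "integrable M (\<lambda>x. norm (f x * g x))"
    using integrable_mult_square[OF assms] by (rule integrable_norm)
  have nn: "0 \<le> ?I" "0 \<le> ?F" "0 \<le> ?G" by auto
  have "(\<integral>\<^sup>+x. ennreal (norm (f x)) * ennreal (norm (g x)) \<partial>M)\<^sup>2 \<le>
      (\<integral>\<^sup>+x. (ennreal (norm (f x)))\<^sup>2 \<partial>M) * (\<integral>\<^sup>+x. (ennreal (norm (g x)))\<^sup>2 \<partial>M)"
    by (rule Cauchy_Schwarz_nn_integral) measurable
  then have "(ennreal ?I)\<^sup>2 \<le> ennreal ?F * ennreal ?G"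
    using nn_integral_eq_integral[OF int] nn_integral_eq_integral[OF i(1)] nn_integral_eq_integral[OF i(2)]
    by (simp add: norm_mult ennreal_mult ennreal_power)
  then have "ennreal (?I\<^sup>2) \<le> ennreal (?F * ?G)"
    by (simp only: ennreal_power[OF nn(1)] ennreal_mult[OF nn(2,3)])
  then have "?I\<^sup>2 \<le> ?F * ?G"
    using nn by (subst (asm) ennreal_le_iff) auto
  then have "sqrt (?I\<^sup>2) \<le> sqrt (?F * ?G)"
    by (rule real_sqrt_le_mono)
  then show ?thesis
    using nn by (simp only: real_sqrt_mult real_sqrt_abs abs_of_nonneg)
qed

lemma Cauchy_Schwarz_integral:
  fixes f g :: "'a \<Rightarrow> complex"
  assumes "f \<in> borel_measurable M" "g \<in> borel_measurable M"
    and "integrable M (\<lambda>x. (norm (f x))\<^sup>2)" "integrable M (\<lambda>x. (norm (g x))\<^sup>2)"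
  shows "norm (\<integral>x. f x * g x \<partial>M)
    \<le> sqrt (\<integral>x. (norm (f x))\<^sup>2 \<partial>M) * sqrt (\<integral>x. (norm (g x))\<^sup>2 \<partial>M)"
  using order_trans[OF integral_norm_bound Cauchy_Schwarz_norm_integral[OF assms]] .

section \<open>The Fourier-Bessel transform on the span of the Gaussians\<close>

lemma gauss_span_mult:
  assumes "f \<in> gauss_span" "g \<in> gauss_span"
  shows "(\<lambda>x. f x * g x) \<in> gauss_span"
  using assms(2)
proof (induction rule: gauss_span.induct)
  case (single a c)
  then have "(\<lambda>x. c * (f x * complex_of_real (gauss a x))) \<in> gauss_span"
    using assms(1) by (intro gauss_span_scale gauss_span_mult_gauss) (auto intro: less_imp_le)
  then show ?case by (simp add: mult_ac)
next
  case (add g h)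
  then show ?case
    using gauss_span.add[of "\<lambda>x. f x * g x" "\<lambda>x. f x * h x"] by (simp add: distrib_left)
qed

lemma gauss_span_measurable: "f \<in> gauss_span \<Longrightarrow> f \<in> borel_measurable (mu \<alpha>)"
  by (intro measurable_mu borel_measurable_continuous_onI gauss_span_continuous)

lemma gauss_measurable: "(\<lambda>x. gauss a x) \<in> borel_measurable (mu \<alpha>)"
  unfolding gauss_def by (intro measurable_mu borel_measurable_continuous_onI continuous_intros)

context
  fixes \<alpha> :: "real^'n::finite"
  assumes \<alpha>: "\<And>i. - 1 / 2 < \<alpha> $ i"
begin

text \<open>The integral of \<open>gauss a\<close> against \<open>mu \<alpha>\<close>, as
  \<open>integral_gauss\<close> confirms.\<close>

definition gauss_mass :: "real^'n \<Rightarrow> real" where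
  "gauss_mass a = (\<Prod>i\<in>UNIV. Gamma (\<alpha> $ i + 1) / (2 * (a $ i) powr (\<alpha> $ i + 1)))"

lemma gauss_bessel_mu:
  assumes "\<And>i. 0 < a $ i"
  shows "has_bochner_integral (mu \<alpha>) (\<lambda>x. gauss a x * (\<Prod>i\<in>UNIV. bessel_j (\<alpha> $ i) (\<xi> $ i * x $ i)))
    (gauss_mass a * gauss (\<chi> i. 1 / (4 * a $ i)) \<xi>)"
proof -
  have "has_bochner_integral (mu \<alpha>) (\<lambda>x. \<Prod>i\<in>UNIV. exp (- (a $ i) * (x $ i)\<^sup>2) * bessel_j (\<alpha> $ i) (\<xi> $ i * x $ i))
    (\<Prod>i\<in>UNIV. Gamma (\<alpha> $ i + 1) / (2 * (a $ i) powr (\<alpha> $ i + 1)) * exp (- (1 / (4 * a $ i)) * (\<xi> $ i)\<^sup>2))"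
  proof (rule mu_prod[of "\<lambda>i t. exp (- (a $ i) * t\<^sup>2) * bessel_j (\<alpha> $ i) (\<xi> $ i * t)"])
    show "(\<lambda>t. exp (- (a $ i) * t\<^sup>2) * bessel_j (\<alpha> $ i) (\<xi> $ i * t)) \<in> borel_measurable borel" for i
      by (intro borel_measurable_continuous_onI continuous_intros
          continuous_on_compose2[OF bessel_j_continuous[OF \<alpha>]]) auto
  qed (intro gauss_bessel_integral assms \<alpha>)
  then show ?thesis
    by (simp only: gauss_mass_def gauss_prod prod.distrib vec_lambda_beta)
qed

lemma bessel_j_0: "bessel_j (\<alpha> $ i) 0 = 1"
proof -
  have "0 < Gamma (\<alpha> $ i + 1)"
    using \<alpha>[of i] by (intro Gamma_real_pos) simp
  then show ?thesis
    unfolding bessel_j_eq bessel_series_def using powser_zero[of "bessel_coeff (\<alpha> $ i)"]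
    by simp (simp add: bessel_coeff_def)
qed

text \<open>The transform formula at frequency 0, where the kernel is 1.\<close>

lemma gauss_mu:
  assumes "\<And>i. 0 < a $ i"
  shows "has_bochner_integral (mu \<alpha>) (gauss a) (gauss_mass a)"
proof -
  have "gauss b 0 = 1" for b :: "real^'n" by (simp add: gauss_def)
  then show ?thesis
    using gauss_bessel_mu[OF assms, of 0] by (simp add: bessel_j_0)
qed

lemma integrable_gauss: "(\<And>i. 0 < a $ i) \<Longrightarrow> integrable (mu \<alpha>) (gauss a)"
  using gauss_mu by (auto simp: has_bochner_integral_iff)

lemma integral_gauss: "(\<And>i. 0 < a $ i) \<Longrightarrow> integral\<^sup>L (mu \<alpha>) (gauss a) = gauss_mass a"
  using gauss_mu by (auto simp: has_bochner_integral_iff)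

lemma integrable_gauss_bound:
  fixes f :: "real^'n \<Rightarrow> 'b::{banach, second_countable_topology}"
  assumes "0 < b" "f \<in> borel_measurable (mu \<alpha>)" "\<And>x. norm (f x) \<le> K * exp (- b * (norm x)\<^sup>2)"
  shows "integrable (mu \<alpha>) f"
proof (rule Bochner_Integration.integrable_bound[OF _ assms(2)])
  have "integrable (mu \<alpha>) (\<lambda>x. K * gauss (\<chi> i. b) x)"
    by (intro integrable_mult_right integrable_gauss) (simp add: assms)
  then show "integrable (mu \<alpha>) (\<lambda>x. K * exp (- b * (norm x)\<^sup>2))"
    by (simp add: gauss_const)
  show "AE x in mu \<alpha>. norm (f x) \<le> norm (K * exp (- b * (norm x)\<^sup>2))"
    by (rule AE_I2, rule order_trans[OF assms(3)]) simp
qed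

lemma gauss_span_integrable:
  assumes "f \<in> gauss_span"
  shows "integrable (mu \<alpha>) f"
proof -
  obtain K b where "0 < b" "\<And>x. norm (f x) \<le> K * exp (- b * (norm x)\<^sup>2)"
    using gauss_span_norm_le[OF assms] by blast
  then show ?thesis
    using gauss_span_measurable[OF assms] by (intro integrable_gauss_bound)
qed

lemma gauss_span_square_integrable:
  assumes "f \<in> gauss_span"
  shows "integrable (mu \<alpha>) (\<lambda>x. (norm (f x))\<^sup>2)"
proof -
  have "integrable (mu \<alpha>) (\<lambda>x. norm (f x * f x))"
    using gauss_span_integrable[OF gauss_span_mult[OF assms assms]] by (rule integrable_norm)
  then show ?thesis by (simp add: norm_mult power2_eq_square)
qed

abbreviation "bessel_kernel \<xi> x \<equiv> \<Prod>i\<in>UNIV. bessel_j (\<alpha> $ i) (\<xi> $ i * x $ i)"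

lemma bessel_kernel_measurable: "(\<lambda>x. complex_of_real (bessel_kernel \<xi> x)) \<in> borel_measurable (mu \<alpha>)"
  by (intro measurable_mu borel_measurable_continuous_onI continuous_intros
      continuous_on_compose2[OF bessel_j_continuous[OF \<alpha>]]) auto

lemma norm_bessel_kernel_le: "norm (complex_of_real (bessel_kernel \<xi> x)) \<le> 1"
  unfolding norm_of_real abs_prod by (intro prod_le_1 conjI abs_bessel_j_le_1 \<alpha>) auto

lemma norm_mult_bessel_kernel_le: "norm (c * complex_of_real (bessel_kernel \<xi> x)) \<le> norm c"
  unfolding norm_mult using mult_left_le[OF norm_bessel_kernel_le norm_ge_zero] .

lemma integrable_bessel_kernel:
  assumes "integrable (mu \<alpha>) f"
  shows "integrable (mu \<alpha>) (\<lambda>x. f x * complex_of_real (bessel_kernel \<xi> x))"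
proof (rule Bochner_Integration.integrable_bound[OF assms])
  show "(\<lambda>x. f x * complex_of_real (bessel_kernel \<xi> x)) \<in> borel_measurable (mu \<alpha>)"
    using assms bessel_kernel_measurable by (intro borel_measurable_times) auto
qed (use norm_mult_bessel_kernel_le in auto)

text \<open>Here the bound 1 for the Bessel functions enters: the kernel has modulus at most
  1.\<close>

lemma norm_fourier_bessel_le:
  assumes "integrable (mu \<alpha>) f"
  shows "norm (fourier_bessel \<alpha> f \<xi>) \<le> (\<integral>x. norm (f x) \<partial>mu \<alpha>)"
  unfolding fourier_bessel_def
  by (rule Bochner_Integration.integral_norm_bound_integral)
    (use assms integrable_bessel_kernel norm_mult_bessel_kernel_le in auto)

lemma fourier_bessel_add:
  assumes "f \<in> gauss_span" "g \<in> gauss_span"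
  shows "fourier_bessel \<alpha> (\<lambda>x. f x + g x) = (\<lambda>\<xi>. fourier_bessel \<alpha> f \<xi> + fourier_bessel \<alpha> g \<xi>)"
  unfolding fourier_bessel_def distrib_right
  by (intro ext Bochner_Integration.integral_add integrable_bessel_kernel gauss_span_integrable assms)

lemma fourier_bessel_gauss:
  assumes "\<And>i. 0 < a $ i"
  shows "fourier_bessel \<alpha> (\<lambda>x. c * complex_of_real (gauss a x)) =
    (\<lambda>\<xi>. (c * complex_of_real (gauss_mass a)) * complex_of_real (gauss (\<chi> i. 1 / (4 * a $ i)) \<xi>))"
proof
  fix \<xi>
  have "fourier_bessel \<alpha> (\<lambda>x. c * complex_of_real (gauss a x)) \<xi> =
      (\<integral>x. c * complex_of_real (gauss a x * bessel_kernel \<xi> x) \<partial>mu \<alpha>)"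
    unfolding fourier_bessel_def by (simp only: of_real_mult mult.assoc)
  also have "\<dots> = c * complex_of_real (\<integral>x. gauss a x * bessel_kernel \<xi> x \<partial>mu \<alpha>)"
    unfolding integral_mult_right_zero integral_complex_of_real ..
  also have "\<dots> = (c * complex_of_real (gauss_mass a)) * complex_of_real (gauss (\<chi> i. 1 / (4 * a $ i)) \<xi>)"
    by (simp add: has_bochner_integral_integral_eq[OF gauss_bessel_mu[OF assms]])
  finally show "fourier_bessel \<alpha> (\<lambda>x. c * complex_of_real (gauss a x)) \<xi> = \<dots>" .
qed

lemma fourier_bessel_gauss_span:
  assumes "f \<in> gauss_span"
  shows "fourier_bessel \<alpha> f \<in> gauss_span"
  using assms
proof (induction rule: gauss_span.induct)
  case (single a c)
  then show ?case
    unfolding fourier_bessel_gauss[OF single] by (intro gauss_span.single) simp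
next
  case (add f g)
  then show ?case unfolding fourier_bessel_add[OF add.hyps] by (intro gauss_span.add)
qed

text \<open>The reciprocal of the square of \<open>c_const \<alpha>\<close>.\<close>

definition plancherel_const :: real where
  "plancherel_const = (\<Prod>i\<in>UNIV. (Gamma (\<alpha> $ i + 1))\<^sup>2 * 4 powr (\<alpha> $ i))"

lemma plancherel_const_pos: "0 < plancherel_const"
proof -
  have "0 < Gamma (\<alpha> $ i + 1)" for i
    using \<alpha>[of i] by (intro Gamma_real_pos) simp
  then show ?thesis
    unfolding plancherel_const_def by (intro prod_pos ballI mult_pos_pos zero_less_power) auto
qed

text \<open>The map \<open>a \<mapsto> 1 / (4 * a)\<close> is an involution on exponents, and the
  two masses multiply to a constant independent of \<open>a\<close>. This is the inversion formula
  on the span.\<close>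

lemma fourier_bessel_twice:
  assumes "f \<in> gauss_span"
  shows "fourier_bessel \<alpha> (fourier_bessel \<alpha> f) = (\<lambda>x. complex_of_real plancherel_const * f x)"
  using assms
proof (induction rule: gauss_span.induct)
  case (single a c)
  have "gauss_mass a * gauss_mass (\<chi> i. 1 / (4 * a $ i)) = plancherel_const"
    unfolding gauss_mass_def plancherel_const_def prod.distrib[symmetric]
  proof (intro prod.cong refl)
    fix i
    define z where "z = \<alpha> $ i + 1"
    have "(a $ i) powr z * (1 / (4 * a $ i)) powr z = (1 / 4) powr z"
      using single[of i] by (simp flip: powr_mult)
    also have "\<dots> = 1 / (4 * 4 powr (\<alpha> $ i))"
      by (simp add: z_def powr_divide powr_add)
    finally have "(a $ i) powr z * (1 / (4 * a $ i)) powr z = 1 / (4 * 4 powr (\<alpha> $ i))" .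
    then have "1 / (4 * ((a $ i) powr z * (1 / (4 * a $ i)) powr z)) = 4 powr (\<alpha> $ i)"
      by simp
    moreover have "Gamma z / (2 * (a $ i) powr z) * (Gamma z / (2 * (1 / (4 * a $ i)) powr z)) =
        (Gamma z)\<^sup>2 * (1 / (4 * ((a $ i) powr z * (1 / (4 * a $ i)) powr z)))"
      by (simp add: power2_eq_square)
    ultimately show "Gamma (\<alpha> $ i + 1) / (2 * (a $ i) powr (\<alpha> $ i + 1)) *
        (Gamma (\<alpha> $ i + 1) / (2 * (\<chi> i. 1 / (4 * a $ i)) $ i powr (\<alpha> $ i + 1))) =
        (Gamma (\<alpha> $ i + 1))\<^sup>2 * 4 powr (\<alpha> $ i)"
      by (simp only: z_def vec_lambda_beta)
  qed
  then have "complex_of_real (gauss_mass a) * complex_of_real (gauss_mass (\<chi> i. 1 / (4 * a $ i))) =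
      complex_of_real plancherel_const"
    by (metis of_real_mult)
  moreover have "(\<chi> i. 1 / (4 * (\<chi> i. 1 / (4 * a $ i)) $ i)) = a"
    using single by (simp add: vec_eq_iff)
  moreover have "0 < (\<chi> i. 1 / (4 * a $ i)) $ i" for i
    using single by simp
  ultimately show ?case
    by (simp add: fourier_bessel_gauss single) (simp add: fun_eq_iff mult_ac)
next
  case (add f g)
  then show ?case
    by (simp add: fourier_bessel_add fourier_bessel_gauss_span distrib_left)
qed

text \<open>Both sides are bilinear, so a pair of Gaussians decides, and there both integrals are
  explicit masses.\<close>

lemma fourier_bessel_symmetric:
  assumes "f \<in> gauss_span" "g \<in> gauss_span"
  shows "(\<integral>x. f x * fourier_bessel \<alpha> g x \<partial>mu \<alpha>) = (\<integral>x. fourier_bessel \<alpha> f x * g x \<partial>mu \<alpha>)"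
  using assms(1)
proof (induction rule: gauss_span.induct)
  case (single a c)
  note a = single
  show ?case
    using assms(2)
  proof (induction rule: gauss_span.induct)
    case (single b d)
    let ?q = "\<lambda>a :: real^'n. (\<chi> i. 1 / (4 * a $ i)) :: real^'n"
    have sym: "gauss_mass b * gauss_mass (a + ?q b) = gauss_mass a * gauss_mass (b + ?q a)"
      unfolding gauss_mass_def prod.distrib[symmetric]
    proof (intro prod.cong refl)
      fix i
      define z where "z = \<alpha> $ i + 1"
      have "(b $ i) powr z * (a $ i + 1 / (4 * b $ i)) powr z = (b $ i * (a $ i + 1 / (4 * b $ i))) powr z"
        using a[of i] single[of i] by (intro powr_mult[symmetric])
      \<comment> \<open>Both sides equal \<open>a $ i * b $ i + 1 / 4\<close>; this is the
        symmetry.\<close>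
      also have "b $ i * (a $ i + 1 / (4 * b $ i)) = a $ i * (b $ i + 1 / (4 * a $ i))"
        using a[of i] single[of i] by (simp add: field_simps)
      also have "\<dots> powr z = (a $ i) powr z * (b $ i + 1 / (4 * a $ i)) powr z"
        using a[of i] single[of i] by (intro powr_mult)
      finally have "(b $ i) powr z * (a $ i + 1 / (4 * b $ i)) powr z = (a $ i) powr z * (b $ i + 1 / (4 * a $ i)) powr z" .
      then show "Gamma (\<alpha> $ i + 1) / (2 * b $ i powr (\<alpha> $ i + 1)) * (Gamma (\<alpha> $ i + 1) / (2 * (a + ?q b) $ i powr (\<alpha> $ i + 1))) =
          Gamma (\<alpha> $ i + 1) / (2 * a $ i powr (\<alpha> $ i + 1)) * (Gamma (\<alpha> $ i + 1) / (2 * (b + ?q a) $ i powr (\<alpha> $ i + 1)))"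
        unfolding z_def by simp
    qed
    have pos: "0 < (a + ?q b) $ i" "0 < (b + ?q a) $ i" for i
      using a[of i] single[of i] by (auto intro: add_pos_pos)
    have int: "(\<integral>x. e * complex_of_real (gauss v x) \<partial>mu \<alpha>) = e * complex_of_real (gauss_mass v)"
      if "\<And>i. 0 < v $ i" for e v
      unfolding integral_mult_right_zero integral_complex_of_real integral_gauss[OF that] ..
    have "(\<integral>x. c * complex_of_real (gauss a x) * fourier_bessel \<alpha> (\<lambda>x. d * complex_of_real (gauss b x)) x \<partial>mu \<alpha>) =
        (\<integral>x. (c * d * complex_of_real (gauss_mass b)) * complex_of_real (gauss (a + ?q b) x) \<partial>mu \<alpha>)"
      by (simp add: fourier_bessel_gauss single gauss_add mult_ac)
    also have "\<dots> = c * d * complex_of_real (gauss_mass b * gauss_mass (a + ?q b))"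
      unfolding int[OF pos(1)] by simp
    also have "\<dots> = c * d * complex_of_real (gauss_mass a * gauss_mass (b + ?q a))"
      unfolding sym ..
    also have "\<dots> = (\<integral>x. (c * d * complex_of_real (gauss_mass a)) * complex_of_real (gauss (b + ?q a) x) \<partial>mu \<alpha>)"
      unfolding int[OF pos(2)] by simp
    also have "\<dots> = (\<integral>x. fourier_bessel \<alpha> (\<lambda>x. c * complex_of_real (gauss a x)) x * (d * complex_of_real (gauss b x)) \<partial>mu \<alpha>)"
      by (simp add: fourier_bessel_gauss a gauss_add mult_ac)
    finally show ?case .
  next
    case (add g h)
    have f: "(\<lambda>x. c * complex_of_real (gauss a x)) \<in> gauss_span" by (rule gauss_span.single[OF a])
    note i = gauss_span_integrable[OF gauss_span_mult]
    show ?case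
      unfolding fourier_bessel_add[OF add.hyps] distrib_left
      by (simp only: Bochner_Integration.integral_add[OF i[OF f] i[OF f]]
          Bochner_Integration.integral_add[OF i[OF fourier_bessel_gauss_span[OF f]] i[OF fourier_bessel_gauss_span[OF f]]]
          fourier_bessel_gauss_span add.hyps add.IH)
  qed
next
  case (add f h)
  note i = gauss_span_integrable[OF gauss_span_mult]
  have g: "fourier_bessel \<alpha> g \<in> gauss_span" by (rule fourier_bessel_gauss_span[OF assms(2)])
  show ?case
    unfolding fourier_bessel_add[OF add.hyps] distrib_right
    by (simp only: Bochner_Integration.integral_add[OF i[OF _ g] i[OF _ g]]
        Bochner_Integration.integral_add[OF i[OF _ assms(2)] i[OF _ assms(2)]]
        fourier_bessel_gauss_span add.hyps add.IH)
qed

lemma fourier_bessel_cnj: "fourier_bessel \<alpha> (\<lambda>x. cnj (f x)) \<xi> = cnj (fourier_bessel \<alpha> f \<xi>)"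
  unfolding fourier_bessel_def Bochner_Integration.integral_cnj[symmetric] by simp

text \<open>Symmetry, applied to the transform of \<open>f\<close> and to the conjugate of
  \<open>f\<close>, moves one transform across the integral; applying the transform twice then
  multiplies \<open>f\<close> by the constant.\<close>

lemma plancherel_gauss_span:
  assumes "f \<in> gauss_span"
  shows "(\<integral>x. (norm (fourier_bessel \<alpha> f x))\<^sup>2 \<partial>mu \<alpha>) = plancherel_const * (\<integral>x. (norm (f x))\<^sup>2 \<partial>mu \<alpha>)"
proof -
  have F: "fourier_bessel \<alpha> f \<in> gauss_span" and cf: "(\<lambda>x. cnj (f x)) \<in> gauss_span"
    using assms by (auto intro: fourier_bessel_gauss_span gauss_span_cnj)
  have "complex_of_real (\<integral>x. (norm (fourier_bessel \<alpha> f x))\<^sup>2 \<partial>mu \<alpha>) =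
      (\<integral>x. fourier_bessel \<alpha> f x * fourier_bessel \<alpha> (\<lambda>x. cnj (f x)) x \<partial>mu \<alpha>)"
    by (simp only: integral_complex_of_real[symmetric] complex_norm_square fourier_bessel_cnj)
  also have "\<dots> = (\<integral>x. fourier_bessel \<alpha> (fourier_bessel \<alpha> f) x * cnj (f x) \<partial>mu \<alpha>)"
    by (rule fourier_bessel_symmetric[OF F cf])
  also have "\<dots> = (\<integral>x. complex_of_real (plancherel_const * (norm (f x))\<^sup>2) \<partial>mu \<alpha>)"
    unfolding fourier_bessel_twice[OF assms] of_real_mult complex_norm_square mult.assoc ..
  also have "\<dots> = complex_of_real (plancherel_const * (\<integral>x. (norm (f x))\<^sup>2 \<partial>mu \<alpha>))"
    unfolding integral_complex_of_real by simp
  finally show ?thesis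
    by (simp only: of_real_eq_iff)
qed

end

section \<open>Density of the Gaussians\<close>

text \<open>Integrability is demanded separately because a nonintegrable function has integral 0 by
  convention and would pass the smallness test.\<close>

definition poly_approximable :: "'a::euclidean_space measure \<Rightarrow> ('a \<Rightarrow> complex) \<Rightarrow> bool" where
  "poly_approximable M H \<longleftrightarrow> H \<in> borel_measurable M \<and>
    (\<forall>\<delta>>0. \<exists>P. polynomial_function P \<and> integrable M (\<lambda>x. (norm (H x - P x))\<^sup>2) \<and>
      (\<integral>x. (norm (H x - P x))\<^sup>2 \<partial>M) < \<delta>)"

lemma polynomial_function_borel:
  fixes P :: "'a::euclidean_space \<Rightarrow> complex"
  shows "polynomial_function P \<Longrightarrow> P \<in> borel_measurable borel"
  by (intro borel_measurable_continuous_onI continuous_at_imp_continuous_on ballI continuous_polymonial_function)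

context
  fixes M :: "'a::euclidean_space measure" and S :: "'a set"
  assumes fin: "finite_measure M" and sets_M: "sets M = sets borel"
    and S: "compact S" "AE x in M. x \<in> S"
begin

interpretation finite_measure M by (rule fin)

lemma borel_measurable_M: "f \<in> borel_measurable borel \<Longrightarrow> f \<in> borel_measurable M"
  by (subst measurable_cong_sets[OF sets_M refl])

lemma poly_approximable_closure:
  assumes H: "H \<in> borel_measurable M"
    and approx: "\<And>\<delta>. 0 < \<delta> \<Longrightarrow> \<exists>G. poly_approximable M G \<and>
      integrable M (\<lambda>x. (norm (H x - G x))\<^sup>2) \<and> (\<integral>x. (norm (H x - G x))\<^sup>2 \<partial>M) < \<delta>"
  shows "poly_approximable M H"
  unfolding poly_approximable_def
proof (intro conjI allI impI H)
  fix \<delta> :: real assume "0 < \<delta>"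
  \<comment> \<open>\<open>integrable_square_add\<close> doubles both squared errors, so two errors
    below a quarter add up to less than \<open>\<delta>\<close>.\<close>
  then have d: "0 < \<delta> / 4" by simp
  obtain G where G: "poly_approximable M G" "integrable M (\<lambda>x. (norm (H x - G x))\<^sup>2)"
    "(\<integral>x. (norm (H x - G x))\<^sup>2 \<partial>M) < \<delta> / 4"
    using approx[OF d] by blast
  then obtain P where P: "polynomial_function P" "integrable M (\<lambda>x. (norm (G x - P x))\<^sup>2)"
    "(\<integral>x. (norm (G x - P x))\<^sup>2 \<partial>M) < \<delta> / 4"
    using d unfolding poly_approximable_def by blast
  have m: "(\<lambda>x. H x - G x) \<in> borel_measurable M" "(\<lambda>x. G x - P x) \<in> borel_measurable M"
    using H G(1) borel_measurable_M[OF polynomial_function_borel[OF P(1)]]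
    by (auto simp: poly_approximable_def intro!: borel_measurable_diff)
  note sq = integrable_square_add[OF m G(2) P(2)]
  show "\<exists>P. polynomial_function P \<and> integrable M (\<lambda>x. (norm (H x - P x))\<^sup>2) \<and>
      (\<integral>x. (norm (H x - P x))\<^sup>2 \<partial>M) < \<delta>"
    using sq G(3) P by (intro exI[of _ P]) auto
qed

lemma poly_approximable_add:
  assumes "poly_approximable M F" "poly_approximable M G"
  shows "poly_approximable M (\<lambda>x. F x + G x)"
  unfolding poly_approximable_def
proof (intro conjI allI impI)
  show "(\<lambda>x. F x + G x) \<in> borel_measurable M"
    using assms by (auto simp: poly_approximable_def)
  fix \<delta> :: real assume "0 < \<delta>"
  then have d: "0 < \<delta> / 4" by simp
  obtain P where P: "polynomial_function P" "integrable M (\<lambda>x. (norm (F x - P x))\<^sup>2)"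
    "(\<integral>x. (norm (F x - P x))\<^sup>2 \<partial>M) < \<delta> / 4"
    using assms(1) d unfolding poly_approximable_def by blast
  obtain Q where Q: "polynomial_function Q" "integrable M (\<lambda>x. (norm (G x - Q x))\<^sup>2)"
    "(\<integral>x. (norm (G x - Q x))\<^sup>2 \<partial>M) < \<delta> / 4"
    using assms(2) d unfolding poly_approximable_def by blast
  have m: "(\<lambda>x. F x - P x) \<in> borel_measurable M" "(\<lambda>x. G x - Q x) \<in> borel_measurable M"
    using assms borel_measurable_M[OF polynomial_function_borel[OF P(1)]]
      borel_measurable_M[OF polynomial_function_borel[OF Q(1)]]
    by (auto simp: poly_approximable_def intro!: borel_measurable_diff)
  have eq: "(F x - P x) + (G x - Q x) = F x + G x - (P x + Q x)" for x by simp
  note sq = integrable_square_add[OF m P(2) Q(2), unfolded eq]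
  show "\<exists>P. polynomial_function P \<and> integrable M (\<lambda>x. (norm (F x + G x - P x))\<^sup>2) \<and>
      (\<integral>x. (norm (F x + G x - P x))\<^sup>2 \<partial>M) < \<delta>"
    using sq P Q by (intro exI[of _ "\<lambda>x. P x + Q x"]) (auto intro: polynomial_function_add)
qed

lemma poly_approximable_continuous:
  assumes f: "continuous_on UNIV f"
  shows "poly_approximable M f"
  unfolding poly_approximable_def
proof (intro conjI allI impI)
  show fm: "f \<in> borel_measurable M"
    by (intro borel_measurable_M borel_measurable_continuous_onI f)
  fix \<delta> :: real assume \<delta>: "0 < \<delta>"
  \<comment> \<open>The \<open>+ 1\<close> keeps the denominator positive when the measure is
    zero.\<close>
  define e where "e = sqrt (\<delta> / (2 * (measure M (space M) + 1)))"
  have mp: "0 < measure M (space M) + 1"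
    using measure_nonneg[of M "space M"] by linarith
  have e: "0 < e" "e\<^sup>2 = \<delta> / (2 * (measure M (space M) + 1))"
    using \<delta> mp by (auto simp: e_def)
  obtain P where P: "polynomial_function P" "\<And>x. x \<in> S \<Longrightarrow> norm (f x - P x) < e"
    using Stone_Weierstrass_polynomial_function[OF S(1) continuous_on_subset[OF f subset_UNIV] e(1)] by blast
  have bound: "AE x in M. (norm (f x - P x))\<^sup>2 \<le> e\<^sup>2"
    using S(2) by eventually_elim (auto intro!: power_mono less_imp_le[OF P(2)])
  have [measurable]: "f \<in> borel_measurable M" "P \<in> borel_measurable M"
    using fm borel_measurable_M[OF polynomial_function_borel[OF P(1)]] by auto
  have int: "integrable M (\<lambda>x. (norm (f x - P x))\<^sup>2)"
    by (rule integrable_const_bound[of _ "e\<^sup>2"]) (use bound in auto)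
  have "(\<integral>x. (norm (f x - P x))\<^sup>2 \<partial>M) \<le> (\<integral>x. e\<^sup>2 \<partial>M)"
    by (intro integral_mono_AE int bound) auto
  also have "\<dots> = e\<^sup>2 * measure M (space M)" by simp
  also have "\<dots> \<le> e\<^sup>2 * (measure M (space M) + 1)"
    by (intro mult_left_mono) auto
  also have "\<dots> = \<delta> / 2" using e(2) mp by (simp add: field_simps)
  also have "\<dots> < \<delta>" using \<delta> by simp
  finally show "\<exists>P. polynomial_function P \<and> integrable M (\<lambda>x. (norm (f x - P x))\<^sup>2) \<and>
      (\<integral>x. (norm (f x - P x))\<^sup>2 \<partial>M) < \<delta>"
    using P(1) int by blast
qed

lemma compact_inner_approx:
  assumes A: "A \<in> sets borel" and \<eta>: "0 < \<eta>"
  shows "\<exists>K\<subseteq>A. compact K \<and> measure M A - \<eta> < measure M K"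
proof (rule ccontr)
  assume "\<not> ?thesis"
  then have le: "measure M K \<le> measure M A - \<eta>" if "K \<subseteq> A" "compact K" for K
    using that by force
  have "emeasure M A = (SUP K \<in> {K. K \<subseteq> A \<and> compact K}. emeasure M K)"
    by (rule inner_regular) (use A sets_M emeasure_finite in auto)
  also have "\<dots> \<le> ennreal (measure M A - \<eta>)"
    by (rule SUP_least) (auto simp: emeasure_eq_measure intro!: ennreal_leI le)
  finally have "ennreal (measure M A) \<le> ennreal (measure M A - \<eta>)"
    by (simp add: emeasure_eq_measure)
  moreover have "0 \<le> measure M A - \<eta>" using le[of "{}"] by simp
  ultimately show False using \<eta> by (simp add: ennreal_le_iff)
qed

text \<open>Inner regularity puts compact sets into \<open>A\<close> and into its complement that
  miss little mass. A Urysohn function equal to 1 on the first and 0 on the second differs from the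
  indicator only on the small remainder \<open>R\<close>.\<close>

lemma poly_approximable_indicator:
  assumes A: "A \<in> sets borel"
  shows "poly_approximable M (\<lambda>x. indicat_real A x *\<^sub>R y)"
proof (rule poly_approximable_closure)
  have Am: "A \<in> sets M" using A sets_M by simp
  then show "(\<lambda>x. indicat_real A x *\<^sub>R y) \<in> borel_measurable M" by simp
  fix \<delta> :: real assume \<delta>: "0 < \<delta>"
  define \<eta> where "\<eta> = \<delta> / (2 * ((norm y)\<^sup>2 + 1))"
  have np: "0 < (norm y)\<^sup>2 + 1" by (simp add: add_nonneg_pos)
  have \<eta>: "0 < \<eta>" using \<delta> np by (simp add: \<eta>_def)
  have space_M: "space M = UNIV" using sets_eq_imp_space_eq[OF sets_M] by simp
  obtain K where K: "K \<subseteq> A" "compact K" "measure M A - \<eta> < measure M K"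
    using compact_inner_approx[OF A \<eta>] by blast
  obtain L where L: "L \<subseteq> - A" "compact L" "measure M (- A) - \<eta> < measure M L"
    using compact_inner_approx[of "- A" \<eta>] A \<eta> by auto
  have disj: "L \<inter> K = {}" using K(1) L(1) by blast
  obtain f :: "'a \<Rightarrow> real" where f: "continuous_on UNIV f" "\<And>x. f x \<in> closed_segment 0 1"
    "\<And>x. x \<in> L \<Longrightarrow> f x = 0" "\<And>x. x \<in> K \<Longrightarrow> f x = 1"
    using Urysohn[OF compact_imp_closed[OF L(2)] compact_imp_closed[OF K(2)] disj, of "0::real" 1] by blast
  have KL: "K \<in> sets M" "L \<in> sets M"
    using K L sets_M by (auto intro: borel_compact)
  define R where "R = - (K \<union> L)"
  have R: "R \<in> sets M" using KL space_M sets.compl_sets[of "K \<union> L" M] by (simp add: R_def Compl_eq_Diff_UNIV)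
  have "measure M (K \<union> L) = measure M K + measure M L"
    using KL disj by (intro finite_measure_Union) auto
  moreover have "measure M (- A) = measure M (space M) - measure M A"
    using finite_measure_compl[OF Am] by (simp add: space_M Compl_eq_Diff_UNIV)
  moreover have "measure M R = measure M (space M) - measure M (K \<union> L)"
    unfolding R_def using finite_measure_compl[of "K \<union> L"] KL by (simp add: space_M Compl_eq_Diff_UNIV)
  ultimately have Rm: "measure M R < 2 * \<eta>" using K(3) L(3) by linarith
  have bound: "(norm (indicat_real A x *\<^sub>R y - f x *\<^sub>R y))\<^sup>2 \<le> indicator R x * (norm y)\<^sup>2" for x
  proof (cases "x \<in> R")
    case True
    have "0 \<le> f x" "f x \<le> 1" using f(2)[of x] by (auto simp: closed_segment_eq_real_ivl)
    then have "\<bar>indicat_real A x - f x\<bar> \<le> 1" by (auto simp: indicator_def)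
    then have "norm (indicat_real A x *\<^sub>R y - f x *\<^sub>R y) \<le> 1 * norm y"
      unfolding scaleR_left_diff_distrib[symmetric] norm_scaleR by (intro mult_right_mono) auto
    then have "(norm (indicat_real A x *\<^sub>R y - f x *\<^sub>R y))\<^sup>2 \<le> (norm y)\<^sup>2"
      by (intro power_mono) auto
    then show ?thesis using True by simp
  next
    case False
    then consider "x \<in> K" | "x \<in> L" by (auto simp: R_def)
    then show ?thesis
    proof cases
      case 1
      then have "x \<in> A" using K(1) by blast
      then show ?thesis using False f(4)[OF 1] by simp
    next
      case 2
      then have "x \<notin> A" using L(1) by blast
      then show ?thesis using False f(3)[OF 2] by simp
    qed
  qed
  have cont: "continuous_on UNIV (\<lambda>x. f x *\<^sub>R y)" by (intro continuous_intros f)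
  have [measurable]: "(\<lambda>x. f x *\<^sub>R y) \<in> borel_measurable M" "A \<in> sets M"
    using borel_measurable_M[OF borel_measurable_continuous_onI[OF cont]] Am by auto
  have ir: "integrable M (\<lambda>x. indicator R x * (norm y)\<^sup>2)"
    using R by (intro integrable_mult_left) (auto simp: emeasure_finite less_top[symmetric])
  have int: "integrable M (\<lambda>x. (norm (indicat_real A x *\<^sub>R y - f x *\<^sub>R y))\<^sup>2)"
    by (rule Bochner_Integration.integrable_bound[OF ir]) (use bound in \<open>auto intro: order_trans[OF _ abs_ge_self]\<close>)
  have "(\<integral>x. (norm (indicat_real A x *\<^sub>R y - f x *\<^sub>R y))\<^sup>2 \<partial>M) \<le> (\<integral>x. indicator R x * (norm y)\<^sup>2 \<partial>M)"
    by (intro integral_mono int ir bound)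
  also have "\<dots> = measure M R * (norm y)\<^sup>2" using R by (simp add: space_M)
  also have "\<dots> \<le> 2 * \<eta> * (norm y)\<^sup>2" using Rm by (intro mult_right_mono) auto
  also have "\<dots> < 2 * \<eta> * ((norm y)\<^sup>2 + 1)" using \<eta> by (intro mult_strict_left_mono) auto
  also have "\<dots> = \<delta>" using np by (simp add: \<eta>_def field_simps)
  finally have "(\<integral>x. (norm (indicat_real A x *\<^sub>R y - f x *\<^sub>R y))\<^sup>2 \<partial>M) < \<delta>" .
  then show "\<exists>G. poly_approximable M G \<and> integrable M (\<lambda>x. (norm (indicat_real A x *\<^sub>R y - G x))\<^sup>2) \<and>
      (\<integral>x. (norm (indicat_real A x *\<^sub>R y - G x))\<^sup>2 \<partial>M) < \<delta>"
    using poly_approximable_continuous[OF cont] int by blast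
qed

lemma poly_approximable_sum:
  assumes "finite I" "\<And>i. i \<in> I \<Longrightarrow> poly_approximable M (f i)"
  shows "poly_approximable M (\<lambda>x. \<Sum>i\<in>I. f i x)"
  using assms
proof (induction rule: finite_induct)
  case empty
  then show ?case using poly_approximable_continuous[of "\<lambda>_. 0"] by simp
next
  case (insert i I)
  then show ?case using poly_approximable_add[of "f i" "\<lambda>x. \<Sum>i\<in>I. f i x"] by simp
qed

text \<open>Simple functions bounded by \<open>2 * norm (H x)\<close> converge to \<open>H\<close>;
  the error is at most \<open>3 * norm (H x)\<close>, so \<open>9 * (norm (H x))\<^sup>2\<close>
  dominates its square.\<close>

lemma poly_approximable_square_integrable:
  assumes H: "H \<in> borel_measurable M" and int: "integrable M (\<lambda>x. (norm (H x))\<^sup>2)"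
  shows "poly_approximable M H"
proof (rule poly_approximable_closure[OF H])
  fix \<delta> :: real assume \<delta>: "0 < \<delta>"
  have space_M: "space M = UNIV" using sets_eq_imp_space_eq[OF sets_M] by simp
  obtain F where F: "\<And>i. simple_function M (F i)" "\<And>x. (\<lambda>i. F i x) \<longlonglongrightarrow> H x"
    "\<And>i x. norm (F i x) \<le> 2 * norm (H x)"
    using borel_measurable_implies_sequence_metric[OF H, of 0] by (auto simp: space_M)
  have [measurable]: "F i \<in> borel_measurable M" for i
    using F(1) by (rule borel_measurable_simple_function)
  note [measurable] = H
  have bound: "(norm (H x - F i x))\<^sup>2 \<le> 9 * (norm (H x))\<^sup>2" for i x
  proof -
    have "norm (H x - F i x) \<le> 3 * norm (H x)"
      using norm_triangle_ineq4[of "H x" "F i x"] F(3)[of i x] by linarith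
    then have "(norm (H x - F i x))\<^sup>2 \<le> (3 * norm (H x))\<^sup>2" by (intro power_mono) auto
    then show ?thesis by (simp add: power_mult_distrib)
  qed
  have i9: "integrable M (\<lambda>x. 9 * (norm (H x))\<^sup>2)" using int by simp
  have ints: "integrable M (\<lambda>x. (norm (H x - F i x))\<^sup>2)" for i
    by (rule Bochner_Integration.integrable_bound[OF i9]) (use bound in auto)
  have "(\<lambda>i. \<integral>x. (norm (H x - F i x))\<^sup>2 \<partial>M) \<longlonglongrightarrow> (\<integral>x. 0 \<partial>M)"
  proof (rule integral_dominated_convergence[OF _ _ i9])
    show "AE x in M. (\<lambda>i. (norm (H x - F i x))\<^sup>2) \<longlonglongrightarrow> 0"
    proof (rule AE_I2)
      fix x
      have "(\<lambda>i. (norm (H x - F i x))\<^sup>2) \<longlonglongrightarrow> (norm (H x - H x))\<^sup>2"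
        by (intro tendsto_intros F)
      then show "(\<lambda>i. (norm (H x - F i x))\<^sup>2) \<longlonglongrightarrow> 0" by simp
    qed
  qed (use bound in auto)
  then have "eventually (\<lambda>i. (\<integral>x. (norm (H x - F i x))\<^sup>2 \<partial>M) < \<delta>) sequentially"
    using \<delta> by (intro order_tendstoD(2)) auto
  then obtain i where i: "(\<integral>x. (norm (H x - F i x))\<^sup>2 \<partial>M) < \<delta>"
    by (auto simp: eventually_sequentially)
  have "F i = (\<lambda>x. \<Sum>y\<in>F i ` space M. indicat_real (F i -` {y} \<inter> space M) x *\<^sub>R y)"
    by (intro ext simple_function_indicator_representation_banach[OF F(1)]) (simp add: space_M)
  moreover have "poly_approximable M (\<lambda>x. \<Sum>y\<in>F i ` space M. indicat_real (F i -` {y} \<inter> space M) x *\<^sub>R y)"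
    using F(1)[of i] sets_M
    by (intro poly_approximable_sum poly_approximable_indicator) (auto simp: simple_function_def)
  ultimately have "poly_approximable M (F i)" by simp
  then show "\<exists>G. poly_approximable M G \<and> integrable M (\<lambda>x. (norm (H x - G x))\<^sup>2) \<and>
      (\<integral>x. (norm (H x - G x))\<^sup>2 \<partial>M) < \<delta>"
    using ints i by blast
qed

end

section \<open>Passage from the orthant to the unit cube\<close>

definition exp_coords :: "real^'n::finite \<Rightarrow> real^'n" where
  "exp_coords x = (\<chi> i. exp (- (x $ i)\<^sup>2))"

definition log_coords :: "real^'n::finite \<Rightarrow> real^'n" where
  "log_coords y = (\<chi> i. sqrt (- ln (y $ i)))"

lemma log_exp_coords: "x \<in> pos_orthant \<Longrightarrow> log_coords (exp_coords x) = x"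
  by (simp add: pos_orthant_def log_coords_def exp_coords_def vec_eq_iff less_imp_le)

lemma borel_measurable_vec_lambda:
  fixes f :: "'n::finite \<Rightarrow> 'a \<Rightarrow> real"
  assumes [measurable]: "\<And>i. f i \<in> borel_measurable M"
  shows "(\<lambda>x. \<chi> i. f i x) \<in> borel_measurable M"
proof (subst borel_measurable_euclidean_space, intro ballI)
  fix b :: "real^'n" assume "b \<in> Basis"
  then obtain i where "b = axis i 1" by (auto simp: Basis_vec_def)
  then show "(\<lambda>x. (\<chi> i. f i x) \<bullet> b) \<in> borel_measurable M"
    by (simp add: inner_axis)
qed

lemma exp_coords_borel: "exp_coords \<in> borel_measurable borel"
  unfolding exp_coords_def by (intro borel_measurable_vec_lambda) measurable

lemma log_coords_borel: "log_coords \<in> borel_measurable borel"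
  unfolding log_coords_def by (intro borel_measurable_vec_lambda) measurable

text \<open>A coordinate of \<open>exp_coords x\<close> is \<open>gauss (axis i 1) x\<close>, with
  exponent 0 in the other coordinates, so multiplication by it stays in the span. The function
  \<open>f\<close> is generalized because the product case multiplies twice.\<close>

lemma gauss_span_mult_real_polynomial:
  fixes q :: "real^'n::finite \<Rightarrow> real"
  assumes "real_polynomial_function q" "f \<in> gauss_span"
  shows "(\<lambda>x. f x * complex_of_real (q (exp_coords x))) \<in> gauss_span"
  using assms
proof (induction arbitrary: f rule: real_polynomial_function.induct)
  case (linear h)
  have h: "h (exp_coords x) = (\<Sum>i\<in>UNIV. h (axis i 1) * gauss (axis i 1) x)" for x
  proof -
    have "exp_coords x = (\<Sum>i\<in>UNIV. exp (- (x $ i)\<^sup>2) *\<^sub>R axis i 1)"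
      by (simp add: vec_eq_iff exp_coords_def axis_def if_distrib cong: if_cong)
    then have "h (exp_coords x) = (\<Sum>i\<in>UNIV. exp (- (x $ i)\<^sup>2) * h (axis i 1))"
      using linear(1) by (simp add: linear_sum bounded_linear.linear linear_cmul)
    moreover have "gauss (axis i 1) x = exp (- (x $ i)\<^sup>2)" for i
      by (simp add: gauss_def axis_def if_distrib[of "\<lambda>u. u * _"] cong: if_cong)
    ultimately show ?thesis by (simp add: mult.commute)
  qed
  have "(\<lambda>x. \<Sum>i\<in>UNIV. complex_of_real (h (axis i 1)) * (f x * complex_of_real (gauss (axis i 1) x))) \<in> gauss_span"
    by (intro gauss_span_sum gauss_span_scale gauss_span_mult_gauss linear) (auto simp: axis_def)
  then show ?case
    unfolding h by (simp add: sum_distrib_left mult_ac)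
next
  case (const c)
  then show ?case using gauss_span_scale[of f "complex_of_real c"] by (simp add: mult.commute)
next
  case (add p q)
  then show ?case
    using gauss_span.add[of "\<lambda>x. f x * complex_of_real (p (exp_coords x))" "\<lambda>x. f x * complex_of_real (q (exp_coords x))"]
    by (simp add: distrib_left)
next
  case (mult p q)
  have "(\<lambda>x. f x * complex_of_real (p (exp_coords x)) * complex_of_real (q (exp_coords x))) \<in> gauss_span"
    by (intro mult)
  then show ?case by (simp add: mult.assoc)
qed

lemma gauss_span_mult_polynomial:
  fixes P :: "real^'n::finite \<Rightarrow> complex"
  assumes "polynomial_function P" "f \<in> gauss_span"
  shows "(\<lambda>x. f x * P (exp_coords x)) \<in> gauss_span"
proof -
  have "real_polynomial_function (\<lambda>x. Re (P x))" "real_polynomial_function (\<lambda>x. Im (P x))"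
    using assms(1) by (auto simp: polynomial_function_iff_Basis_inner Basis_complex_def)
  then have "(\<lambda>x. f x * complex_of_real (Re (P (exp_coords x))) + \<i> * (f x * complex_of_real (Im (P (exp_coords x))))) \<in> gauss_span"
    using assms(2) by (intro gauss_span.add gauss_span_scale gauss_span_mult_real_polynomial)
  moreover have "f x * complex_of_real (Re (P (exp_coords x))) + \<i> * (f x * complex_of_real (Im (P (exp_coords x)))) =
      f x * P (exp_coords x)" for x
    by (subst (3) complex_eq) (simp add: algebra_simps)
  ultimately show ?thesis by simp
qed

text \<open>In the coordinates \<open>y\<^sub>i = exp (- x\<^sub>i\<^sup>2)\<close> the Gaussians with integral exponents are monomials on the
  unit cube.\<close>

lemma gauss_span_dense:
  fixes \<alpha> :: "real^'n::finite"
  assumes \<alpha>: "\<And>i. - 1 / 2 < \<alpha> $ i" and \<psi>: "\<psi> \<in> L2 \<alpha>" and \<delta>: "0 < \<delta>"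
  shows "\<exists>p\<in>gauss_span. (\<integral>x. (norm (\<psi> x - p x))\<^sup>2 \<partial>mu \<alpha>) < \<delta>"
proof -
  define G where "G = gauss (\<chi> i. 1 :: real^'n)"
  have G_pos: "0 < G x" for x by (simp add: G_def gauss_pos)
  have G2: "(G x)\<^sup>2 = gauss (\<chi> i. 2) x" for x
    unfolding G_def power2_eq_square gauss_add[symmetric] by (rule arg_cong2[where f = gauss]) (auto simp: vec_eq_iff)
  have Gm[measurable]: "G \<in> borel_measurable borel"
    unfolding G_def gauss_def[abs_def] by (intro borel_measurable_continuous_onI continuous_intros)
  have Gmu[measurable]: "G \<in> borel_measurable (mu \<alpha>)" by (rule measurable_mu[OF Gm])
  \<comment> \<open>The weight \<open>(G x)\<^sup>2\<close> makes the measure finite and turns the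
    square distance from \<open>H\<close> to \<open>P\<close> on the cube into that from
    \<open>\<psi>\<close> to \<open>G\<close> times \<open>P\<close> on the orthant, where
    \<open>H\<close> is \<open>\<psi> / G\<close> in the new coordinates.\<close>
  define m where "m = density (mu \<alpha>) (\<lambda>x. ennreal ((G x)\<^sup>2))"
  define \<nu> where "\<nu> = distr m borel exp_coords"
  have Ym: "exp_coords \<in> measurable (mu \<alpha>) borel" by (rule measurable_mu[OF exp_coords_borel])
  have Ym': "exp_coords \<in> measurable m borel" using Ym by (simp add: m_def)
  have "integrable (mu \<alpha>) (\<lambda>x. (G x)\<^sup>2)"
    unfolding G2 by (rule integrable_gauss[OF \<alpha>]) simp
  moreover have "emeasure m (space m) = (\<integral>\<^sup>+x. ennreal ((G x)\<^sup>2) \<partial>mu \<alpha>)"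
    unfolding m_def by (subst emeasure_density) (auto intro!: nn_integral_cong)
  ultimately have "emeasure m (space m) < \<infinity>"
    by (simp add: nn_integral_eq_integral)
  then have "finite_measure m" by (intro finite_measureI) auto
  then have fin: "finite_measure \<nu>"
    unfolding \<nu>_def using Ym' by (rule finite_measure.finite_measure_distr)
  have sets: "sets \<nu> = sets borel" by (simp add: \<nu>_def)
  have "exp_coords x \<in> cbox 0 (\<chi> i. 1)" for x :: "real^'n"
    by (simp add: mem_box_cart exp_coords_def)
  then have supp: "AE y in \<nu>. y \<in> cbox 0 (\<chi> i. 1)"
    unfolding \<nu>_def using Ym' by (subst AE_distr_iff) auto
  \<comment> \<open>\<open>\<psi>\<close> is measurable on the orthant only; extension by zero makes
    the composition with \<open>log_coords\<close> Borel measurable everywhere.\<close>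
  define \<psi>' where "\<psi>' x = indicat_real pos_orthant x *\<^sub>R \<psi> x" for x
  define H where "H y = \<psi>' (log_coords y) / complex_of_real (G (log_coords y))" for y
  have \<psi>m: "\<psi> \<in> borel_measurable (mu \<alpha>)" and \<psi>i: "integrable (mu \<alpha>) (\<lambda>x. (norm (\<psi> x))\<^sup>2)"
    using \<psi> by (auto simp: L2_def)
  have "\<psi> \<in> borel_measurable (restrict_space borel pos_orthant)"
    using \<psi>m by (simp add: measurable_cong_sets[OF sets_mu refl])
  then have \<psi>'m: "\<psi>' \<in> borel_measurable borel"
    unfolding \<psi>'_def by (subst (asm) borel_measurable_restrict_space_iff) auto
  have Hm: "H \<in> borel_measurable borel"
  proof -
    note [measurable] = log_coords_borel \<psi>'m
    show ?thesis unfolding H_def by measurable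
  qed
  have H_eq: "H (exp_coords x) = \<psi> x / complex_of_real (G x)" if "x \<in> pos_orthant" for x
    using that by (simp add: H_def log_exp_coords \<psi>'_def)
  have transfer: "integrable \<nu> (\<lambda>y. (norm (H y - P y))\<^sup>2) \<longleftrightarrow>
        integrable (mu \<alpha>) (\<lambda>x. (norm (\<psi> x - complex_of_real (G x) * P (exp_coords x)))\<^sup>2)"
    "(\<integral>y. (norm (H y - P y))\<^sup>2 \<partial>\<nu>) =
        (\<integral>x. (norm (\<psi> x - complex_of_real (G x) * P (exp_coords x)))\<^sup>2 \<partial>mu \<alpha>)"
    if P: "P \<in> borel_measurable borel" for P
  proof -
    let ?f = "\<lambda>y. (norm (H y - P y))\<^sup>2"
    have fm: "?f \<in> borel_measurable borel" using Hm P by measurable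
    have fY: "(\<lambda>x. ?f (exp_coords x)) \<in> borel_measurable (mu \<alpha>)"
      by (rule measurable_compose[OF Ym fm])
    have eq: "(G x)\<^sup>2 *\<^sub>R ?f (exp_coords x) = (norm (\<psi> x - complex_of_real (G x) * P (exp_coords x)))\<^sup>2"
      if "x \<in> space (mu \<alpha>)" for x
    proof -
      have "\<psi> x - complex_of_real (G x) * P (exp_coords x) = complex_of_real (G x) * (H (exp_coords x) - P (exp_coords x))"
        using that G_pos[of x] by (simp add: space_mu H_eq right_diff_distrib)
      then show ?thesis using G_pos[of x] by (simp add: norm_mult power_mult_distrib)
    qed
    have "integrable \<nu> ?f \<longleftrightarrow> integrable (mu \<alpha>) (\<lambda>x. (G x)\<^sup>2 *\<^sub>R ?f (exp_coords x))"
      unfolding \<nu>_def integrable_distr_eq[OF Ym' fm] unfolding m_def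
      by (rule integrable_density) (use fY in auto)
    also have "\<dots> \<longleftrightarrow> integrable (mu \<alpha>) (\<lambda>x. (norm (\<psi> x - complex_of_real (G x) * P (exp_coords x)))\<^sup>2)"
      by (rule Bochner_Integration.integrable_cong[OF refl eq])
    finally show "integrable \<nu> ?f \<longleftrightarrow> \<dots>" .
    have "integral\<^sup>L \<nu> ?f = (\<integral>x. (G x)\<^sup>2 *\<^sub>R ?f (exp_coords x) \<partial>mu \<alpha>)"
      unfolding \<nu>_def integral_distr[OF Ym' fm] unfolding m_def
      by (rule integral_density) (use fY in auto)
    also have "\<dots> = (\<integral>x. (norm (\<psi> x - complex_of_real (G x) * P (exp_coords x)))\<^sup>2 \<partial>mu \<alpha>)"
      by (rule Bochner_Integration.integral_cong[OF refl eq])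
    finally show "integral\<^sup>L \<nu> ?f = \<dots>" .
  qed
  have "integrable \<nu> (\<lambda>y. (norm (H y))\<^sup>2)"
    using transfer(1)[of "\<lambda>_. 0"] \<psi>i by simp
  moreover have "H \<in> borel_measurable \<nu>"
    using Hm by (simp add: \<nu>_def)
  ultimately have "poly_approximable \<nu> H"
    by (intro poly_approximable_square_integrable[OF fin sets compact_cbox supp])
  then obtain P where P: "polynomial_function P" "(\<integral>y. (norm (H y - P y))\<^sup>2 \<partial>\<nu>) < \<delta>"
    using \<delta> unfolding poly_approximable_def by blast
  have "(\<lambda>x. complex_of_real (G x)) \<in> gauss_span"
    unfolding G_def using gauss_span.single[of "\<chi> i. 1" 1] by simp
  then have "(\<lambda>x. complex_of_real (G x) * P (exp_coords x)) \<in> gauss_span"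
    by (rule gauss_span_mult_polynomial[OF P(1)])
  then show ?thesis
    using P(2) unfolding transfer(2)[OF polynomial_function_borel[OF P(1)]] 
    by (intro bexI[of _ "\<lambda>x. complex_of_real (G x) * P (exp_coords x)"])
qed

section \<open>Low frequencies of compactly supported distributions\<close>

text \<open>A Gaussian majorant makes the square norm of the cutoff explicit. On the support
  \<open>r \<le> 2 * c\<close>, so the factor \<open>exp 1\<close> compensates
  \<open>exp (- r / (2 * c))\<close>; \<open>B\<close> does not depend on \<open>c\<close>.\<close>

lemma cutoff_square_le:
  obtains B where "0 \<le> B" "\<And>c x. 0 < c \<Longrightarrow>
    (cube_cutoff c (x :: real^'n::finite))\<^sup>2 \<le> B * gauss (\<chi> i. 1 / (2 * c)) x"
proof -
  obtain K where K: "0 \<le> K" "\<And>r. \<bar>cutoff 0 r\<bar> \<le> K"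
    using cutoff_bounded[of 0] by auto
  have one: "(cutoff 0 (r / c))\<^sup>2 \<le> K\<^sup>2 * exp 1 * exp (- (1 / (2 * c)) * r)" if c: "0 < c" for c r
  proof (cases "2 * c \<le> r")
    case True
    then have "2 \<le> r / c" using c by (simp add: field_simps)
    then show ?thesis by (simp add: cutoff_eq_0 del: cutoff.simps)
  next
    case False
    have "(cutoff 0 (r / c))\<^sup>2 \<le> K\<^sup>2 * 1"
      using power_mono[OF K(2) abs_ge_zero, of "r / c" 2] by (simp del: cutoff.simps)
    also have "\<dots> \<le> K\<^sup>2 * (exp 1 * exp (- (1 / (2 * c)) * r))"
    proof (rule mult_left_mono)
      have "0 \<le> 1 + (- (1 / (2 * c)) * r)"
        using False c by (simp add: field_simps)
      then show "1 \<le> exp 1 * exp (- (1 / (2 * c)) * r)"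
        unfolding exp_add[symmetric] by simp
    qed simp
    finally show ?thesis by (simp only: mult.assoc)
  qed
  have "(cube_cutoff c x)\<^sup>2 \<le> (\<Prod>i\<in>(UNIV::'n set). K\<^sup>2 * exp 1) * gauss (\<chi> i. 1 / (2 * c)) x"
    if "0 < c" for c and x :: "real^'n"
    unfolding cube_cutoff_def prod_power_distrib gauss_prod prod.distrib[symmetric] vec_lambda_beta
    by (intro prod_mono conjI one that) auto
  then show thesis
    by (intro that[of "\<Prod>i\<in>(UNIV::'n set). K\<^sup>2 * exp 1"]) (auto intro!: prod_nonneg)
qed

lemma cube_cutoff_borel: "cube_cutoff c \<in> borel_measurable borel"
proof -
  have [measurable]: "cutoff 0 \<in> borel_measurable borel"
    by (intro borel_measurable_continuous_onI deriv_family_continuous deriv_family_cutoff)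
  show ?thesis
    unfolding cube_cutoff_def[abs_def] by measurable
qed

context
  fixes \<alpha> :: "real^'n::finite"
  assumes \<alpha>: "\<And>i. - 1 / 2 < \<alpha> $ i"
begin

lemma fourier_bessel_scale:
  "fourier_bessel \<alpha> (\<lambda>x. c * f x) \<xi> = c * fourier_bessel \<alpha> f \<xi>"
  unfolding fourier_bessel_def mult.assoc by (rule integral_mult_right_zero)

text \<open>For a Gaussian sum \<open>T (\<Theta> k)\<close> is the pairing of \<open>g\<close> with
  an explicit inverse transform, to which Cauchy-Schwarz and Plancherel apply. The passage to the
  limit replaces the norm of \<open>\<Theta> k\<close> by that of the cut-off
  \<open>q\<close>.\<close>

lemma supported_gauss_span_bound:
  assumes T: "T \<in> tempered_even" and supp: "supported_in T (cball 0 \<epsilon>)" and \<epsilon>: "0 < \<epsilon>"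
    and gm: "g \<in> borel_measurable (mu \<alpha>)" and gi: "integrable (mu \<alpha>) (\<lambda>x. (norm (g x))\<^sup>2)"
    and rep: "\<And>p. p \<in> gauss_span \<Longrightarrow> T (fourier_bessel \<alpha> p) = (\<integral>x. g x * p x \<partial>mu \<alpha>)"
    and q: "q \<in> gauss_span"
  shows "norm (T q) \<le> sqrt (\<integral>x. (norm (g x))\<^sup>2 \<partial>mu \<alpha>) *
    sqrt (1 / plancherel_const \<alpha> * (\<integral>x. (norm (complex_of_real (cube_cutoff (4 * \<epsilon>\<^sup>2) x) * q x))\<^sup>2 \<partial>mu \<alpha>))"
proof -
  let ?K = "plancherel_const \<alpha>" and ?h = "\<lambda>x. complex_of_real (cube_cutoff (4 * \<epsilon>\<^sup>2) x) * q x"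
  have K: "0 < ?K" by (rule plancherel_const_pos[OF \<alpha>])
  obtain \<Theta> L where \<Theta>: "\<And>k. \<Theta> k \<in> gauss_span" "(\<lambda>k. T (\<Theta> k)) \<longlonglongrightarrow> T q"
    "\<And>k x. norm (\<Theta> k x - ?h x) \<le> L / real (Suc k) * exp (- (norm x)\<^sup>2)"
    using supported_gauss_span_approx[OF T supp \<epsilon> q] by blast
  have bound: "norm (T (\<Theta> k)) \<le> sqrt (\<integral>x. (norm (g x))\<^sup>2 \<partial>mu \<alpha>) *
      sqrt (1 / ?K * (\<integral>x. (norm (\<Theta> k x))\<^sup>2 \<partial>mu \<alpha>))" for k
  proof -
    \<comment> \<open>The inverse transform of \<open>\<Theta> k\<close>, by
      \<open>fourier_bessel_twice\<close>.\<close>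
    define \<theta> where "\<theta> = (\<lambda>x. complex_of_real (1 / ?K) * fourier_bessel \<alpha> (\<Theta> k) x)"
    have \<theta>: "\<theta> \<in> gauss_span"
      unfolding \<theta>_def by (intro gauss_span_scale fourier_bessel_gauss_span[OF \<alpha>] \<Theta>)
    have "fourier_bessel \<alpha> \<theta> = \<Theta> k"
      unfolding \<theta>_def using K
      by (intro ext) (simp only: fourier_bessel_scale fourier_bessel_twice[OF \<alpha> \<Theta>(1)], simp)
    then have "T (\<Theta> k) = (\<integral>x. g x * \<theta> x \<partial>mu \<alpha>)"
      using rep[OF \<theta>] by simp
    then have "norm (T (\<Theta> k)) \<le> sqrt (\<integral>x. (norm (g x))\<^sup>2 \<partial>mu \<alpha>) * sqrt (\<integral>x. (norm (\<theta> x))\<^sup>2 \<partial>mu \<alpha>)"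
      using Cauchy_Schwarz_integral[OF gm gauss_span_measurable[OF \<theta>] gi gauss_span_square_integrable[OF \<alpha> \<theta>]]
      by simp
    moreover have "(\<integral>x. (norm (\<theta> x))\<^sup>2 \<partial>mu \<alpha>) = 1 / ?K * (\<integral>x. (norm (\<Theta> k x))\<^sup>2 \<partial>mu \<alpha>)"
    proof -
      have "(\<integral>x. (norm (\<theta> x))\<^sup>2 \<partial>mu \<alpha>) = (\<integral>x. (1 / ?K)\<^sup>2 * (norm (fourier_bessel \<alpha> (\<Theta> k) x))\<^sup>2 \<partial>mu \<alpha>)"
        using K by (simp only: \<theta>_def norm_mult power_mult_distrib norm_of_real power2_abs)
      also have "\<dots> = (1 / ?K)\<^sup>2 * (?K * (\<integral>x. (norm (\<Theta> k x))\<^sup>2 \<partial>mu \<alpha>))"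
        by (simp only: integral_mult_right_zero plancherel_gauss_span[OF \<alpha> \<Theta>(1)])
      also have "\<dots> = 1 / ?K * (\<integral>x. (norm (\<Theta> k x))\<^sup>2 \<partial>mu \<alpha>)"
        using K by (simp add: power2_eq_square)
      finally show ?thesis .
    qed
    ultimately show ?thesis by simp
  qed
  have hm: "?h \<in> borel_measurable (mu \<alpha>)"
  proof -
    note [measurable] = measurable_mu[OF cube_cutoff_borel] gauss_span_measurable[OF q]
    show ?thesis by measurable
  qed
  have "(\<lambda>k. \<integral>x. (norm (\<Theta> k x))\<^sup>2 \<partial>mu \<alpha>) \<longlonglongrightarrow> (\<integral>x. (norm (?h x))\<^sup>2 \<partial>mu \<alpha>)"
  proof (rule integral_dominated_convergence)
    have L: "0 \<le> L" using order_trans[OF norm_ge_zero \<Theta>(3)[of 0 0]] by simp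
    \<comment> \<open>Comparison with the fixed sum \<open>\<Theta> 0\<close> gives a majorant
      independent of \<open>k\<close> whose integrability is known.\<close>
    let ?w = "\<lambda>x. 2 * ((2 * L)\<^sup>2 * exp (- 2 * (norm x)\<^sup>2)) + 2 * (norm (\<Theta> 0 x))\<^sup>2"
    have "integrable (mu \<alpha>) (\<lambda>x. gauss (\<chi> i. 2) x)"
      by (rule integrable_gauss[OF \<alpha>]) simp
    then show "integrable (mu \<alpha>) ?w"
      unfolding gauss_const
      by (intro Bochner_Integration.integrable_add integrable_mult_right gauss_span_square_integrable[OF \<alpha>] \<Theta>(1))
    show "AE x in mu \<alpha>. norm ((norm (\<Theta> k x))\<^sup>2) \<le> ?w x" for k
    proof (rule AE_I2)
      fix x
      have "norm (\<Theta> k x - \<Theta> 0 x) \<le> norm (\<Theta> k x - ?h x) + norm (\<Theta> 0 x - ?h x)"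
        using norm_triangle_ineq4[of "\<Theta> k x - ?h x" "\<Theta> 0 x - ?h x"] by simp
      also have "\<dots> \<le> L * exp (- (norm x)\<^sup>2) + L * exp (- (norm x)\<^sup>2)"
      proof (rule add_mono)
        show "norm (\<Theta> 0 x - ?h x) \<le> L * exp (- (norm x)\<^sup>2)"
          using \<Theta>(3)[of 0 x] by simp
        have "L / real (Suc k) \<le> L" using L by (simp add: divide_le_eq mult_le_cancel_left1)
        then show "norm (\<Theta> k x - ?h x) \<le> L * exp (- (norm x)\<^sup>2)"
          using order_trans[OF \<Theta>(3)[of k x] mult_right_mono] by simp
      qed
      finally have "(norm (\<Theta> k x - \<Theta> 0 x))\<^sup>2 \<le> (2 * L * exp (- (norm x)\<^sup>2))\<^sup>2"
        by (intro power_mono) auto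
      also have "\<dots> = (2 * L)\<^sup>2 * exp (- 2 * (norm x)\<^sup>2)"
        by (simp add: power_mult_distrib exp_double[symmetric])
      finally have a: "(norm (\<Theta> k x - \<Theta> 0 x))\<^sup>2 \<le> (2 * L)\<^sup>2 * exp (- 2 * (norm x)\<^sup>2)" .
      have "(norm (\<Theta> k x))\<^sup>2 \<le> (norm (\<Theta> k x - \<Theta> 0 x) + norm (\<Theta> 0 x))\<^sup>2"
        using norm_triangle_ineq[of "\<Theta> k x - \<Theta> 0 x" "\<Theta> 0 x"] by (intro power_mono) auto
      also have "\<dots> \<le> 2 * (norm (\<Theta> k x - \<Theta> 0 x))\<^sup>2 + 2 * (norm (\<Theta> 0 x))\<^sup>2"
        using sum_squares_bound[of "norm (\<Theta> k x - \<Theta> 0 x)" "norm (\<Theta> 0 x)"] by (simp add: power2_sum)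
      also have "\<dots> \<le> ?w x"
        using a by (intro add_mono mult_left_mono) auto
      finally show "norm ((norm (\<Theta> k x))\<^sup>2) \<le> ?w x" by simp
    qed
    show "AE x in mu \<alpha>. (\<lambda>k. (norm (\<Theta> k x))\<^sup>2) \<longlonglongrightarrow> (norm (?h x))\<^sup>2"
    proof (rule AE_I2)
      fix x :: "real^'n"
      have "(\<lambda>k. L * exp (- (norm x)\<^sup>2) / real (Suc k)) \<longlonglongrightarrow> 0"
        by (rule LIMSEQ_Suc) (rule lim_const_over_n)
      then have "(\<lambda>k. \<Theta> k x - ?h x) \<longlonglongrightarrow> 0"
        by (rule Lim_null_comparison[rotated]) (use \<Theta>(3) in auto)
      then have "(\<lambda>k. \<Theta> k x) \<longlonglongrightarrow> ?h x"
        by (simp add: LIM_zero_iff)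
      then show "(\<lambda>k. (norm (\<Theta> k x))\<^sup>2) \<longlonglongrightarrow> (norm (?h x))\<^sup>2"
        by (intro tendsto_intros)
    qed
    show "(\<lambda>x. (norm (?h x))\<^sup>2) \<in> borel_measurable (mu \<alpha>)"
      using hm by measurable
    show "(\<lambda>x. (norm (\<Theta> k x))\<^sup>2) \<in> borel_measurable (mu \<alpha>)" for k
      using gauss_span_measurable[OF \<Theta>(1)[of k], of \<alpha>] by measurable
  qed
  then have "(\<lambda>k. sqrt (\<integral>x. (norm (g x))\<^sup>2 \<partial>mu \<alpha>) * sqrt (1 / ?K * (\<integral>x. (norm (\<Theta> k x))\<^sup>2 \<partial>mu \<alpha>))) \<longlonglongrightarrow>
      sqrt (\<integral>x. (norm (g x))\<^sup>2 \<partial>mu \<alpha>) * sqrt (1 / ?K * (\<integral>x. (norm (?h x))\<^sup>2 \<partial>mu \<alpha>))"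
    by (intro tendsto_intros)
  then show ?thesis
    by (rule tendsto_le[OF sequentially_bot _ tendsto_norm[OF \<Theta>(2)]]) (use bound in auto)
qed

text \<open>The Gamma factors and powers of 4 cancel, and only \<open>c = \<epsilon> * R\<close>
  survives: coordinate \<open>i\<close> contributes \<open>c\<close> to the power
  \<open>2 * (\<alpha> $ i + 1)\<close>, which is at most \<open>c\<close> because this exponent
  exceeds 1 and \<open>c \<le> 1\<close>. At least one coordinate exists, so the product is at most
  \<open>c\<close>.\<close>

lemma gauss_mass_product_le:
  assumes c: "0 < c" "c \<le> 1" and \<epsilon>: "0 < \<epsilon>" and R: "\<epsilon> * R = c"
  shows "1 / plancherel_const \<alpha> * gauss_mass \<alpha> (\<chi> i. 1 / (8 * \<epsilon>\<^sup>2)) * gauss_mass \<alpha> (\<chi> i. 2 / R\<^sup>2) \<le> c"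
proof -
  have Rp: "0 < R" using R c \<epsilon> by (metis zero_less_mult_pos)
  have G: "0 < Gamma (\<alpha> $ i + 1)" for i
    using \<alpha>[of i] by (intro Gamma_real_pos) simp
  have "1 / plancherel_const \<alpha> * gauss_mass \<alpha> (\<chi> i. 1 / (8 * \<epsilon>\<^sup>2)) * gauss_mass \<alpha> (\<chi> i. 2 / R\<^sup>2) =
      (\<Prod>i\<in>UNIV. (c\<^sup>2) powr (\<alpha> $ i + 1))"
  proof -
    have "1 / plancherel_const \<alpha> = (\<Prod>i\<in>UNIV. 1 / ((Gamma (\<alpha> $ i + 1))\<^sup>2 * 4 powr (\<alpha> $ i)))"
      unfolding plancherel_const_def[OF \<alpha>] by (simp add: prod_dividef)
    then have "1 / plancherel_const \<alpha> * gauss_mass \<alpha> (\<chi> i. 1 / (8 * \<epsilon>\<^sup>2)) * gauss_mass \<alpha> (\<chi> i. 2 / R\<^sup>2) =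
      (\<Prod>i\<in>UNIV. 1 / ((Gamma (\<alpha> $ i + 1))\<^sup>2 * 4 powr (\<alpha> $ i)) *
        (Gamma (\<alpha> $ i + 1) / (2 * (1 / (8 * \<epsilon>\<^sup>2)) powr (\<alpha> $ i + 1))) *
        (Gamma (\<alpha> $ i + 1) / (2 * (2 / R\<^sup>2) powr (\<alpha> $ i + 1))))"
      by (simp only: gauss_mass_def[OF \<alpha>] prod.distrib vec_lambda_beta)
    also have "\<dots> = (\<Prod>i\<in>UNIV. (c\<^sup>2) powr (\<alpha> $ i + 1))"
    proof (intro prod.cong refl)
      fix i
      define z where "z = \<alpha> $ i + 1"
      have "4 powr (\<alpha> $ i) * 4 * ((1 / (8 * \<epsilon>\<^sup>2)) powr z * (2 / R\<^sup>2) powr z) = (4 * ((1 / (8 * \<epsilon>\<^sup>2)) * (2 / R\<^sup>2))) powr z"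
      proof -
        have gen: "(x * (y * w)) powr z = x powr z * (y powr z * w powr z)" if "0 \<le> x" "0 \<le> y" "0 \<le> w" for x y w :: real
          using that by (simp add: powr_mult)
        have eq: "4 powr (\<alpha> $ i) * 4 = (4::real) powr z"
          by (simp add: z_def powr_add)
        show ?thesis unfolding eq by (rule gen[symmetric]) auto
      qed
      also have "4 * ((1 / (8 * \<epsilon>\<^sup>2)) * (2 / R\<^sup>2)) = inverse (c\<^sup>2)"
        using \<epsilon> Rp by (simp add: R[symmetric] power_mult_distrib field_simps)
      finally have *: "4 powr (\<alpha> $ i) * 4 * ((1 / (8 * \<epsilon>\<^sup>2)) powr z * (2 / R\<^sup>2) powr z) = inverse ((c\<^sup>2) powr z)"
        using c by (simp add: powr_divide inverse_eq_divide)
      have "1 / ((Gamma z)\<^sup>2 * 4 powr (\<alpha> $ i)) * (Gamma z / (2 * (1 / (8 * \<epsilon>\<^sup>2)) powr z)) * (Gamma z / (2 * (2 / R\<^sup>2) powr z)) =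
          inverse (4 powr (\<alpha> $ i) * 4 * ((1 / (8 * \<epsilon>\<^sup>2)) powr z * (2 / R\<^sup>2) powr z))"
        using G[of i] by (simp add: z_def field_simps power2_eq_square)
      then show "1 / ((Gamma (\<alpha> $ i + 1))\<^sup>2 * 4 powr (\<alpha> $ i)) *
        (Gamma (\<alpha> $ i + 1) / (2 * (1 / (8 * \<epsilon>\<^sup>2)) powr (\<alpha> $ i + 1))) *
        (Gamma (\<alpha> $ i + 1) / (2 * (2 / R\<^sup>2) powr (\<alpha> $ i + 1))) = (c\<^sup>2) powr (\<alpha> $ i + 1)"
        unfolding * by (simp add: z_def)
    qed
    finally show ?thesis .
  qed
  also have "\<dots> \<le> (\<Prod>i\<in>(UNIV::'n set). c)"
  proof (intro prod_mono conjI)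
    fix i
    have "(c\<^sup>2) powr (\<alpha> $ i + 1) = c powr (2 * (\<alpha> $ i + 1))"
      using c by (simp add: powr_powr flip: powr_numeral)
    also have "\<dots> \<le> c powr 1"
      using c \<alpha>[of i] by (intro powr_mono') auto
    finally show "(c\<^sup>2) powr (\<alpha> $ i + 1) \<le> c" using c by simp
  qed simp
  also have "\<dots> = c ^ CARD('n)" by simp
  also have "\<dots> \<le> c ^ 1"
    using c by (intro power_decreasing) (auto simp: Suc_leI)
  finally show ?thesis by simp
qed

lemma low_frequency_gauss_span:
  assumes B: "0 \<le> B" "\<And>c x. 0 < c \<Longrightarrow> (cube_cutoff c (x :: real^'n))\<^sup>2 \<le> B * gauss (\<chi> i. 1 / (2 * c)) x"
    and T: "T \<in> tempered_even" and supp: "supported_in T (cball 0 \<epsilon>)" and \<epsilon>: "0 < \<epsilon>"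
    and gm: "g \<in> borel_measurable (mu \<alpha>)" and gi: "integrable (mu \<alpha>) (\<lambda>x. (norm (g x))\<^sup>2)"
    and rep: "\<And>p. p \<in> gauss_span \<Longrightarrow> T (fourier_bessel \<alpha> p) = (\<integral>x. g x * p x \<partial>mu \<alpha>)"
    and c: "0 < c" "c \<le> 1" and R: "\<epsilon> * R = c"
    and p: "p \<in> gauss_span"
  shows "norm (\<integral>x. g x * (p x * complex_of_real (gauss (\<chi> i. 1 / R\<^sup>2) x)) \<partial>mu \<alpha>) \<le>
    sqrt (\<integral>x. (norm (g x))\<^sup>2 \<partial>mu \<alpha>) * sqrt (B * c * (\<integral>x. (norm (p x))\<^sup>2 \<partial>mu \<alpha>))"
proof -
  let ?\<gamma> = "\<lambda>x. complex_of_real (gauss (\<chi> i. 1 / R\<^sup>2) x)" and ?K = "plancherel_const \<alpha>"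
  let ?N = "\<integral>x. (norm (p x))\<^sup>2 \<partial>mu \<alpha>"
  have Rp: "0 < R" using R c \<epsilon> by (metis zero_less_mult_pos)
  have K: "0 < ?K" by (rule plancherel_const_pos[OF \<alpha>])
  have \<gamma>: "?\<gamma> \<in> gauss_span"
    using gauss_span.single[of "\<chi> i. 1 / R\<^sup>2" 1] Rp by simp
  define \<phi> where "\<phi> = (\<lambda>x. p x * ?\<gamma> x)"
  have \<phi>: "\<phi> \<in> gauss_span" unfolding \<phi>_def by (rule gauss_span_mult[OF p \<gamma>])
  define q where "q = fourier_bessel \<alpha> \<phi>"
  have q: "q \<in> gauss_span" unfolding q_def by (rule fourier_bessel_gauss_span[OF \<alpha> \<phi>])
  define m1 where "m1 = gauss_mass \<alpha> (\<chi> i. 1 / (8 * \<epsilon>\<^sup>2))"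
  define m2 where "m2 = gauss_mass \<alpha> (\<chi> i. 2 / R\<^sup>2)"
  have I1: "integrable (mu \<alpha>) (gauss (\<chi> i. 1 / (8 * \<epsilon>\<^sup>2)))" "integral\<^sup>L (mu \<alpha>) (gauss (\<chi> i. 1 / (8 * \<epsilon>\<^sup>2))) = m1"
    unfolding m1_def using \<epsilon> by (auto intro!: integrable_gauss[OF \<alpha>] integral_gauss[OF \<alpha>])
  have I2: "integral\<^sup>L (mu \<alpha>) (gauss (\<chi> i. 2 / R\<^sup>2)) = m2"
    unfolding m2_def using Rp by (auto intro!: integral_gauss[OF \<alpha>])
  have m2_nn: "0 \<le> m2" unfolding I2[symmetric] by (intro integral_nonneg_AE) (auto simp: gauss_pos less_imp_le)
  have \<gamma>2: "(\<integral>x. (norm (?\<gamma> x))\<^sup>2 \<partial>mu \<alpha>) = m2"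
  proof -
    have "(norm (?\<gamma> x))\<^sup>2 = gauss (\<chi> i. 2 / R\<^sup>2) x" for x :: "real^'n"
      unfolding norm_of_real power2_abs power2_eq_square[of "gauss _ x"] gauss_add[symmetric]
      by (rule arg_cong2[where f = gauss]) (auto simp: vec_eq_iff)
    then show ?thesis using I2 by simp
  qed
  let ?J = "\<integral>x. norm (\<phi> x) \<partial>mu \<alpha>"
  \<comment> \<open>Cauchy-Schwarz splits the \<open>L1\<close> norm; the squared Gaussian has
    exponents \<open>2 / R\<^sup>2\<close>, hence the mass \<open>m2\<close>.\<close>
  have J: "0 \<le> ?J" "?J \<le> sqrt ?N * sqrt m2"
    using Cauchy_Schwarz_norm_integral[OF gauss_span_measurable[OF p] gauss_span_measurable[OF \<gamma>]
        gauss_span_square_integrable[OF \<alpha> p] gauss_span_square_integrable[OF \<alpha> \<gamma>]]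
    unfolding \<phi>_def \<gamma>2 by auto
  have J2: "?J\<^sup>2 \<le> ?N * m2"
  proof -
    have "?J\<^sup>2 \<le> (sqrt ?N * sqrt m2)\<^sup>2" by (intro power_mono J)
    then show ?thesis using m2_nn by (simp add: power_mult_distrib)
  qed
  let ?h = "\<lambda>x. complex_of_real (cube_cutoff (4 * \<epsilon>\<^sup>2) x) * q x"
  \<comment> \<open>The supremum bound on \<open>q\<close> pulls out \<open>?J\<close>. What is left
    is the majorant of the squared cutoff with parameter \<open>4 * \<epsilon>\<^sup>2\<close>,
    whose exponent is \<open>1 / (8 * \<epsilon>\<^sup>2)\<close> and whose mass is
    \<open>m1\<close>.\<close>
  have "(\<integral>x. (norm (?h x))\<^sup>2 \<partial>mu \<alpha>) \<le> (\<integral>x. (B * ?J\<^sup>2) * gauss (\<chi> i. 1 / (8 * \<epsilon>\<^sup>2)) x \<partial>mu \<alpha>)"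
  proof (rule integral_mono')
    show "integrable (mu \<alpha>) (\<lambda>x. (B * ?J\<^sup>2) * gauss (\<chi> i. 1 / (8 * \<epsilon>\<^sup>2)) x)"
      by (intro integrable_mult_right I1)
    fix x
    have "norm (q x) \<le> ?J"
      unfolding q_def by (rule norm_fourier_bessel_le[OF \<alpha> gauss_span_integrable[OF \<alpha> \<phi>]])
    then have "(norm (q x))\<^sup>2 \<le> ?J\<^sup>2" by (intro power_mono) auto
    moreover have "(cube_cutoff (4 * \<epsilon>\<^sup>2) x)\<^sup>2 \<le> B * gauss (\<chi> i. 1 / (8 * \<epsilon>\<^sup>2)) x"
      using B(2)[of "4 * \<epsilon>\<^sup>2" x] \<epsilon> by simp
    ultimately have "(cube_cutoff (4 * \<epsilon>\<^sup>2) x)\<^sup>2 * (norm (q x))\<^sup>2 \<le> (B * gauss (\<chi> i. 1 / (8 * \<epsilon>\<^sup>2)) x) * ?J\<^sup>2"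
      using B(1) by (intro mult_mono) (auto simp: gauss_pos less_imp_le)
    then show "(norm (?h x))\<^sup>2 \<le> (B * ?J\<^sup>2) * gauss (\<chi> i. 1 / (8 * \<epsilon>\<^sup>2)) x"
      by (simp only: norm_mult power_mult_distrib norm_of_real power2_abs mult_ac)
  qed (use B(1) in \<open>auto intro!: mult_nonneg_nonneg simp: gauss_pos less_imp_le\<close>)
  also have "\<dots> = B * ?J\<^sup>2 * m1"
    using I1(2) by simp
  finally have h: "1 / ?K * (\<integral>x. (norm (?h x))\<^sup>2 \<partial>mu \<alpha>) \<le> 1 / ?K * (B * ?J\<^sup>2 * m1)"
    using K by (intro mult_left_mono) auto
  have m1_nn: "0 \<le> m1" unfolding I1(2)[symmetric] by (intro integral_nonneg_AE) (auto simp: gauss_pos less_imp_le)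
  note h
  also have "1 / ?K * (B * ?J\<^sup>2 * m1) \<le> 1 / ?K * (B * (?N * m2) * m1)"
    using B(1) K m1_nn by (intro mult_left_mono mult_right_mono J2) auto
  also have "\<dots> = B * ?N * (1 / ?K * m1 * m2)" by simp
  also have "\<dots> \<le> B * ?N * c"
    unfolding m1_def m2_def using B(1) by (intro mult_left_mono gauss_mass_product_le[OF c \<epsilon> R]) auto
  finally have "sqrt (1 / ?K * (\<integral>x. (norm (?h x))\<^sup>2 \<partial>mu \<alpha>)) \<le> sqrt (B * c * ?N)"
    by (intro real_sqrt_le_mono) (simp only: mult_ac)
  then have "sqrt (\<integral>x. (norm (g x))\<^sup>2 \<partial>mu \<alpha>) * sqrt (1 / ?K * (\<integral>x. (norm (?h x))\<^sup>2 \<partial>mu \<alpha>)) \<le>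
      sqrt (\<integral>x. (norm (g x))\<^sup>2 \<partial>mu \<alpha>) * sqrt (B * c * ?N)"
    by (rule mult_left_mono) simp
  from order_trans[OF supported_gauss_span_bound[OF T supp \<epsilon> gm gi rep q] this]
  show ?thesis
    unfolding q_def rep[OF \<phi>] by (simp only: \<phi>_def)
qed

end

section \<open>From the span to all square-integrable functions\<close>

lemma cnj_borel[measurable]: "cnj \<in> borel_measurable borel"
  by (intro borel_measurable_continuous_onI continuous_intros)

context
  fixes \<alpha> :: "real^'n::finite"
  assumes \<alpha>: "\<And>i. - 1 / 2 < \<alpha> $ i"
begin

lemma cnj_L2: "g \<in> L2 \<alpha> \<Longrightarrow> (\<lambda>x. cnj (g x)) \<in> L2 \<alpha>"
  by (auto simp: L2_def)

text \<open>Density removes the auxiliary function of the preceding estimate. The 2 under the root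
  stems from bounding the square norm of the approximant by
  \<open>2 * ?N + 2 * \<delta>\<close>.\<close>

lemma low_frequency_bound:
  assumes B: "0 \<le> B" "\<And>c x. 0 < c \<Longrightarrow> (cube_cutoff c (x :: real^'n))\<^sup>2 \<le> B * gauss (\<chi> i. 1 / (2 * c)) x"
    and T: "T \<in> tempered_even" and supp: "supported_in T (cball 0 \<epsilon>)" and \<epsilon>: "0 < \<epsilon>"
    and g: "g \<in> L2 \<alpha>"
    and rep: "\<And>p. p \<in> gauss_span \<Longrightarrow> T (fourier_bessel \<alpha> p) = (\<integral>x. g x * p x \<partial>mu \<alpha>)"
    and c: "0 < c" "c \<le> 1" and R: "\<epsilon> * R = c"
  shows "(\<integral>x. (norm (g x))\<^sup>2 * gauss (\<chi> i. 1 / R\<^sup>2) x \<partial>mu \<alpha>) \<le>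
    sqrt (2 * (B * c)) * (\<integral>x. (norm (g x))\<^sup>2 \<partial>mu \<alpha>)"
proof -
  let ?\<gamma> = "gauss (\<chi> i. 1 / R\<^sup>2) :: real^'n \<Rightarrow> real"
  let ?N = "\<integral>x. (norm (g x))\<^sup>2 \<partial>mu \<alpha>" and ?I = "\<integral>x. (norm (g x))\<^sup>2 * ?\<gamma> x \<partial>mu \<alpha>"
  have gm[measurable]: "g \<in> borel_measurable (mu \<alpha>)" and gi: "integrable (mu \<alpha>) (\<lambda>x. (norm (g x))\<^sup>2)"
    using g by (auto simp: L2_def)
  have \<gamma>m[measurable]: "?\<gamma> \<in> borel_measurable (mu \<alpha>)"
    by (rule gauss_measurable)
  have \<gamma>1: "0 \<le> ?\<gamma> x" "?\<gamma> x \<le> 1" for x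
    by (auto simp: gauss_def intro!: sum_nonneg)
  have N: "0 \<le> ?N" by simp
  \<comment> \<open>\<open>p\<close> runs through Gaussian sums tending to the conjugate of \<open>g\<close>.\<close>
  have bound: "?I \<le> sqrt ?N * sqrt (B * c * (2 * ?N + 2 * \<delta>)) + sqrt ?N * sqrt \<delta>" if \<delta>: "0 < \<delta>" for \<delta>
  proof -
    obtain p where p: "p \<in> gauss_span" "(\<integral>x. (norm (cnj (g x) - p x))\<^sup>2 \<partial>mu \<alpha>) < \<delta>"
      using gauss_span_dense[OF \<alpha> cnj_L2[OF g] \<delta>] by blast
    note [measurable] = gauss_span_measurable[OF p(1)]
    note pi = gauss_span_square_integrable[OF \<alpha> p(1)]
    have gci: "integrable (mu \<alpha>) (\<lambda>x. (norm (cnj (g x)))\<^sup>2)" using gi by simp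
    have di: "integrable (mu \<alpha>) (\<lambda>x. (norm (cnj (g x) - p x))\<^sup>2)"
      using integrable_square_add(1)[of "\<lambda>x. cnj (g x)" "mu \<alpha>" "\<lambda>x. - p x"] gci pi by simp
    have dn: "(\<integral>x. (norm (p x))\<^sup>2 \<partial>mu \<alpha>) \<le> 2 * ?N + 2 * \<delta>"
    proof -
      have "(\<integral>x. (norm (cnj (g x) + - (cnj (g x) - p x)))\<^sup>2 \<partial>mu \<alpha>) \<le>
          2 * (\<integral>x. (norm (cnj (g x)))\<^sup>2 \<partial>mu \<alpha>) + 2 * (\<integral>x. (norm (- (cnj (g x) - p x)))\<^sup>2 \<partial>mu \<alpha>)"
        by (rule integrable_square_add(2)) (use gci di in \<open>simp_all only: norm_minus_cancel, measurable\<close>)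
      then have "(\<integral>x. (norm (p x))\<^sup>2 \<partial>mu \<alpha>) \<le> 2 * ?N + 2 * (\<integral>x. (norm (cnj (g x) - p x))\<^sup>2 \<partial>mu \<alpha>)"
        by (simp only: norm_minus_cancel complex_mod_cnj) simp
      then show ?thesis using p(2) by linarith
    qed
    let ?e = "\<lambda>x. (cnj (g x) - p x) * complex_of_real (?\<gamma> x)"
    have \<gamma>_le: "(norm (z * complex_of_real (?\<gamma> x)))\<^sup>2 \<le> (norm z)\<^sup>2" for z x
    proof (rule power_mono)
      show "norm (z * complex_of_real (?\<gamma> x)) \<le> norm z"
        using mult_left_mono[OF \<gamma>1(2)[of x] norm_ge_zero[of z]] \<gamma>1(1)[of x] by (simp add: norm_mult)
    qed simp
    have ei: "integrable (mu \<alpha>) (\<lambda>x. (norm (?e x))\<^sup>2)"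
      by (rule Bochner_Integration.integrable_bound[OF di]) (use \<gamma>_le in auto)
    have en: "(\<integral>x. (norm (?e x))\<^sup>2 \<partial>mu \<alpha>) \<le> \<delta>"
      using integral_mono[OF ei di \<gamma>_le] p(2) by linarith
    have pi': "integrable (mu \<alpha>) (\<lambda>x. (norm (p x * complex_of_real (?\<gamma> x)))\<^sup>2)"
      by (rule Bochner_Integration.integrable_bound[OF pi]) (use \<gamma>_le in auto)
    have i1: "integrable (mu \<alpha>) (\<lambda>x. g x * (p x * complex_of_real (?\<gamma> x)))"
      by (rule integrable_mult_square) (use gi pi' in auto)
    have i2: "integrable (mu \<alpha>) (\<lambda>x. g x * ?e x)"
      by (rule integrable_mult_square) (use gi ei in auto)
    have "complex_of_real ?I = (\<integral>x. g x * (p x * complex_of_real (?\<gamma> x)) + g x * ?e x \<partial>mu \<alpha>)"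
      unfolding integral_complex_of_real[symmetric] of_real_mult complex_norm_square
      by (simp add: algebra_simps)
    also have "\<dots> = (\<integral>x. g x * (p x * complex_of_real (?\<gamma> x)) \<partial>mu \<alpha>) + (\<integral>x. g x * ?e x \<partial>mu \<alpha>)"
      by (rule Bochner_Integration.integral_add[OF i1 i2])
    finally have eq: "complex_of_real ?I = \<dots>" .
    have "?I \<le> norm (complex_of_real ?I)" by simp
    also have "\<dots> \<le> norm (\<integral>x. g x * (p x * complex_of_real (?\<gamma> x)) \<partial>mu \<alpha>) + norm (\<integral>x. g x * ?e x \<partial>mu \<alpha>)"
      unfolding eq by (rule norm_triangle_ineq)
    also have "\<dots> \<le> sqrt ?N * sqrt (B * c * (2 * ?N + 2 * \<delta>)) + sqrt ?N * sqrt \<delta>"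
    proof (rule add_mono)
      have "norm (\<integral>x. g x * (p x * complex_of_real (?\<gamma> x)) \<partial>mu \<alpha>) \<le> sqrt ?N * sqrt (B * c * (\<integral>x. (norm (p x))\<^sup>2 \<partial>mu \<alpha>))"
        by (rule low_frequency_gauss_span[OF \<alpha> B T supp \<epsilon> gm gi rep c R p(1)])
      also have "\<dots> \<le> sqrt ?N * sqrt (B * c * (2 * ?N + 2 * \<delta>))"
        using B c N by (intro mult_left_mono real_sqrt_le_mono dn) auto
      finally show "norm (\<integral>x. g x * (p x * complex_of_real (?\<gamma> x)) \<partial>mu \<alpha>) \<le> \<dots>" .
      have em: "?e \<in> borel_measurable (mu \<alpha>)" by measurable
      have "norm (\<integral>x. g x * ?e x \<partial>mu \<alpha>) \<le> sqrt ?N * sqrt (\<integral>x. (norm (?e x))\<^sup>2 \<partial>mu \<alpha>)"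
        by (rule Cauchy_Schwarz_integral[OF gm em gi ei])
      also have "\<dots> \<le> sqrt ?N * sqrt \<delta>"
        by (intro mult_left_mono real_sqrt_le_mono en) simp
      finally show "norm (\<integral>x. g x * ?e x \<partial>mu \<alpha>) \<le> \<dots>" .
    qed
    finally show ?thesis .
  qed
  \<comment> \<open>\<open>low_frequency_gauss_span\<close> has a constant independent of
    \<open>p\<close>, so \<open>\<delta>\<close> can tend to 0 from the right.\<close>
  have "((\<lambda>\<delta>. sqrt ?N * sqrt (B * c * (2 * ?N + 2 * \<delta>)) + sqrt ?N * sqrt \<delta>) \<longlongrightarrow>
      sqrt ?N * sqrt (B * c * (2 * ?N + 2 * 0)) + sqrt ?N * sqrt 0) (at_right 0)"
    by (intro tendsto_intros)
  then have "?I \<le> sqrt ?N * sqrt (B * c * (2 * ?N + 2 * 0)) + sqrt ?N * sqrt 0"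
    by (rule tendsto_lowerbound) (use bound in \<open>auto simp: eventually_at_filter\<close>)
  also have "\<dots> = sqrt (2 * (B * c)) * (sqrt ?N * sqrt ?N)"
    by (simp add: real_sqrt_mult)
  also have "\<dots> = sqrt (2 * (B * c)) * ?N" using N by simp
  finally show ?thesis .
qed

text \<open>The difference of two representing functions annihilates all Gaussian sums; testing
  against sums close to its conjugate shows that its square norm is zero. This is what makes the
  choice operator in \<open>sobolev_norm\<close> harmless.\<close>

lemma represents_unique:
  assumes "\<psi> \<in> L2 \<alpha>" "\<psi>' \<in> L2 \<alpha>" "represents \<alpha> \<psi> T" "represents \<alpha> \<psi>' T"
  shows "L2_alpha_norm \<alpha> \<psi> = L2_alpha_norm \<alpha> \<psi>'"
proof -
  have m[measurable]: "\<psi> \<in> borel_measurable (mu \<alpha>)" "\<psi>' \<in> borel_measurable (mu \<alpha>)"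
    and i: "integrable (mu \<alpha>) (\<lambda>x. (norm (\<psi> x))\<^sup>2)" "integrable (mu \<alpha>) (\<lambda>x. (norm (\<psi>' x))\<^sup>2)"
    using assms by (auto simp: L2_def)
  define d where "d x = \<psi> x - \<psi>' x" for x
  have dm[measurable]: "d \<in> borel_measurable (mu \<alpha>)" unfolding d_def by measurable
  have di: "integrable (mu \<alpha>) (\<lambda>x. (norm (d x))\<^sup>2)"
    using integrable_square_add(1)[of \<psi> "mu \<alpha>" "\<lambda>x. - \<psi>' x"] i by (simp add: d_def)
  have d: "d \<in> L2 \<alpha>" using dm di by (simp add: L2_def)
  let ?N = "\<integral>x. (norm (d x))\<^sup>2 \<partial>mu \<alpha>"
  have zero: "(\<integral>x. d x * p x \<partial>mu \<alpha>) = 0" if p: "p \<in> gauss_span" for p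
  proof -
    note pm[measurable] = gauss_span_measurable[OF p] and pi = gauss_span_square_integrable[OF \<alpha> p]
    have "integrable (mu \<alpha>) (\<lambda>x. \<psi> x * p x)" "integrable (mu \<alpha>) (\<lambda>x. \<psi>' x * p x)"
      by (intro integrable_mult_square m pm i pi)+
    then have "(\<integral>x. d x * p x \<partial>mu \<alpha>) = (\<integral>x. \<psi> x * p x \<partial>mu \<alpha>) - (\<integral>x. \<psi>' x * p x \<partial>mu \<alpha>)"
      by (simp add: d_def left_diff_distrib)
    moreover have "(\<integral>x. \<psi> x * p x \<partial>mu \<alpha>) = (\<integral>x. \<psi>' x * p x \<partial>mu \<alpha>)"
      using assms(3,4) gauss_span_S_even[OF p] by (auto simp: represents_def distr_of_fun_def)
    ultimately show ?thesis by simp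
  qed
  have bound: "?N \<le> sqrt ?N * sqrt \<delta>" if \<delta>: "0 < \<delta>" for \<delta>
  proof -
    obtain p where p: "p \<in> gauss_span" "(\<integral>x. (norm (cnj (d x) - p x))\<^sup>2 \<partial>mu \<alpha>) < \<delta>"
      using gauss_span_dense[OF \<alpha> cnj_L2[OF d] \<delta>] by blast
    note pm[measurable] = gauss_span_measurable[OF p(1)] and pi = gauss_span_square_integrable[OF \<alpha> p(1)]
    have ei: "integrable (mu \<alpha>) (\<lambda>x. (norm (cnj (d x) - p x))\<^sup>2)"
      using integrable_square_add(1)[of "\<lambda>x. cnj (d x)" "mu \<alpha>" "\<lambda>x. - p x"] di pi by simp
    have em: "(\<lambda>x. cnj (d x) - p x) \<in> borel_measurable (mu \<alpha>)" by measurable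
    have "integrable (mu \<alpha>) (\<lambda>x. d x * p x)" "integrable (mu \<alpha>) (\<lambda>x. d x * (cnj (d x) - p x))"
      by (intro integrable_mult_square dm pm em di pi ei)+
    then have "(\<integral>x. d x * p x + d x * (cnj (d x) - p x) \<partial>mu \<alpha>) = 0 + (\<integral>x. d x * (cnj (d x) - p x) \<partial>mu \<alpha>)"
      by (subst Bochner_Integration.integral_add) (auto simp: zero[OF p(1)])
    moreover have "complex_of_real ?N = (\<integral>x. d x * p x + d x * (cnj (d x) - p x) \<partial>mu \<alpha>)"
      unfolding integral_complex_of_real[symmetric] complex_norm_square by (simp add: algebra_simps)
    ultimately have eq: "complex_of_real ?N = (\<integral>x. d x * (cnj (d x) - p x) \<partial>mu \<alpha>)" by simp
    have "?N = norm (complex_of_real ?N)" by simp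
    also have "\<dots> = norm (\<integral>x. d x * (cnj (d x) - p x) \<partial>mu \<alpha>)"
      unfolding eq ..
    also have "\<dots> \<le> sqrt ?N * sqrt (\<integral>x. (norm (cnj (d x) - p x))\<^sup>2 \<partial>mu \<alpha>)"
      by (rule Cauchy_Schwarz_integral[OF dm em di ei])
    also have "\<dots> \<le> sqrt ?N * sqrt \<delta>"
      using p(2) by (intro mult_left_mono real_sqrt_le_mono) auto
    finally show ?thesis .
  qed
  have "((\<lambda>\<delta>. sqrt ?N * sqrt \<delta>) \<longlongrightarrow> sqrt ?N * sqrt 0) (at_right 0)"
    by (intro tendsto_intros)
  then have "?N \<le> sqrt ?N * sqrt 0"
    by (rule tendsto_lowerbound) (use bound in \<open>auto simp: eventually_at_filter\<close>)
  moreover have "0 \<le> ?N" by simp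
  ultimately have "?N = 0" by simp
  then have "AE x in mu \<alpha>. (norm (d x))\<^sup>2 = 0"
    using integral_nonneg_eq_0_iff_AE[OF di] by simp
  then have "AE x in mu \<alpha>. (norm (\<psi> x))\<^sup>2 = (norm (\<psi>' x))\<^sup>2"
    by eventually_elim (simp add: d_def)
  then have "(\<integral>x. (norm (\<psi> x))\<^sup>2 \<partial>mu \<alpha>) = (\<integral>x. (norm (\<psi>' x))\<^sup>2 \<partial>mu \<alpha>)"
    by (intro integral_cong_AE) auto
  then show ?thesis by (simp add: L2_alpha_norm_def)
qed

lemma sobolev_norm_eq:
  assumes "\<psi> \<in> L2 \<alpha>" "represents \<alpha> \<psi> (mult_distr (sobolev_weight s) (fourier_bessel_distr \<alpha> T))"
  shows "sobolev_norm \<alpha> s T = c_const \<alpha> * L2_alpha_norm \<alpha> \<psi>"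
proof -
  let ?P = "\<lambda>\<psi>. \<psi> \<in> L2 \<alpha> \<and> represents \<alpha> \<psi> (mult_distr (sobolev_weight s) (fourier_bessel_distr \<alpha> T))"
  have "?P (SOME \<psi>. ?P \<psi>)" by (rule someI[of ?P \<psi>]) (use assms in auto)
  then have "L2_alpha_norm \<alpha> (SOME \<psi>. ?P \<psi>) = L2_alpha_norm \<alpha> \<psi>"
    using represents_unique assms by blast
  then show ?thesis by (simp add: sobolev_norm_def)
qed

section \<open>Changing the Sobolev exponent\<close>

lemma sobolev_weight_mult: "sobolev_weight s x * sobolev_weight t x = sobolev_weight (s + t) x"
proof -
  have "0 < 1 + (norm x)\<^sup>2" by (simp add: add_pos_nonneg)
  then show ?thesis by (simp add: sobolev_weight_def powr_add)
qed

lemma sobolev_weight_measurable: "sobolev_weight s \<in> borel_measurable (mu \<alpha>)"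
proof (intro measurable_mu borel_measurable_continuous_onI)
  have "1 + (norm x)\<^sup>2 \<noteq> 0" for x :: "real^'n"
    by (metis add_pos_nonneg less_numeral_extra(1,3) zero_le_power2)
  then show "continuous_on UNIV (sobolev_weight s :: real^'n \<Rightarrow> complex)"
    unfolding sobolev_weight_def by (intro continuous_intros) auto
qed

lemma sobolev_weight_mult_L2:
  assumes "s \<le> 0" "\<psi> \<in> L2 \<alpha>"
  shows "(\<lambda>x. sobolev_weight s x * \<psi> x) \<in> L2 \<alpha>"
proof -
  have m[measurable]: "\<psi> \<in> borel_measurable (mu \<alpha>)" "sobolev_weight s \<in> borel_measurable (mu \<alpha>)"
    and i: "integrable (mu \<alpha>) (\<lambda>x. (norm (\<psi> x))\<^sup>2)"
    using assms sobolev_weight_measurable by (auto simp: L2_def)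
  have "norm (sobolev_weight s x) \<le> 1" for x :: "real^'n"
  proof -
    have "(1 + (norm x)\<^sup>2) powr s \<le> (1 + (norm x)\<^sup>2) powr 0"
      using assms by (intro powr_mono) auto
    moreover have "1 + (norm x)\<^sup>2 \<noteq> 0"
      by (metis add_pos_nonneg less_numeral_extra(1,3) zero_le_power2)
    ultimately show ?thesis by (simp add: sobolev_weight_def)
  qed
  then have le: "(norm (sobolev_weight s x * \<psi> x))\<^sup>2 \<le> (norm (\<psi> x))\<^sup>2" for x
    unfolding norm_mult by (intro power_mono mult_left_le_one_le) auto
  have "integrable (mu \<alpha>) (\<lambda>x. (norm (sobolev_weight s x * \<psi> x))\<^sup>2)"
    by (rule Bochner_Integration.integrable_bound[OF i]) (use le in auto)
  then show ?thesis by (simp add: L2_def)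
qed

text \<open>A weight can be shifted from the representing function to the test function, because
  weights preserve \<open>S_even\<close>.\<close>

lemma represents_lower_weight:
  assumes rep: "represents \<alpha> \<psi> (mult_distr (sobolev_weight s) (fourier_bessel_distr \<alpha> T))"
  shows "represents \<alpha> (\<lambda>x. sobolev_weight (t - s) x * \<psi> x) (mult_distr (sobolev_weight t) (fourier_bessel_distr \<alpha> T))"
  unfolding represents_def
proof
  fix \<phi> :: "real^'n \<Rightarrow> complex" assume \<phi>: "\<phi> \<in> S_even"
  have "(\<lambda>x. sobolev_weight (t - s) x * \<phi> x) \<in> S_even"
    by (rule sobolev_weight_mult_S_even[OF \<phi>])
  then have "mult_distr (sobolev_weight s) (fourier_bessel_distr \<alpha> T) (\<lambda>x. sobolev_weight (t - s) x * \<phi> x) =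
      distr_of_fun \<alpha> \<psi> (\<lambda>x. sobolev_weight (t - s) x * \<phi> x)"
    using rep unfolding represents_def by blast
  moreover have "sobolev_weight s x * (sobolev_weight (t - s) x * \<phi> x) = sobolev_weight t x * \<phi> x" for x
    unfolding mult.assoc[symmetric] sobolev_weight_mult by simp
  moreover have "\<psi> x * (sobolev_weight (t - s) x * \<phi> x) = sobolev_weight (t - s) x * \<psi> x * \<phi> x" for x
    by (simp only: mult_ac)
  ultimately show "mult_distr (sobolev_weight t) (fourier_bessel_distr \<alpha> T) \<phi> =
      distr_of_fun \<alpha> (\<lambda>x. sobolev_weight (t - s) x * \<psi> x) \<phi>"
    by (simp only: mult_distr_def distr_of_fun_def)
qed

end

text \<open>Here \<open>v\<close> stands for \<open>1 + (norm x)\<^sup>2\<close>, \<open>b\<close>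
  for \<open>1 + R\<^sup>2\<close> and \<open>N\<close> for the squared modulus of
  \<open>\<psi>\<close>. Below the threshold the comparison is with the transform of
  \<open>T\<close> itself, above it with \<open>\<psi>\<close>. It is used with exponent 0, to
  absorb the low frequencies, and with the given \<open>t\<close>.\<close>

lemma weight_split:
  fixes v b N :: real
  assumes "1 \<le> v" "1 \<le> b" "0 \<le> t" "t \<le> s" "0 \<le> N"
  shows "(v powr (t - s))\<^sup>2 * N \<le>
    b powr (2 * t) * (if v \<le> b then (v powr (- s))\<^sup>2 * N else 0) + b powr (2 * (t - s)) * N"
proof (cases "v \<le> b")
  case True
  have "(v powr (t - s))\<^sup>2 = v powr (2 * t) * (v powr (- s))\<^sup>2"
    using assms by (simp add: power2_eq_square flip: powr_add)
  also have "\<dots> \<le> b powr (2 * t) * (v powr (- s))\<^sup>2"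
    using True assms by (intro mult_right_mono powr_mono2) auto
  finally have "(v powr (t - s))\<^sup>2 * N \<le> b powr (2 * t) * (v powr (- s))\<^sup>2 * N"
    using assms by (intro mult_right_mono)
  moreover have "0 \<le> b powr (2 * (t - s)) * N" using assms by simp
  ultimately show ?thesis using True by (simp add: mult.assoc)
next
  case False
  have "(v powr (t - s))\<^sup>2 = v powr (2 * (t - s))"
    using assms by (simp add: power2_eq_square flip: powr_add)
  also have "\<dots> \<le> b powr (2 * (t - s))"
    using False assms by (intro powr_mono2') auto
  finally show ?thesis using False assms by (simp add: mult_right_mono)
qed

theorem theorem24:
  fixes \<alpha> :: "real^'n::finite" and s t :: real
  assumes "\<And>i. \<alpha> $ i > - 1/2" and "0 \<le> t" and "t \<le> s"
  shows "\<exists>C>0. \<forall>\<epsilon>>0. \<forall>T\<in>sobolev_supp \<alpha> s \<epsilon>.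
           sobolev_norm \<alpha> t T \<le> C * \<epsilon> powr (2 * (s - t)) * sobolev_norm \<alpha> s T"
proof -
  have \<alpha>: "- 1 / 2 < \<alpha> $ i" for i using assms(1)[of i] by simp
  obtain B where B: "0 \<le> B" "\<And>c x. 0 < c \<Longrightarrow> (cube_cutoff c (x :: real^'n))\<^sup>2 \<le> B * gauss (\<chi> i. 1 / (2 * c)) x"
    using cutoff_square_le by blast
  \<comment> \<open>Chosen so that \<open>2 * (B * c)\<close> is at most the square of
    \<open>1 / (2 * exp 1)\<close>: the low-frequency share becomes at most one half even after the
    loss of \<open>exp 1\<close> below.\<close>
  define c where "c = 1 / (8 * (exp 1)\<^sup>2 * (B + 1))"
  have den: "1 \<le> 8 * (exp 1)\<^sup>2 * (B + 1)"
  proof -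
    have "1 * 1 \<le> 8 * (exp (1::real))\<^sup>2"
      by (intro mult_mono one_le_power) auto
    then have "1 * 1 \<le> (8 * (exp 1)\<^sup>2) * (B + 1)"
      using B(1) by (intro mult_mono) auto
    then show ?thesis by simp
  qed
  have den_pos: "0 < 8 * (exp 1)\<^sup>2 * (B + 1)" using den by linarith
  have c: "0 < c" "c \<le> 1"
    using divide_pos_pos[OF zero_less_one den_pos] divide_le_eq_1_pos[OF den_pos, of 1] den
    by (simp_all only: c_def)
  have Bc: "exp 1 * sqrt (2 * (B * c)) \<le> 1 / 2"
  proof -
    have "2 * (B * c) \<le> 1 / (4 * (exp 1)\<^sup>2)"
    proof -
      have "2 * (B * c) = 1 / (4 * (exp 1)\<^sup>2) * (B / (B + 1))"
      proof -
        have "2 * (B * (1 / (8 * E * D))) = 1 / (4 * E) * (B / D)" for E D :: real by simp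
        then show ?thesis unfolding c_def .
      qed
      also have "\<dots> \<le> 1 / (4 * (exp 1)\<^sup>2) * 1"
        using B(1) by (intro mult_left_mono) auto
      finally show ?thesis by simp
    qed
    then have "sqrt (2 * (B * c)) \<le> sqrt ((1 / (2 * exp 1))\<^sup>2)"
      by (intro real_sqrt_le_mono) (simp add: power_divide power_mult_distrib)
    then have "sqrt (2 * (B * c)) \<le> 1 / (2 * exp 1)" by simp
    then show ?thesis by (simp add: field_simps)
  qed
  have "0 < \<alpha> $ i + 1" for i using \<alpha>[of i] by simp
  then have cc: "0 \<le> c_const \<alpha>"
    unfolding c_const_def
    by (intro divide_nonneg_nonneg prod_nonneg powr_ge_zero ballI less_imp_le[OF Gamma_real_pos])
  \<comment> \<open>The root comes from adding equal bounds for low and high frequencies, the power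
    of \<open>c\<close> from \<open>R = c / \<epsilon>\<close>.\<close>
  define C where "C = sqrt 2 * c powr (- 2 * (s - t))"
  have "0 < C" using c by (simp add: C_def)
  moreover have "sobolev_norm \<alpha> t T \<le> C * \<epsilon> powr (2 * (s - t)) * sobolev_norm \<alpha> s T"
    if \<epsilon>: "0 < \<epsilon>" and T: "T \<in> sobolev_supp \<alpha> s \<epsilon>" for \<epsilon> T
  proof -
    have Tt: "T \<in> tempered_even" and supp: "supported_in T (cball 0 \<epsilon>)"
      using T by (auto simp: sobolev_supp_def sobolev_def)
    obtain \<psi> where \<psi>: "\<psi> \<in> L2 \<alpha>"
      and rep: "represents \<alpha> \<psi> (mult_distr (sobolev_weight s) (fourier_bessel_distr \<alpha> T))"
      using T by (auto simp: sobolev_supp_def sobolev_def)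
    have s: "0 \<le> s" using assms by simp
    \<comment> \<open>Weight 0 gives the transform of \<open>T\<close> itself; it is
      square-integrable because \<open>s \<ge> 0\<close>.\<close>
    define g where "g = (\<lambda>x. sobolev_weight (0 - s) x * \<psi> x)"
    have g: "g \<in> L2 \<alpha>" unfolding g_def using s by (intro sobolev_weight_mult_L2[OF \<alpha>] \<psi>) simp
    define f where "f = (\<lambda>x. sobolev_weight (t - s) x * \<psi> x)"
    have f: "f \<in> L2 \<alpha>" unfolding f_def using assms by (intro sobolev_weight_mult_L2[OF \<alpha>] \<psi>) simp
    have rep_g: "T (fourier_bessel \<alpha> p) = (\<integral>x. g x * p x \<partial>mu \<alpha>)" if "p \<in> gauss_span" for p
    proof -
      have "represents \<alpha> g (mult_distr (sobolev_weight 0) (fourier_bessel_distr \<alpha> T))"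
        unfolding g_def by (rule represents_lower_weight[OF \<alpha> rep])
      moreover have "sobolev_weight 0 x = 1" for x :: "real^'n"
      proof -
        have "1 + (norm x)\<^sup>2 \<noteq> 0" by (metis add_pos_nonneg less_numeral_extra(1,3) zero_le_power2)
        then show ?thesis by (simp add: sobolev_weight_def)
      qed
      ultimately show ?thesis
        using gauss_span_S_even[OF that]
        by (auto simp: represents_def distr_of_fun_def mult_distr_def fourier_bessel_distr_def)
    qed
    define R where "R = c / \<epsilon>"
    have R: "\<epsilon> * R = c" "0 < R" using \<epsilon> c by (auto simp: R_def)
    have \<psi>i: "integrable (mu \<alpha>) (\<lambda>x. (norm (\<psi> x))\<^sup>2)" and gi: "integrable (mu \<alpha>) (\<lambda>x. (norm (g x))\<^sup>2)"
      and fi: "integrable (mu \<alpha>) (\<lambda>x. (norm (f x))\<^sup>2)"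
      using \<psi> g f by (auto simp: L2_def)
    have gm[measurable]: "g \<in> borel_measurable (mu \<alpha>)" using g by (simp add: L2_def)
    define A where "A = (\<integral>x. (norm (\<psi> x))\<^sup>2 \<partial>mu \<alpha>)"
    define N where "N = (\<integral>x. (norm (g x))\<^sup>2 \<partial>mu \<alpha>)"
    define b where "b = 1 + R\<^sup>2"
    have b: "1 \<le> b" by (simp add: b_def)
    let ?v = "\<lambda>x::real^'n. 1 + (norm x)\<^sup>2"
    let ?low = "\<lambda>x. if ?v x \<le> b then (norm (g x))\<^sup>2 else 0"
    have v: "1 \<le> ?v x" for x by simp
    have norm_g: "(norm (g x))\<^sup>2 = (?v x powr (- s))\<^sup>2 * (norm (\<psi> x))\<^sup>2" for x
      by (simp add: g_def sobolev_weight_def norm_mult power_mult_distrib)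
    have norm_f: "(norm (f x))\<^sup>2 = (?v x powr (t - s))\<^sup>2 * (norm (\<psi> x))\<^sup>2" for x
      by (simp add: f_def sobolev_weight_def norm_mult power_mult_distrib)
    have vm: "{x \<in> space (mu \<alpha>). ?v x \<le> b} \<in> sets (mu \<alpha>)"
    proof -
      have [measurable]: "?v \<in> borel_measurable (mu \<alpha>)"
        by (intro measurable_mu borel_measurable_continuous_onI continuous_intros)
      show ?thesis by measurable
    qed
    have low_m: "?low \<in> borel_measurable (mu \<alpha>)"
      using vm by (intro measurable_If) auto
    have low_i: "integrable (mu \<alpha>) ?low"
      by (rule Bochner_Integration.integrable_bound[OF gi low_m]) auto
    have low: "(\<integral>x. ?low x \<partial>mu \<alpha>) \<le> N / 2"
    proof -
      have \<gamma>i: "integrable (mu \<alpha>) (\<lambda>x. (norm (g x))\<^sup>2 * gauss (\<chi> i. 1 / R\<^sup>2) x)"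
      proof (rule Bochner_Integration.integrable_bound[OF gi])
        have [measurable]: "(\<lambda>x. gauss (\<chi> i. 1 / R\<^sup>2) x) \<in> borel_measurable (mu \<alpha>)"
          by (rule gauss_measurable)
        show "(\<lambda>x. (norm (g x))\<^sup>2 * gauss (\<chi> i. 1 / R\<^sup>2) x) \<in> borel_measurable (mu \<alpha>)" by measurable
        have "0 \<le> gauss (\<chi> i. 1 / R\<^sup>2) x \<and> gauss (\<chi> i. 1 / R\<^sup>2) x \<le> 1" for x :: "real^'n"
          by (auto simp: gauss_def intro!: sum_nonneg)
        then show "AE x in mu \<alpha>. norm ((norm (g x))\<^sup>2 * gauss (\<chi> i. 1 / R\<^sup>2) x) \<le> norm ((norm (g x))\<^sup>2)"
          by (intro AE_I2) (auto simp: abs_mult intro!: mult_left_le)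
      qed
      have "?low x \<le> exp 1 * ((norm (g x))\<^sup>2 * gauss (\<chi> i. 1 / R\<^sup>2) x)" for x
      proof (cases "?v x \<le> b")
        case True
        \<comment> \<open>On the ball of radius \<open>R\<close> the Gaussian is at least
          \<open>exp (- 1)\<close>, so the factor \<open>exp 1\<close> lets it replace the indicator
          of the ball.\<close>
        then have "(norm x)\<^sup>2 / R\<^sup>2 \<le> 1" using R(2) by (simp add: b_def)
        then have "0 \<le> 1 + (- (1 / R\<^sup>2) * (norm x)\<^sup>2)" by simp
        then have "1 \<le> exp 1 * gauss (\<chi> i. 1 / R\<^sup>2) x"
          unfolding gauss_const exp_add[symmetric] by simp
        then have "(norm (g x))\<^sup>2 * 1 \<le> (norm (g x))\<^sup>2 * (exp 1 * gauss (\<chi> i. 1 / R\<^sup>2) x)"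
          by (rule mult_left_mono) simp
        then show ?thesis using True by (simp add: mult_ac)
      next
        case False
        then show ?thesis using gauss_pos[of "\<chi> i. 1 / R\<^sup>2" x] by (simp add: less_imp_le)
      qed
      then have "(\<integral>x. ?low x \<partial>mu \<alpha>) \<le> (\<integral>x. exp 1 * ((norm (g x))\<^sup>2 * gauss (\<chi> i. 1 / R\<^sup>2) x) \<partial>mu \<alpha>)"
        by (intro integral_mono low_i integrable_mult_right \<gamma>i)
      also have "\<dots> = exp 1 * (\<integral>x. (norm (g x))\<^sup>2 * gauss (\<chi> i. 1 / R\<^sup>2) x \<partial>mu \<alpha>)"
        by simp
      also have "\<dots> \<le> exp 1 * (sqrt (2 * (B * c)) * N)"
        unfolding N_def
        by (intro mult_left_mono low_frequency_bound[OF \<alpha> B Tt supp \<epsilon> g rep_g c R(1)]) auto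
      also have "\<dots> \<le> 1 / 2 * N"
      proof -
        have "0 \<le> N" by (simp add: N_def)
        from mult_right_mono[OF Bc this] show ?thesis by (simp only: mult.assoc)
      qed
      finally show ?thesis by simp
    qed
    \<comment> \<open>Absorption: \<open>N\<close> is finite and at most \<open>N / 2\<close> of it
      lies in the ball, so the part outside controls \<open>N\<close>.\<close>
    have N_le: "N / 2 \<le> b powr (- 2 * s) * A"
    proof -
      have "(norm (g x))\<^sup>2 \<le> 1 * ?low x + b powr (- 2 * s) * (norm (\<psi> x))\<^sup>2" for x
        using weight_split[OF v[of x] b order_refl s zero_le_power2[of "norm (\<psi> x)"]] b
        by (simp add: norm_g split: if_splits)
      then have "N \<le> (\<integral>x. 1 * ?low x + b powr (- 2 * s) * (norm (\<psi> x))\<^sup>2 \<partial>mu \<alpha>)"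
        unfolding N_def
        by (intro integral_mono gi Bochner_Integration.integrable_add integrable_mult_right low_i \<psi>i)
      also have "\<dots> = (\<integral>x. ?low x \<partial>mu \<alpha>) + b powr (- 2 * s) * A"
        unfolding A_def using low_i \<psi>i by simp
      finally show ?thesis using low by linarith
    qed
    have "(\<integral>x. (norm (f x))\<^sup>2 \<partial>mu \<alpha>) \<le> (\<integral>x. b powr (2 * t) * ?low x + b powr (2 * (t - s)) * (norm (\<psi> x))\<^sup>2 \<partial>mu \<alpha>)"
    proof (intro integral_mono fi Bochner_Integration.integrable_add integrable_mult_right low_i \<psi>i)
      fix x
      show "(norm (f x))\<^sup>2 \<le> b powr (2 * t) * ?low x + b powr (2 * (t - s)) * (norm (\<psi> x))\<^sup>2"
        using weight_split[OF v[of x] b assms(2,3) zero_le_power2[of "norm (\<psi> x)"]]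
        by (simp only: norm_g norm_f)
    qed
    also have "\<dots> = b powr (2 * t) * (\<integral>x. ?low x \<partial>mu \<alpha>) + b powr (2 * (t - s)) * A"
      unfolding A_def using low_i \<psi>i by simp
    \<comment> \<open>The low-frequency integral is at most \<open>N / 2\<close>, hence bounded
      through the high frequencies by \<open>N_le\<close>.\<close>
    also have "\<dots> \<le> b powr (2 * t) * (b powr (- 2 * s) * A) + b powr (2 * (t - s)) * A"
      using low N_le by (intro add_mono mult_left_mono) auto
    also have "\<dots> = 2 * (b powr (2 * (t - s)) * A)"
    proof -
      have "b powr (2 * t) * b powr (- 2 * s) = b powr (2 * (t - s))"
        unfolding powr_add[symmetric] by (simp add: algebra_simps)
      then show ?thesis by (simp add: mult.assoc[symmetric])
    qed
    \<comment> \<open>The exponent is nonpositive and \<open>b \<ge> R\<^sup>2\<close>. Dropping the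
      1 in \<open>b\<close> yields a pure power of \<open>R\<close>, hence of
      \<open>\<epsilon>\<close>.\<close>
    also have "\<dots> \<le> 2 * ((R\<^sup>2) powr (2 * (t - s)) * A)"
      using R(2) assms by (intro mult_left_mono mult_right_mono powr_mono2') (auto simp: b_def A_def)
    finally have main: "(\<integral>x. (norm (f x))\<^sup>2 \<partial>mu \<alpha>) \<le> 2 * ((R\<^sup>2) powr (2 * (t - s)) * A)" .
    have "L2_alpha_norm \<alpha> f \<le> sqrt (2 * ((R\<^sup>2) powr (2 * (t - s)) * A))"
      unfolding L2_alpha_norm_def by (rule real_sqrt_le_mono[OF main])
    also have "\<dots> = sqrt 2 * (R powr (2 * (t - s)) * L2_alpha_norm \<alpha> \<psi>)"
    proof -
      have "(R\<^sup>2) powr (2 * (t - s)) = (R powr (2 * (t - s)))\<^sup>2"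
        using R(2) by (simp add: power2_eq_square powr_mult)
      then have "sqrt ((R\<^sup>2) powr (2 * (t - s))) = R powr (2 * (t - s))" by simp
      then show ?thesis
        unfolding L2_alpha_norm_def A_def[symmetric] by (simp only: real_sqrt_mult)
    qed
    also have "R powr (2 * (t - s)) = c powr (- 2 * (s - t)) * \<epsilon> powr (2 * (s - t))"
    proof -
      have "R powr (2 * (t - s)) = c powr (2 * (t - s)) / \<epsilon> powr (2 * (t - s))"
        unfolding R_def by (rule powr_divide)
      moreover have "- 2 * (s - t) = 2 * (t - s)" "2 * (s - t) = - (2 * (t - s))"
        by (simp_all add: algebra_simps)
      ultimately show ?thesis by (simp only: powr_minus divide_inverse)
    qed
    finally have "L2_alpha_norm \<alpha> f \<le> C * \<epsilon> powr (2 * (s - t)) * L2_alpha_norm \<alpha> \<psi>"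
      by (simp only: C_def mult.assoc)
    then have "c_const \<alpha> * L2_alpha_norm \<alpha> f \<le> c_const \<alpha> * (C * \<epsilon> powr (2 * (s - t)) * L2_alpha_norm \<alpha> \<psi>)"
      by (rule mult_left_mono[OF _ cc])
    moreover have "sobolev_norm \<alpha> t T = c_const \<alpha> * L2_alpha_norm \<alpha> f"
      by (rule sobolev_norm_eq[OF \<alpha> f]) (unfold f_def, rule represents_lower_weight[OF \<alpha> rep])
    moreover have "sobolev_norm \<alpha> s T = c_const \<alpha> * L2_alpha_norm \<alpha> \<psi>"
      by (rule sobolev_norm_eq[OF \<alpha> \<psi> rep])
    ultimately show ?thesis by (simp only: mult_ac)
  qed
  ultimately show ?thesis by blast
qed

end
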